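(* Let $\varrho:\mathbb{R}\to\mathbb{R}$ be an activation function satisfying the Product Hypothesis, with fixed family $(\Pi^{\varrho}_{\varepsilon,K})_{\varepsilon,K>0}$. Let $\varepsilon>0$, $\alpha\in\mathbb{R}$, $\delta\in(0,1)$ and $n\in\mathbb{N}$. Set $$N(\varepsilon,\delta)=\max\left\{\left\lceil\log_2\left(\frac{\log_2(\varepsilon(1-\delta))}{\log_2(\delta)}\right)\right\rceil,1\right\},\qquad \Sigma(\varepsilon,\delta,n)=2^{-2^{N(\varepsilon,\delta)}}\,\frac{\min\{\varepsilon,1/4\}}{16n^3}.$$ Then there exists a $\varrho$-MNN $\Phi^{\mathrm{INV}^{\alpha}_{n,\varrho}}_{\varepsilon,\delta}$ satisfying $$\left\|A^{-1}-R\left(\Phi^{\mathrm{INV}^{\alpha}_{n,\varrho}}_{\varepsilon,\delta}\right)(A)\right\|_2\le\varepsilon$$ for all $A\in\mathbb{R}^{n\times n}$ such that $\|\mathrm{I}_n-\alpha A\|_2\le\delta$, and satisfying: (i) if $N\left(\frac{\varepsilon}{2\alpha},\delta\right)\ge2$, $$\begin{aligned}M\left(\Phi^{\mathrm{INV}^{\alpha}_{n,\varrho}}_{\varepsilon,\delta}\right)&\le14\,n^{\log_2 7}\left(N\left(\tfrac{\varepsilon}{2\alpha},\delta\right)-1\right)\left(M\left(\Pi^{\varrho}_{\Sigma(\varepsilon/\alpha,\delta,n),\,2n}\right)+12\right)\\&\quad+n^2\left(L\left(\Pi^{\varrho}_{\Sigma(\varepsilon/\alpha,\delta,n),\,2n}\right)-14N\left(\tfrac{\varepsilon}{2\alpha},\delta\right)+20+2\log_2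 n\right)\\&\quad+n\left(N\left(\tfrac{\varepsilon}{2\alpha},\delta\right)+1\right),\\ L\left(\Phi^{\mathrm{INV}^{\alpha}_{n,\varrho}}_{\varepsilon,\delta}\right)&\le N\left(\tfrac{\varepsilon}{2\alpha},\delta\right)\left[2\log_2 n+5+L\left(\Pi^{\varrho}_{\Sigma(\varepsilon/\alpha,\delta,n),\,2n}\right)\right];\end{aligned}$$ (ii) if $N\left(\frac{\varepsilon}{2\alpha},\delta\right)=1$, $$M\left(\Phi^{\mathrm{INV}^{\alpha}_{n,\varrho}}_{\varepsilon,\delta}\right)=2(n^2+n),\qquad L\left(\Phi^{\mathrm{INV}^{\alpha}_{n,\varrho}}_{\varepsilon,\delta}\right)=2.$$
   Context: Notation. $\mathrm{I}_n$ is the $n\times n$ identity matrix; $\|\cdot\|_2$ is the matrix norm induced by the Euclidean norm. For a matrix or tensor $T$, $\mathrm{n_W}(T)$ is its number of nonzero entries. A tensor $\mathcal{L}\in\mathbb{R}^{(n_1\times n_2)\times(n_3\times n_4)}$ acts on $A\in\mathbb{R}^{n_3\times n_4}$ by $(\mathcal{L}A)_{i,j}=\sum_{k,l}\mathcal{L}_{i,j,k,l}A_{k,l}$. Matrix Neural Networks. A $\varrho$-MNN is a tuple $\Phi=((\mathcal{L}^1,C^1,\alpha^1),\dots,(\mathcal{L}^L,C^L,\alpha^L))$ where $\mathcal{L}^\ell$ is an $(N^{\ell,1}\times N^{\ell,2})\times(N^{\ell-1,1}\times N^{\ell-1,2})$ tensor, $C^\ell$ is an $N^{\ell,1}\times N^{\ell,2}$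 matrix, and $\alpha^\ell$ acts entrywise on $N^{\ell,1}\times N^{\ell,2}$ matrices by functions $\alpha^\ell_{i,j}\in\{\mathrm{id},\varrho\}$ if $\ell<L$, while $\alpha^L=\mathrm{id}$. Its realization is $R(\Phi)(A)=A_L$, where $A_0=A$ and $A_\ell=\alpha^\ell(\mathcal{L}^\ell A_{\ell-1}+C^\ell)$. Its number of layers is $L(\Phi)=L$ and its number of weights is $M(\Phi)=\sum_{\ell=1}^{L}(\mathrm{n_W}(\mathcal{L}^\ell)+\mathrm{n_W}(C^\ell))$. Product Hypothesis. For all $K,\varepsilon>0$ there is a $\varrho$-MNN $\Pi^{\varrho}_{\varepsilon,K}$ (with input a pair of scalars $(x,y)$, seen as a $1\times2$ matrix) such that $\sup_{(x,y)\in[-K,K]^2}|xy-R(\Pi^{\varrho}_{\varepsilon,K})(x,y)|\le\varepsilon$. One such network is fixed for each $\varepsilon,K$.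
   Formalization: Bounds (i) and (ii) are claimed only for α > 0, since N(ε/(2α),δ) and Σ(ε/α,δ,n) are undefined for α ≤ 0 (log of a negative number, division by zero); the outer log₂ of a nonpositive number is read as −∞, so N = 1 there; n ≥ 1. *)

theory Defs
  imports Complex_Main "Jordan_Normal_Form.Matrix"
begin

definition vec_norm2 :: "real vec \<Rightarrow> real" where
  "vec_norm2 v = sqrt (v \<bullet> v)"

definition mat_norm2 :: "real mat \<Rightarrow> real" where
  "mat_norm2 A = Sup {vec_norm2 (A *\<^sub>v v) | v. v \<in> carrier_vec (dim_col A) \<and> vec_norm2 v \<le> 1}"

(* The entry T_(i,j,k,l) of a tensor is T $$ (i,j) $$ (k,l). *)
type_synonym tensor = "real mat mat"

definition carrier_tensor :: "nat \<Rightarrow> nat \<Rightarrow> nat \<Rightarrow> nat \<Rightarrow> tensor set" where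
  "carrier_tensor n1 n2 n3 n4 =
    {T \<in> carrier_mat n1 n2. \<forall>i<n1. \<forall>j<n2. T $$ (i,j) \<in> carrier_mat n3 n4}"

definition tensor_apply :: "tensor \<Rightarrow> real mat \<Rightarrow> real mat" where
  "tensor_apply T A = mat (dim_row T) (dim_col T)
    (\<lambda>(i,j). \<Sum>k<dim_row A. \<Sum>l<dim_col A. T $$ (i,j) $$ (k,l) * A $$ (k,l))"

definition nonzeros_mat :: "real mat \<Rightarrow> nat" where
  "nonzeros_mat C = card {(i,j). i < dim_row C \<and> j < dim_col C \<and> C $$ (i,j) \<noteq> 0}"

definition nonzeros_tensor :: "tensor \<Rightarrow> nat" where
  "nonzeros_tensor T = card {(i,j,k,l). i < dim_row T \<and> j < dim_col T \<and>
     k < dim_row (T $$ (i,j)) \<and> l < dim_col (T $$ (i,j)) \<and> T $$ (i,j) $$ (k,l) \<noteq> 0}"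

definition act_apply :: "(real \<Rightarrow> real) mat \<Rightarrow> real mat \<Rightarrow> real mat" where
  "act_apply a A = mat (dim_row A) (dim_col A) (\<lambda>(i,j). (a $$ (i,j)) (A $$ (i,j)))"

(* List position l (starting at 0) holds the layer with index l + 1. *)
type_synonym mnn = "(tensor \<times> real mat \<times> (real \<Rightarrow> real) mat) list"

(* \<Phi> is a \<rho>-MNN with m x n inputs and p x q outputs; all dimensions are positive. *)
definition is_mnn :: "(real \<Rightarrow> real) \<Rightarrow> nat \<times> nat \<Rightarrow> nat \<times> nat \<Rightarrow> mnn \<Rightarrow> bool" where
  "is_mnn \<rho> d_in d_out \<Phi> \<longleftrightarrow> \<Phi> \<noteq> [] \<and>
    (\<exists>N1 N2 :: nat \<Rightarrow> nat.
       (N1 0, N2 0) = d_in \<and> (N1 (length \<Phi>), N2 (length \<Phi>)) = d_out \<and>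
       (\<forall>l\<le>length \<Phi>. 0 < N1 l \<and> 0 < N2 l) \<and>
       (\<forall>l<length \<Phi>. case \<Phi> ! l of (T, C, a) \<Rightarrow>
          T \<in> carrier_tensor (N1 (Suc l)) (N2 (Suc l)) (N1 l) (N2 l) \<and>
          C \<in> carrier_mat (N1 (Suc l)) (N2 (Suc l)) \<and>
          a \<in> carrier_mat (N1 (Suc l)) (N2 (Suc l)) \<and>
          (\<forall>i<N1 (Suc l). \<forall>j<N2 (Suc l).
             a $$ (i,j) \<in> (if Suc l < length \<Phi> then {id, \<rho>} else {id}))))"

definition realization :: "mnn \<Rightarrow> real mat \<Rightarrow> real mat" where
  "realization \<Phi> A = fold (\<lambda>(T, C, a) B. act_apply a (tensor_apply T B + C)) \<Phi> A"

definition num_layers :: "mnn \<Rightarrow> nat" where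
  "num_layers \<Phi> = length \<Phi>"

definition num_weights :: "mnn \<Rightarrow> nat" where
  "num_weights \<Phi> = (\<Sum>(T, C, a)\<leftarrow>\<Phi>. nonzeros_tensor T + nonzeros_mat C)"

definition product_hypothesis :: "(real \<Rightarrow> real) \<Rightarrow> (real \<Rightarrow> real \<Rightarrow> mnn) \<Rightarrow> bool" where
  "product_hypothesis \<rho> \<Psi> \<longleftrightarrow>
    (\<forall>\<epsilon>>0. \<forall>K>0. is_mnn \<rho> (1, 2) (1, 1) (\<Psi> \<epsilon> K) \<and>
      (\<forall>x\<in>{-K..K}. \<forall>y\<in>{-K..K}.
         \<bar>x * y - realization (\<Psi> \<epsilon> K) (mat_of_rows_list 2 [[x, y]]) $$ (0,0)\<bar> \<le> \<epsilon>))"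

(* If \<epsilon> (1 - \<delta>) \<ge> 1, the argument of the outer logarithm is nonpositive and the logarithm is
   read as minus infinity, so that the maximum is 1. This case has to be separated because
   log 2 of a negative x is log 2 (-x) in the library. *)
definition N_inv :: "real \<Rightarrow> real \<Rightarrow> nat" where
  "N_inv \<epsilon> \<delta> =
    (let r = log 2 (\<epsilon> * (1 - \<delta>)) / log 2 \<delta>
     in if r \<le> 0 then 1 else nat (max \<lceil>log 2 r\<rceil> 1))"

definition Sigma_inv :: "real \<Rightarrow> real \<Rightarrow> nat \<Rightarrow> real" where
  "Sigma_inv \<epsilon> \<delta> n = 1 / 2 ^ (2 ^ N_inv \<epsilon> \<delta>) * (min \<epsilon> (1/4) / (16 * real n ^ 3))"

end

(* With X = I - alpha A one has A^{-1} = alpha (I - X)^{-1}, and the partial Neumann sums are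
   S_N = sum_{l < 2^N} X^l = prod_{j < N} (I + X^(2^j)) with error X^(2^N) (I - X)^{-1}. A network
   for S_N therefore performs N - 1 squarings and N - 1 further products. The products are carried
   out by Strassen's algorithm, two linear layers per level of the recursion, with copies of the
   scalar product network P at the bottom: after padding to size 2^k <= 2 n this costs
   7^k (M(P) + 12) - 12 * 4^k weights and adds an error of at most 4^k Sigma to every entry.
   The partial sums are rescaled to T_j = 2^{-j} S_j, and Sigma is so small that all computed
   matrices keep operator norm at most one, hence their entries stay in the range of P.

   Since Sigma depends on N(eps/alpha) and not on N(eps/(2 alpha)), which can be much larger, the
   construction is only used if eps (1 - delta) / alpha <= 1/2, when the two differ by at most
   one. Otherwise a constant network is accurate enough. *)

theory Submission
  imports Defs "HOL-Analysis.L2_Norm" "Jordan_Normal_Form.Determinant"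
begin

section \<open>Networks and realizable maps\<close>

text \<open>The factor I + X is affine in A, so the first round needs only the squaring of X and the
  last round only a product. With N = m + 2 rounds this makes 1 + 2 m + 1 = 2 (N - 1) products, each
  with leading cost 7^k (M(P) + 12) and 7^k <= 7 n^(log2 7), which is the origin of the constant 14.
  Stability rests on one invariant. Let eta bound the operator norm error of one product. A computed
  square of a matrix of norm at most q has norm at most q^2 + eta, and this is at most q again if
  1/2 <= q and eta <= (1 - q)/2. Hence q = max(delta, 1/2) is used instead of delta: for small delta
  a fixed eta could exceed delta - delta^2. The range 2 n of P arises because entries bounded by 1
  can double at each of the k levels, and 2^k <= 2 n. Half of eps pays for the truncation of the
  series, the other half for inexact products. A constant can be accurate enough because the inverse
  lies within |alpha| delta/(1 - delta^2) <= |alpha|/(2 (1 - delta)) of a fixed multiple of I. The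
  construction is made with |alpha|, which covers negative alpha; for alpha = 0 no matrix satisfies
  the hypothesis.\<close>

definition fits_layer :: "(real \<Rightarrow> real) \<Rightarrow> nat \<times> nat \<Rightarrow> nat \<times> nat \<Rightarrow>
    tensor \<times> real mat \<times> (real \<Rightarrow> real) mat \<Rightarrow> bool" where
  "fits_layer \<rho> d e X \<longleftrightarrow> 0 < fst e \<and> 0 < snd e \<and> (case X of (T, C, a) \<Rightarrow>
      T \<in> carrier_tensor (fst e) (snd e) (fst d) (snd d) \<and>
      C \<in> carrier_mat (fst e) (snd e) \<and> a \<in> carrier_mat (fst e) (snd e) \<and>
      (\<forall>i<fst e. \<forall>j<snd e. a $$ (i,j) \<in> {id, \<rho>}))"

text \<open>Unlike \<open>is_mnn\<close>, this singles out no last layer and admits the empty list,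
  so that chains are closed under concatenation.\<close>

primrec chain :: "(real \<Rightarrow> real) \<Rightarrow> nat \<times> nat \<Rightarrow> nat \<times> nat \<Rightarrow> mnn \<Rightarrow> bool" where
  "chain \<rho> d d' [] \<longleftrightarrow> d = d'"
| "chain \<rho> d d' (X # \<Phi>) \<longleftrightarrow> (\<exists>e. fits_layer \<rho> d e X \<and> chain \<rho> e d' \<Phi>)"

lemma chain_append:
  "chain \<rho> d d' \<Phi> \<Longrightarrow> chain \<rho> d' d'' \<Psi> \<Longrightarrow> chain \<rho> d d'' (\<Phi> @ \<Psi>)"
  by (induction \<Phi> arbitrary: d) auto

lemma num_weights_append: "num_weights (\<Phi> @ \<Psi>) = num_weights \<Phi> + num_weights \<Psi>"
  by (simp add: num_weights_def)

lemma realization_append: "realization (\<Phi> @ \<Psi>) A = realization \<Psi> (realization \<Phi> A)"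
  by (simp add: realization_def)

text \<open>The bridge to \<open>is_mnn\<close>, which speaks of a sequence of dimensions instead of
  one intermediate dimension per layer.\<close>

lemma chain_iff_dims:
  "chain \<rho> d d' \<Phi> \<longleftrightarrow> (\<exists>D. D 0 = d \<and> D (length \<Phi>) = d' \<and>
     (\<forall>l<length \<Phi>. fits_layer \<rho> (D l) (D (Suc l)) (\<Phi> ! l)))"
proof (induction \<Phi> arbitrary: d)
  case Nil
  then show ?case by (auto intro: exI[of _ "\<lambda>_. d'"])
next
  case (Cons X \<Phi>)
  show ?case
  proof
    assume "chain \<rho> d d' (X # \<Phi>)"
    then obtain e D where "fits_layer \<rho> d e X" "D 0 = e" "D (length \<Phi>) = d'"
       "\<forall>l<length \<Phi>. fits_layer \<rho> (D l) (D (Suc l)) (\<Phi> ! l)"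
      using Cons.IH by auto
    then show "\<exists>D. D 0 = d \<and> D (length (X # \<Phi>)) = d' \<and>
       (\<forall>l<length (X # \<Phi>). fits_layer \<rho> (D l) (D (Suc l)) ((X # \<Phi>) ! l))"
      by (intro exI[of _ "case_nat d D"]) (auto simp: less_Suc_eq_0_disj)
  next
    assume "\<exists>D. D 0 = d \<and> D (length (X # \<Phi>)) = d' \<and>
       (\<forall>l<length (X # \<Phi>). fits_layer \<rho> (D l) (D (Suc l)) ((X # \<Phi>) ! l))"
    then obtain D where D: "D 0 = d" "D (Suc (length \<Phi>)) = d'"
       "\<And>l. l < Suc (length \<Phi>) \<Longrightarrow> fits_layer \<rho> (D l) (D (Suc l)) ((X # \<Phi>) ! l)"
      by auto
    have "chain \<rho> (D (Suc 0)) d' \<Phi>"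
      unfolding Cons.IH using D(2) D(3)[of "Suc l" for l] by (intro exI[of _ "\<lambda>l. D (Suc l)"]) auto
    then show "chain \<rho> d d' (X # \<Phi>)"
      using D(1) D(3)[of 0] by (auto simp del: split_paired_Ex)
  qed
qed

lemma is_mnn_imp_chain:
  assumes "is_mnn \<rho> d d' \<Phi>"
  shows "chain \<rho> d d' \<Phi>"
proof -
  obtain N1 N2 where N: "(N1 0, N2 0) = d" "(N1 (length \<Phi>), N2 (length \<Phi>)) = d'"
      "\<forall>l\<le>length \<Phi>. 0 < N1 l \<and> 0 < N2 l"
      "\<forall>l<length \<Phi>. case \<Phi> ! l of (T, C, a) \<Rightarrow>
          T \<in> carrier_tensor (N1 (Suc l)) (N2 (Suc l)) (N1 l) (N2 l) \<and>
          C \<in> carrier_mat (N1 (Suc l)) (N2 (Suc l)) \<and>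
          a \<in> carrier_mat (N1 (Suc l)) (N2 (Suc l)) \<and>
          (\<forall>i<N1 (Suc l). \<forall>j<N2 (Suc l).
             a $$ (i,j) \<in> (if Suc l < length \<Phi> then {id, \<rho>} else {id}))"
    using assms unfolding is_mnn_def by blast
  have "fits_layer \<rho> (N1 l, N2 l) (N1 (Suc l), N2 (Suc l)) (\<Phi> ! l)" if l: "l < length \<Phi>" for l
  proof -
    obtain T C a where X: "\<Phi> ! l = (T, C, a)" by (metis prod_cases3)
    have "Suc l \<le> length \<Phi>" using l by simp
    then have "0 < N1 (Suc l)" "0 < N2 (Suc l)" using N(3) by blast+
    moreover have "a $$ (i,j) \<in> {id, \<rho>}" if "i < N1 (Suc l)" "j < N2 (Suc l)" for i j
    proof -
      have "a $$ (i,j) \<in> (if Suc l < length \<Phi> then {id, \<rho>} else {id})"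
        using N(4)[rule_format, OF l] X that by simp
      then show ?thesis by (cases "Suc l < length \<Phi>") auto
    qed
    ultimately show ?thesis
      using N(4)[rule_format, OF l] unfolding X by (simp add: fits_layer_def)
  qed
  then show ?thesis
    unfolding chain_iff_dims using N(1,2) by (intro exI[of _ "\<lambda>l. (N1 l, N2 l)"]) auto
qed

text \<open>What \<open>chain\<close> leaves open is supplied here: the input dimensions, since
  \<open>fits_layer\<close> makes only output dimensions positive, and the identity activation of
  the last layer.\<close>

lemma chain_imp_is_mnn:
  assumes "chain \<rho> (p, q) (p', q') \<Phi>" "\<Phi> \<noteq> []" "0 < p" "0 < q"
    and last: "\<And>i j. i < p' \<Longrightarrow> j < q' \<Longrightarrow> snd (snd (last \<Phi>)) $$ (i,j) = id"
  shows "is_mnn \<rho> (p, q) (p', q') \<Phi>"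
proof -
  obtain D where D: "D 0 = (p, q)" "D (length \<Phi>) = (p', q')"
     "\<And>l. l < length \<Phi> \<Longrightarrow> fits_layer \<rho> (D l) (D (Suc l)) (\<Phi> ! l)"
    using assms(1) unfolding chain_iff_dims by blast
  let ?N1 = "\<lambda>l. fst (D l)" and ?N2 = "\<lambda>l. snd (D l)"
  have fits: "fits_layer \<rho> (?N1 l, ?N2 l) (?N1 (Suc l), ?N2 (Suc l)) (\<Phi> ! l)"
    if "l < length \<Phi>" for l
    using D(3)[OF that] by simp
  have pos: "0 < ?N1 l \<and> 0 < ?N2 l" if "l \<le> length \<Phi>" for l
  proof (cases l)
    case 0
    then show ?thesis using D(1) assms(3,4) by simp
  next
    case (Suc k)
    then show ?thesis using fits[of k] that by (simp add: fits_layer_def)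
  qed
  have "case \<Phi> ! l of (T, C, a) \<Rightarrow>
          T \<in> carrier_tensor (?N1 (Suc l)) (?N2 (Suc l)) (?N1 l) (?N2 l) \<and>
          C \<in> carrier_mat (?N1 (Suc l)) (?N2 (Suc l)) \<and>
          a \<in> carrier_mat (?N1 (Suc l)) (?N2 (Suc l)) \<and>
          (\<forall>i<?N1 (Suc l). \<forall>j<?N2 (Suc l).
             a $$ (i,j) \<in> (if Suc l < length \<Phi> then {id, \<rho>} else {id}))"
    if l: "l < length \<Phi>" for l
  proof -
    obtain T C a where X: "\<Phi> ! l = (T, C, a)" by (metis prod_cases3)
    have "a $$ (i,j) = id" if "Suc l \<ge> length \<Phi>" "i < ?N1 (Suc l)" "j < ?N2 (Suc l)" for i j
    proof -
      have "Suc l = length \<Phi>" using l that(1) by simp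
      then have "last \<Phi> = \<Phi> ! l" using assms(2) by (metis diff_Suc_1 last_conv_nth)
      then show ?thesis using last[of i j] X D(2) \<open>Suc l = length \<Phi>\<close> that by simp
    qed
    then show ?thesis using fits[OF l] unfolding X fits_layer_def by simp
  qed
  moreover have "(?N1 0, ?N2 0) = (p, q)" "(?N1 (length \<Phi>), ?N2 (length \<Phi>)) = (p', q')"
    using D(1,2) by simp_all
  ultimately show ?thesis
    unfolding is_mnn_def using pos
    by (rule_tac conjI[OF assms(2)], rule_tac exI[of _ ?N1], rule_tac exI[of _ ?N2]) blast
qed

text \<open>The quantification over all enumerations of the index sets makes composition a mere
  concatenation of networks. The bound on the weights allows for zero or cancelling coefficients.\<close>

definition realizes :: "(real \<Rightarrow> real) \<Rightarrow> 'a set \<Rightarrow> 'b set \<Rightarrow>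
    (('a \<Rightarrow> real) \<Rightarrow> 'b \<Rightarrow> real) \<Rightarrow> nat \<Rightarrow> nat \<Rightarrow> bool" where
  "realizes \<rho> I J F w l \<longleftrightarrow> (\<forall>p q p' q' f g.
     bij_betw f ({..<p} \<times> {..<q}) I \<longrightarrow> bij_betw g ({..<p'} \<times> {..<q'}) J \<longrightarrow>
     (\<exists>\<Phi>. chain \<rho> (p, q) (p', q') \<Phi> \<and> length \<Phi> = l \<and> num_weights \<Phi> \<le> w \<and>
        (\<forall>x. realization \<Phi> (mat p q (\<lambda>ij. x (f ij))) = mat p' q' (\<lambda>ij. F x (g ij)))))"

text \<open>Intermediate data have no shape of their own; they are laid out as a single
  column.\<close>

lemma ex_bij_grid:
  assumes "finite J"
  obtains p q and f :: "nat \<times> nat \<Rightarrow> 'a" where "bij_betw f ({..<p} \<times> {..<q}) J"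
proof -
  obtain h where h: "bij_betw h {0..<card J} J"
    using ex_bij_betw_nat_finite[OF assms] by blast
  have "bij_betw fst ({..<card J} \<times> {..<1::nat}) {0..<card J}"
    by (auto simp: bij_betw_def inj_on_def)
  from bij_betw_trans[OF this h] show ?thesis by (rule that)
qed

lemma realizes_comp:
  assumes "realizes \<rho> I J F w l" "realizes \<rho> J K G w' l'" "finite J"
  shows "realizes \<rho> I K (\<lambda>x. G (F x)) (w + w') (l + l')"
  unfolding realizes_def
proof (intro allI impI)
  fix p q p' q' :: nat and f g
  assume f: "bij_betw f ({..<p} \<times> {..<q}) I" and g: "bij_betw g ({..<p'} \<times> {..<q'}) K"
  obtain p1 q1 and h :: "nat \<times> nat \<Rightarrow> 'b" where h: "bij_betw h ({..<p1} \<times> {..<q1}) J"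
    using ex_bij_grid[OF assms(3)] .
  obtain \<Phi> \<Psi> where "chain \<rho> (p, q) (p1, q1) \<Phi>" "length \<Phi> = l" "num_weights \<Phi> \<le> w"
       "\<forall>x. realization \<Phi> (mat p q (\<lambda>ij. x (f ij))) = mat p1 q1 (\<lambda>ij. F x (h ij))"
    and "chain \<rho> (p1, q1) (p', q') \<Psi>" "length \<Psi> = l'" "num_weights \<Psi> \<le> w'"
       "\<forall>x. realization \<Psi> (mat p1 q1 (\<lambda>ij. x (h ij))) = mat p' q' (\<lambda>ij. G x (g ij))"
    using assms(1,2) f g h unfolding realizes_def by meson
  then show "\<exists>\<Phi>. chain \<rho> (p, q) (p', q') \<Phi> \<and> length \<Phi> = l + l' \<and> num_weights \<Phi> \<le> w + w' \<and>
        (\<forall>x. realization \<Phi> (mat p q (\<lambda>ij. x (f ij))) = mat p' q' (\<lambda>ij. G (F x) (g ij)))"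
    by (intro exI[of _ "\<Phi> @ \<Psi>"]) (auto intro: chain_append simp: num_weights_append realization_append)
qed

lemma realizes_cong:
  assumes "realizes \<rho> I J F w l" "\<And>x j. j \<in> J \<Longrightarrow> F x j = G x j"
  shows "realizes \<rho> I J G w l"
proof -
  have "mat p' q' (\<lambda>ij. F x (g ij)) = mat p' q' (\<lambda>ij. G x (g ij))"
    if "bij_betw g ({..<p'} \<times> {..<q'}) J" for g p' q' x
  proof -
    have "g ij \<in> J" if "ij \<in> {..<p'} \<times> {..<q'}" for ij
      using \<open>bij_betw g _ J\<close> that by (auto simp: bij_betw_def)
    then show ?thesis by (intro eq_matI) (auto simp: assms(2))
  qed
  then show ?thesis using assms(1) unfolding realizes_def by simp
qed

text \<open>Renaming inputs costs neither weights nor a layer: an enumeration of \<open>I'\<close>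
  is pulled back along \<open>h\<close> to an enumeration of \<open>I\<close>, and
  \<open>realizes\<close> holds for all of them.\<close>

lemma realizes_reindex:
  assumes "realizes \<rho> I J F w l" "bij_betw h I I'"
  shows "realizes \<rho> I' J (\<lambda>x. F (\<lambda>i. x (h i))) w l"
  unfolding realizes_def
proof (intro allI impI)
  fix p q p' q' :: nat and f g
  assume f: "bij_betw f ({..<p} \<times> {..<q}) I'" and g: "bij_betw g ({..<p'} \<times> {..<q'}) J"
  let ?f = "inv_into I h \<circ> f"
  have "bij_betw ?f ({..<p} \<times> {..<q}) I"
    using bij_betw_trans[OF f bij_betw_inv_into[OF assms(2)]] .
  then obtain \<Phi> where \<Phi>: "chain \<rho> (p, q) (p', q') \<Phi>" "length \<Phi> = l" "num_weights \<Phi> \<le> w"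
     "\<And>x. realization \<Phi> (mat p q (\<lambda>ij. x (?f ij))) = mat p' q' (\<lambda>ij. F x (g ij))"
    using assms(1) g unfolding realizes_def by meson
  have "mat p q (\<lambda>ij. x (f ij)) = mat p q (\<lambda>ij. x (h (?f ij)))" for x :: "_ \<Rightarrow> real"
  proof -
    have "f ij \<in> h ` I" if "ij \<in> {..<p} \<times> {..<q}" for ij
      using f assms(2) that by (auto simp: bij_betw_def)
    then show ?thesis by (intro eq_matI) (auto simp: f_inv_into_f)
  qed
  then have "realization \<Phi> (mat p q (\<lambda>ij. x (f ij))) = mat p' q' (\<lambda>ij. F (\<lambda>i. x (h i)) (g ij))" for x
    using \<Phi>(4)[of "\<lambda>i. x (h i)"] by metis
  with \<Phi>(1-3) show "\<exists>\<Phi>. chain \<rho> (p, q) (p', q') \<Phi> \<and> length \<Phi> = l \<and> num_weights \<Phi> \<le> w \<and>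
    (\<forall>x. realization \<Phi> (mat p q (\<lambda>ij. x (f ij))) = mat p' q' (\<lambda>ij. F (\<lambda>i. x (h i)) (g ij)))"
    by (intro exI[of _ \<Phi>]) auto
qed

section \<open>Affine layers given by sparse rows of index-coefficient pairs\<close>

definition layer_cost :: "'b set \<Rightarrow> ('b \<Rightarrow> ('a \<times> real) list) \<Rightarrow> ('b \<Rightarrow> real) \<Rightarrow> nat" where
  "layer_cost J rw b = (\<Sum>j\<in>J. length (rw j) + (if b j = 0 then 0 else 1))"

lemma card_filter_eq_sum: "finite A \<Longrightarrow> card {x \<in> A. Q x} = (\<Sum>x\<in>A. if Q x then 1 else 0)"
  unfolding card_eq_sum by (rule sum.inter_filter)

text \<open>A sparse row may name an index several times; the corresponding tensor entry is then the
  sum of its coefficients. This is why \<open>layer_cost\<close>, which counts list items, is only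
  an upper bound for the number of nonzero entries.\<close>

lemma sum_list_filter_fst:
  fixes f :: "'a \<Rightarrow> real" and xs :: "('a \<times> real) list"
  assumes "finite I" "fst ` set xs \<subseteq> I"
  shows "(\<Sum>i\<in>I. (\<Sum>(i', w)\<leftarrow>filter (\<lambda>iw. fst iw = i) xs. w) * f i) = (\<Sum>(i, w)\<leftarrow>xs. w * f i)"
  using assms(2)
proof (induction xs)
  case Nil
  then show ?case by simp
next
  case (Cons x xs)
  obtain i0 w0 where x: "x = (i0, w0)" by fastforce
  have "(\<Sum>i\<in>I. (\<Sum>(i', w)\<leftarrow>filter (\<lambda>iw. fst iw = i) (x # xs). w) * f i) =
     (\<Sum>i\<in>I. (if i = i0 then w0 * f i else 0) + (\<Sum>(i', w)\<leftarrow>filter (\<lambda>iw. fst iw = i) xs. w) * f i)"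
    by (intro sum.cong) (auto simp: x algebra_simps)
  also have "\<dots> = w0 * f i0 + (\<Sum>(i, w)\<leftarrow>xs. w * f i)"
    using Cons assms(1) by (simp add: sum.distrib x)
  finally show ?case by (simp add: x)
qed

text \<open>The activations are exposed so that the layer can also serve as the last one of a
  network. That \<open>J\<close> is nonempty provides the positive output dimensions.\<close>

lemma single_layer:
  fixes rw :: "'b \<Rightarrow> ('a \<times> real) list"
  assumes "finite I" "J \<noteq> {}" "\<And>j. j \<in> J \<Longrightarrow> fst ` set (rw j) \<subseteq> I"
    and "\<And>j. j \<in> J \<Longrightarrow> act j \<in> {id, \<rho>}"
    and f: "bij_betw f ({..<p} \<times> {..<q}) I" and g: "bij_betw g ({..<p'} \<times> {..<q'}) J"
  obtains X where "chain \<rho> (p, q) (p', q') [X]" "num_weights [X] \<le> layer_cost J rw b"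
    "\<And>i j. i < p' \<Longrightarrow> j < q' \<Longrightarrow> snd (snd X) $$ (i,j) = act (g (i,j))"
    "\<And>x. realization [X] (mat p q (\<lambda>ij. x (f ij))) =
        mat p' q' (\<lambda>ij. act (g ij) ((\<Sum>(i, w)\<leftarrow>rw (g ij). w * x i) + b (g ij)))"
proof -
  define t where "t ij kl = (\<Sum>(i', w)\<leftarrow>filter (\<lambda>iw. fst iw = f kl) (rw (g ij)). w)" for ij kl
  define T where "T = mat p' q' (\<lambda>ij. mat p q (t ij))"
  define C where "C = mat p' q' (\<lambda>ij. b (g ij))"
  define a where "a = mat p' q' (\<lambda>ij. act (g ij))"
  have gJ: "g ij \<in> J" if "ij \<in> {..<p'} \<times> {..<q'}" for ij
    using g that by (auto simp: bij_betw_def)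
  have pos: "0 < p'" "0 < q'"
    using g assms(2) by (auto simp: bij_betw_def)
  have chain: "chain \<rho> (p, q) (p', q') [(T, C, a)]"
    using pos assms(4) gJ
    by (auto simp: fits_layer_def T_def C_def a_def carrier_tensor_def)
  have "nonzeros_tensor T \<le> card (SIGMA ij : {..<p'} \<times> {..<q'}. {kl \<in> {..<p} \<times> {..<q}. t ij kl \<noteq> 0})"
    unfolding nonzeros_tensor_def
    by (rule card_inj_on_le[of "\<lambda>(i,j,k,l). ((i,j),(k,l))"]) (auto simp: T_def inj_on_def)
  also have "\<dots> = (\<Sum>ij\<in>{..<p'} \<times> {..<q'}. card {kl \<in> {..<p} \<times> {..<q}. t ij kl \<noteq> 0})"
    by (subst card_SigmaI) auto
  also have "\<dots> \<le> (\<Sum>ij\<in>{..<p'} \<times> {..<q'}. length (rw (g ij)))"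
  proof (intro sum_mono)
    fix ij
    have "f kl \<in> fst ` set (rw (g ij))" if "t ij kl \<noteq> 0" for kl
    proof (rule ccontr)
      assume "f kl \<notin> fst ` set (rw (g ij))"
      then have "fst iw \<noteq> f kl" if "iw \<in> set (rw (g ij))" for iw
        using imageI[OF that, of fst] by metis
      then have "filter (\<lambda>iw. fst iw = f kl) (rw (g ij)) = []"
        by (intro filter_False) blast
      with that show False by (simp add: t_def)
    qed
    then have "f ` {kl \<in> {..<p} \<times> {..<q}. t ij kl \<noteq> 0} \<subseteq> fst ` set (rw (g ij))" by blast
    moreover have "inj_on f {kl \<in> {..<p} \<times> {..<q}. t ij kl \<noteq> 0}"
      by (rule inj_on_subset[OF bij_betw_imp_inj_on[OF f]]) blast
    ultimately have "card {kl \<in> {..<p} \<times> {..<q}. t ij kl \<noteq> 0} \<le> card (fst ` set (rw (g ij)))"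
      by (intro card_inj_on_le) simp_all
    also have "\<dots> \<le> length (rw (g ij))"
      by (rule order_trans[OF card_image_le card_length]) simp
    finally show "card {kl \<in> {..<p} \<times> {..<q}. t ij kl \<noteq> 0} \<le> length (rw (g ij))" .
  qed
  finally have nT: "nonzeros_tensor T \<le> (\<Sum>ij\<in>{..<p'} \<times> {..<q'}. length (rw (g ij)))" .
  have "nonzeros_mat C = card {ij \<in> {..<p'} \<times> {..<q'}. b (g ij) \<noteq> 0}"
    unfolding nonzeros_mat_def C_def by (intro arg_cong[of _ _ card]) auto
  also have "\<dots> = (\<Sum>ij\<in>{..<p'} \<times> {..<q'}. if b (g ij) = 0 then 0 else 1)"
    by (subst card_filter_eq_sum) (auto intro!: sum.cong)
  finally have nC: "nonzeros_mat C = (\<Sum>ij\<in>{..<p'} \<times> {..<q'}. if b (g ij) = 0 then 0 else 1)" .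
  have "layer_cost J rw b = (\<Sum>ij\<in>{..<p'} \<times> {..<q'}. length (rw (g ij)) + (if b (g ij) = 0 then 0 else 1))"
    unfolding layer_cost_def by (rule sum.reindex_bij_betw[OF g, symmetric])
  with nT nC have weights: "num_weights [(T, C, a)] \<le> layer_cost J rw b"
    by (simp add: num_weights_def sum.distrib)
  have real: "realization [(T, C, a)] (mat p q (\<lambda>ij. x (f ij))) =
        mat p' q' (\<lambda>ij. act (g ij) ((\<Sum>(i, w)\<leftarrow>rw (g ij). w * x i) + b (g ij)))" for x
  proof -
    have "(\<Sum>k<p. \<Sum>l<q. t ij (k,l) * x (f (k,l))) = (\<Sum>(i, w)\<leftarrow>rw (g ij). w * x i)"
      if "ij \<in> {..<p'} \<times> {..<q'}" for ij
    proof -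
      have "(\<Sum>k<p. \<Sum>l<q. t ij (k,l) * x (f (k,l))) = (\<Sum>kl\<in>{..<p}\<times>{..<q}. t ij kl * x (f kl))"
        by (simp add: sum.cartesian_product)
      also have "\<dots> = (\<Sum>i\<in>I. (\<Sum>(i', w)\<leftarrow>filter (\<lambda>iw. fst iw = i) (rw (g ij)). w) * x i)"
        unfolding t_def by (rule sum.reindex_bij_betw[OF f])
      also have "\<dots> = (\<Sum>(i, w)\<leftarrow>rw (g ij). w * x i)"
        by (rule sum_list_filter_fst[OF assms(1) assms(3)[OF gJ[OF that]]])
      finally show ?thesis .
    qed
    then show ?thesis
      by (intro eq_matI) (auto simp: realization_def act_apply_def tensor_apply_def T_def C_def a_def)
  qed
  from chain weights real show ?thesis by (intro that[of "(T, C, a)"]) (auto simp: a_def)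
qed

lemma realizes_layer:
  fixes rw :: "'b \<Rightarrow> ('a \<times> real) list"
  assumes "finite I" "J \<noteq> {}" "\<And>j. j \<in> J \<Longrightarrow> fst ` set (rw j) \<subseteq> I"
    and "\<And>j. j \<in> J \<Longrightarrow> act j \<in> {id, \<rho>}"
  shows "realizes \<rho> I J (\<lambda>x j. act j ((\<Sum>(i, w)\<leftarrow>rw j. w * x i) + b j)) (layer_cost J rw b) 1"
  unfolding realizes_def
proof (intro allI impI)
  fix p q p' q' :: nat and f g
  assume f: "bij_betw f ({..<p} \<times> {..<q}) I" and g: "bij_betw g ({..<p'} \<times> {..<q'}) J"
  show "\<exists>\<Phi>. chain \<rho> (p, q) (p', q') \<Phi> \<and> length \<Phi> = 1 \<and> num_weights \<Phi> \<le> layer_cost J rw b \<and>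
      (\<forall>x. realization \<Phi> (mat p q (\<lambda>ij. x (f ij))) =
         mat p' q' (\<lambda>ij. act (g ij) ((\<Sum>(i, w)\<leftarrow>rw (g ij). w * x i) + b (g ij))))"
  proof (rule single_layer[OF assms f g])
    fix X :: "tensor \<times> real mat \<times> (real \<Rightarrow> real) mat"
    assume "chain \<rho> (p, q) (p', q') [X]" "num_weights [X] \<le> layer_cost J rw b"
      "\<And>x. realization [X] (mat p q (\<lambda>ij. x (f ij))) =
        mat p' q' (\<lambda>ij. act (g ij) ((\<Sum>(i, w)\<leftarrow>rw (g ij). w * x i) + b (g ij)))"
    then show ?thesis by (intro exI[of _ "[X]"]) auto
  qed
qed

text \<open>Since \<open>realizes\<close> hides the activations, an affine layer with identity
  activation is appended. It accounts for the extra layer, and later it also performs the final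
  rescaling.\<close>

lemma realizes_imp_mnn:
  fixes rw :: "nat \<times> nat \<Rightarrow> ('a \<times> real) list"
  assumes F: "realizes \<rho> ({..<n} \<times> {..<n}) J F w l" and "finite J" "0 < n"
    and rw: "\<And>ij. ij \<in> {..<n} \<times> {..<n} \<Longrightarrow> fst ` set (rw ij) \<subseteq> J"
  obtains \<Phi> where "is_mnn \<rho> (n, n) (n, n) \<Phi>" "length \<Phi> = l + 1"
    "num_weights \<Phi> \<le> w + layer_cost ({..<n} \<times> {..<n}) rw b"
    "\<And>A. A \<in> carrier_mat n n \<Longrightarrow> realization \<Phi> A =
        mat n n (\<lambda>ij. (\<Sum>(i, w)\<leftarrow>rw ij. w * F (\<lambda>ij. A $$ ij) i) + b ij)"
proof -
  obtain p q and f :: "nat \<times> nat \<Rightarrow> 'a" where f: "bij_betw f ({..<p} \<times> {..<q}) J"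
    using ex_bij_grid[OF assms(2)] .
  have id: "bij_betw (\<lambda>ij. ij) ({..<n} \<times> {..<n}) ({..<n} \<times> {..<n})"
    by (simp add: bij_betw_def)
  obtain \<Psi> where \<Psi>: "chain \<rho> (n, n) (p, q) \<Psi>" "length \<Psi> = l" "num_weights \<Psi> \<le> w"
      "\<And>x. realization \<Psi> (mat n n (\<lambda>ij. x ij)) = mat p q (\<lambda>ij. F x (f ij))"
    using F id f unfolding realizes_def by meson
  have ne: "{..<n} \<times> {..<n} \<noteq> {}" using assms(3) by auto
  obtain X where X: "chain \<rho> (p, q) (n, n) [X]"
      "num_weights [X] \<le> layer_cost ({..<n} \<times> {..<n}) rw b"
      "\<And>i j. i < n \<Longrightarrow> j < n \<Longrightarrow> snd (snd X) $$ (i,j) = id"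
      "\<And>x. realization [X] (mat p q (\<lambda>ij. x (f ij))) =
        mat n n (\<lambda>ij. id ((\<Sum>(i, w)\<leftarrow>rw ij. w * x i) + b ij))"
    by (rule single_layer[OF assms(2) ne rw, where act = "\<lambda>_. id" and \<rho> = \<rho> and b = b and g = "\<lambda>ij. ij"])
       (use f id in auto)
  show ?thesis
  proof
    show "is_mnn \<rho> (n, n) (n, n) (\<Psi> @ [X])"
      using chain_append[OF \<Psi>(1) X(1)] assms(3) X(3) by (intro chain_imp_is_mnn) auto
    show "length (\<Psi> @ [X]) = l + 1" using \<Psi>(2) by simp
    show "num_weights (\<Psi> @ [X]) \<le> w + layer_cost ({..<n} \<times> {..<n}) rw b"
      using \<Psi>(3) X(2) by (simp add: num_weights_append)
    fix A :: "real mat" assume "A \<in> carrier_mat n n"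
    then have "A = mat n n (\<lambda>ij. A $$ ij)" by (intro eq_matI) auto
    then have "realization \<Psi> A = mat p q (\<lambda>ij. F (\<lambda>ij. A $$ ij) (f ij))"
      using \<Psi>(4)[of "\<lambda>ij. A $$ ij"] by simp
    then show "realization (\<Psi> @ [X]) A =
        mat n n (\<lambda>ij. (\<Sum>(i, w)\<leftarrow>rw ij. w * F (\<lambda>ij. A $$ ij) i) + b ij)"
      using X(4)[of "F (\<lambda>ij. A $$ ij)"] by (simp add: realization_append)
  qed
qed

section \<open>Parallel copies of a network\<close>

definition grid :: "nat \<Rightarrow> nat \<Rightarrow> (nat \<times> nat) list" where
  "grid p q = List.product [0..<p] [0..<q]"

text \<open>\<open>Inl (c, i, j)\<close> is entry (i, j) in the copy with label \<open>c\<close>.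
  The scalars indexed by \<open>E\<close> travel past the copies through identity weights, one per
  scalar and layer.\<close>

definition copies :: "'c set \<Rightarrow> nat \<times> nat \<Rightarrow> 'e set \<Rightarrow> ('c \<times> nat \<times> nat + 'e) set" where
  "copies C d E = (C \<times> {..<fst d} \<times> {..<snd d}) <+> E"

definition batch :: "mnn \<Rightarrow> nat \<times> nat \<Rightarrow> ('c \<times> nat \<times> nat + 'e \<Rightarrow> real) \<Rightarrow> 'c \<times> nat \<times> nat + 'e \<Rightarrow> real" where
  "batch \<Phi> d x = case_sum
     (\<lambda>(c, ij). realization \<Phi> (mat (fst d) (snd d) (\<lambda>kl. x (Inl (c, kl)))) $$ ij) (\<lambda>e. x (Inr e))"

lemma realization_Cons: "realization (X # \<Phi>) A = realization \<Phi> (realization [X] A)"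
  by (simp add: realization_def)

lemma realization_layer_carrier:
  assumes "fits_layer \<rho> d e X"
  shows "realization [X] A \<in> carrier_mat (fst e) (snd e)"
  using assms by (cases X) (auto simp: realization_def act_apply_def fits_layer_def)

lemma finite_copies: "finite C \<Longrightarrow> finite E \<Longrightarrow> finite (copies C d E)"
  by (simp add: copies_def)

lemma realizes_batch_layer:
  fixes C :: "'c set" and E :: "'e set"
  assumes X: "fits_layer \<rho> d e X" and "finite C" "C \<noteq> {}" "finite E"
  shows "realizes \<rho> (copies C d E) (copies C e E) (batch [X] d)
     (card C * num_weights [X] + card E) 1"
proof -
  obtain T B a where Xeq: "X = (T, B, a)" by (metis prod_cases3)
  obtain p q p' q' where d: "d = (p, q)" "e = (p', q')" by fastforce
  have TBa: "0 < p'" "0 < q'" "dim_row T = p'" "dim_col T = q'" "B \<in> carrier_mat p' q'"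
      "a \<in> carrier_mat p' q'"
      "\<And>i j. i < p' \<Longrightarrow> j < q' \<Longrightarrow> a $$ (i,j) \<in> {id, \<rho>}"
      "\<And>i j. i < p' \<Longrightarrow> j < q' \<Longrightarrow> T $$ (i,j) \<in> carrier_mat p q"
    using X by (auto simp: fits_layer_def Xeq d carrier_tensor_def)
  \<comment> \<open>Zero entries are filtered out because \<open>layer_cost\<close> would count
    them, whereas the cost has to match \<open>num_weights\<close> of the copied layer.\<close>
  define nz where "nz ij = filter (\<lambda>kl. T $$ ij $$ kl \<noteq> 0) (grid p q)" for ij
  define rw :: "'c \<times> nat \<times> nat + 'e \<Rightarrow> (('c \<times> nat \<times> nat + 'e) \<times> real) list" where
    "rw = case_sum (\<lambda>(c, ij). map (\<lambda>kl. (Inl (c, kl), T $$ ij $$ kl)) (nz ij)) (\<lambda>e. [(Inr e, 1)])"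
  define b :: "'c \<times> nat \<times> nat + 'e \<Rightarrow> real" where "b = case_sum (\<lambda>(c, ij). B $$ ij) (\<lambda>_. 0)"
  define act :: "'c \<times> nat \<times> nat + 'e \<Rightarrow> real \<Rightarrow> real" where
    "act = case_sum (\<lambda>(c, ij). a $$ ij) (\<lambda>_. id)"
  have sub: "fst ` set (rw j) \<subseteq> copies C d E" if "j \<in> copies C e E" for j
    using that by (auto simp: copies_def rw_def nz_def grid_def d)
  have act: "act j \<in> {id, \<rho>}" if "j \<in> copies C e E" for j
  proof -
    consider c i k where "j = Inl (c, i, k)" "i < p'" "k < q'" | e where "j = Inr e"
      using \<open>j \<in> _\<close> by (auto simp: copies_def d)
    then show ?thesis
    proof cases
      case 1
      then show ?thesis using TBa(7)[of i k] by (simp add: act_def)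
    qed (simp add: act_def)
  qed
  have ne: "copies C e E \<noteq> {}"
    using assms(3) TBa(1,2) by (auto simp: copies_def d)
  have len: "(\<Sum>ij\<in>{..<p'}\<times>{..<q'}. length (nz ij)) = nonzeros_tensor T"
  proof -
    have "length (nz ij) = card {kl \<in> {..<p} \<times> {..<q}. T $$ ij $$ kl \<noteq> 0}" for ij
    proof -
      have "distinct (nz ij)" by (simp add: nz_def grid_def distinct_product)
      then have "length (nz ij) = card (set (nz ij))" by (simp add: distinct_card)
      also have "set (nz ij) = {kl \<in> {..<p} \<times> {..<q}. T $$ ij $$ kl \<noteq> 0}"
        by (auto simp: nz_def grid_def)
      finally show ?thesis .
    qed
    then have "(\<Sum>ij\<in>{..<p'}\<times>{..<q'}. length (nz ij)) =
      card (SIGMA ij : {..<p'} \<times> {..<q'}. {kl \<in> {..<p} \<times> {..<q}. T $$ ij $$ kl \<noteq> 0})"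
      by (subst card_SigmaI) auto
    also have "\<dots> = nonzeros_tensor T"
    proof -
      let ?S = "SIGMA ij : {..<p'} \<times> {..<q'}. {kl \<in> {..<p} \<times> {..<q}. T $$ ij $$ kl \<noteq> 0}"
      let ?h = "\<lambda>((i, j), (k, l)). (i, j, k, l)"
      have dims: "dim_row (T $$ (i,j)) = p" "dim_col (T $$ (i,j)) = q" if "i < p'" "j < q'" for i j
        using TBa(8)[OF that] by auto
      have "{(i,j,k,l). i < dim_row T \<and> j < dim_col T \<and> k < dim_row (T $$ (i,j)) \<and>
          l < dim_col (T $$ (i,j)) \<and> T $$ (i,j) $$ (k,l) \<noteq> 0} = ?h ` ?S" (is "?L = _")
      proof (intro equalityI subsetI)
        fix x assume "x \<in> ?L"
        then obtain i j k l where x: "x = (i, j, k, l)" "i < p'" "j < q'" "k < p" "l < q"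
            "T $$ (i,j) $$ (k,l) \<noteq> 0"
          using TBa(3,4) dims by auto
        then show "x \<in> ?h ` ?S" by (intro image_eqI[of _ _ "((i, j), (k, l))"]) auto
      next
        fix x assume "x \<in> ?h ` ?S"
        then show "x \<in> ?L" using TBa(3,4) dims by auto
      qed
      moreover have "inj_on ?h ?S" by (auto simp: inj_on_def)
      ultimately show ?thesis unfolding nonzeros_tensor_def by (simp only: card_image)
    qed
    finally show ?thesis .
  qed
  have lenB: "(\<Sum>ij\<in>{..<p'}\<times>{..<q'}. if B $$ ij = 0 then 0 else 1) = nonzeros_mat B"
  proof -
    have "nonzeros_mat B = card {ij \<in> {..<p'} \<times> {..<q'}. B $$ ij \<noteq> 0}"
      unfolding nonzeros_mat_def using TBa(5) by (intro arg_cong[of _ _ card]) auto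
    also have "\<dots> = (\<Sum>ij\<in>{..<p'}\<times>{..<q'}. if B $$ ij = 0 then 0 else 1)"
      by (subst card_filter_eq_sum) (auto intro!: sum.cong)
    finally show ?thesis by simp
  qed
  have "layer_cost (copies C e E) rw b =
      (\<Sum>j\<in>C \<times> {..<p'} \<times> {..<q'}. length (rw (Inl j)) + (if b (Inl j) = 0 then 0 else 1)) +
      (\<Sum>j\<in>E. length (rw (Inr j)) + (if b (Inr j) = 0 then 0 else 1))"
    unfolding layer_cost_def copies_def d using assms(2,4) by (subst sum.Plus) auto
  also have "(\<Sum>j\<in>E. length (rw (Inr j)) + (if b (Inr j) = 0 then 0 else 1)) = card E"
    by (simp add: rw_def b_def)
  also have "(\<Sum>j\<in>C \<times> {..<p'} \<times> {..<q'}. length (rw (Inl j)) + (if b (Inl j) = 0 then 0 else 1)) =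
     (\<Sum>c\<in>C. \<Sum>ij\<in>{..<p'}\<times>{..<q'}. length (nz ij) + (if B $$ ij = 0 then 0 else 1))"
    by (subst sum.cartesian_product) (auto simp: rw_def b_def intro!: sum.cong)
  also have "\<dots> = card C * num_weights [X]"
    using len lenB by (simp add: sum.distrib num_weights_def Xeq)
  finally have cost: "layer_cost (copies C e E) rw b = card C * num_weights [X] + card E" .
  have "act j ((\<Sum>(i, w)\<leftarrow>rw j. w * x i) + b j) = batch [X] d x j" if "j \<in> copies C e E" for x j
  proof (cases j)
    case (Inr e)
    then show ?thesis by (simp add: act_def rw_def b_def batch_def)
  next
    case (Inl cij)
    then obtain c i k where j: "j = Inl (c, (i, k))" "i < p'" "k < q'"
      using \<open>j \<in> _\<close> by (auto simp: copies_def d)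
    let ?M = "mat p q (\<lambda>kl. x (Inl (c, kl)))"
    have "(\<Sum>(i, w)\<leftarrow>rw j. w * x i) =
       (\<Sum>kl\<leftarrow>nz (i,k). T $$ (i,k) $$ kl * x (Inl (c, kl)))"
      by (simp add: j rw_def comp_def)
    also have "\<dots> = (\<Sum>kl\<leftarrow>grid p q. T $$ (i,k) $$ kl * x (Inl (c, kl)))"
      unfolding nz_def by (rule sum_list_map_filter) auto
    also have "\<dots> = (\<Sum>kl\<in>set (grid p q). T $$ (i,k) $$ kl * x (Inl (c, kl)))"
      by (rule sum_list_distinct_conv_sum_set) (simp add: grid_def distinct_product)
    also have "set (grid p q) = {..<p} \<times> {..<q}" by (auto simp: grid_def)
    also have "(\<Sum>kl\<in>{..<p} \<times> {..<q}. T $$ (i,k) $$ kl * x (Inl (c, kl))) =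
       (\<Sum>k'<p. \<Sum>l<q. T $$ (i,k) $$ (k',l) * ?M $$ (k',l))"
      unfolding sum.cartesian_product' by simp
    finally show ?thesis
      using TBa(3-6) j by (simp add: batch_def d act_def b_def realization_def act_apply_def
          tensor_apply_def Xeq)
  qed
  then show ?thesis
    using realizes_layer[where rw = rw and b = b and act = act, OF finite_copies[OF assms(2,4)] ne sub act]
    unfolding cost by (rule realizes_cong[rotated]) auto
qed

text \<open>The empty network is excluded: with no layer, \<open>realizes\<close> could not pass
  from one enumeration of an index set to another.\<close>

lemma realizes_batch:
  fixes C :: "'c set" and E :: "'e set"
  assumes "chain \<rho> d d' \<Phi>" "\<Phi> \<noteq> []" "finite C" "C \<noteq> {}" "finite E"
  shows "realizes \<rho> (copies C d E) (copies C d' E) (batch \<Phi> d)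
     (card C * num_weights \<Phi> + card E * length \<Phi>) (length \<Phi>)"
  using assms(1,2)
proof (induction \<Phi> arbitrary: d)
  case Nil
  then show ?case by simp
next
  case (Cons X \<Phi>)
  obtain e where X: "fits_layer \<rho> d e X" and \<Phi>: "chain \<rho> e d' \<Phi>"
    using Cons.prems(1) by auto
  note L = realizes_batch_layer[OF X assms(3-5)]
  show ?case
  proof (cases "\<Phi> = []")
    case True
    then show ?thesis using L \<Phi> by simp
  next
    case False
    have M: "mat (fst e) (snd e) (\<lambda>kl. realization [X] A $$ kl) = realization [X] A" for A
      using realization_layer_carrier[OF X, of A] by (intro eq_matI) auto
    have "(\<lambda>x. batch \<Phi> e (batch [X] d x)) = (batch (X # \<Phi>) d :: _ \<Rightarrow> 'c \<times> nat \<times> nat + 'e \<Rightarrow> real)"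
      by (auto simp: batch_def fun_eq_iff M realization_Cons[of X \<Phi>] split: sum.split)
    moreover have "num_weights (X # \<Phi>) = num_weights [X] + num_weights \<Phi>"
      by (simp add: num_weights_def)
    ultimately show ?thesis
      using realizes_comp[OF L Cons.IH[OF \<Phi> False] finite_copies[OF assms(3,5)]]
      by (simp add: algebra_simps)
  qed
qed

section \<open>Strassen's algorithm as a network\<close>

text \<open>Strassen's seven products, numbered from 0: an item (a, b, w) is block (a, b) with
  coefficient w in the left (s = 0) or right factor of product t. Each side has 12 coefficients in
  total, which gives the 24 m^2 weights of an encoding layer.\<close>

fun strassen_enc :: "nat \<Rightarrow> nat \<Rightarrow> (nat \<times> nat \<times> real) list" where
  "strassen_enc s t = (if s = 0 then
     [[(0,0,1), (1,1,1)], [(1,0,1), (1,1,1)], [(0,0,1)], [(1,1,1)],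
      [(0,0,1), (0,1,1)], [(1,0,1), (0,0,-1)], [(0,1,1), (1,1,-1)]] ! t
   else
     [[(0,0,1), (1,1,1)], [(0,0,1)], [(0,1,1), (1,1,-1)], [(1,0,1), (0,0,-1)],
      [(1,1,1)], [(0,0,1), (0,1,1)], [(1,0,1), (1,1,1)]] ! t)"

definition strassen_dec :: "nat \<Rightarrow> nat \<Rightarrow> (nat \<times> real) list" where
  "strassen_dec a b = (if a = 0 then
      if b = 0 then [(0,1), (3,1), (4,-1), (6,1)] else [(2,1), (4,1)]
    else if b = 0 then [(1,1), (3,1)] else [(0,1), (1,-1), (2,1), (5,1)])"

definition operands :: "nat list set \<Rightarrow> nat \<Rightarrow> 'e set \<Rightarrow> (nat list \<times> nat \<times> nat \<times> nat + 'e) set" where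
  "operands C m E = (C \<times> {..<2} \<times> {..<m} \<times> {..<m}) <+> E"

text \<open>A label is a path in the recursion tree with the deepest branch at its head;
  \<open>realizes_encode\<close> therefore reads the product number from \<open>hd c\<close> and the
  parent from \<open>tl c\<close>.\<close>

definition deeper :: "nat list set \<Rightarrow> nat list set" where
  "deeper C = (\<lambda>(t, c). t # c) ` ({..<7} \<times> C)"

text \<open>With blocks of size 2^k, encoding takes 24 and decoding 12 coefficients for each of the
  4^k positions in a block; together 36.\<close>

primrec strassen_weights :: "nat \<Rightarrow> nat \<Rightarrow> nat" where
  "strassen_weights M 0 = M"
| "strassen_weights M (Suc k) = 36 * 4 ^ k + 7 * strassen_weights M k"

text \<open>-12 * 4^k is a particular solution of the recursion, since 36 - 7 * 12 = -12 * 4. The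
  term with 12 that is gained here later pays for all overhead of order n^2.\<close>

lemma strassen_weights_eq:
  "strassen_weights M k + 12 * 4 ^ k = 7 ^ k * (M + 12)"
  by (induction k) (simp_all add: algebra_simps)

lemma less7: "(t::nat) < 7 \<longleftrightarrow> t \<in> {0, 1, 2, 3, 4, 5, 6}"
  by auto

lemma sum_lessThan7: "(\<Sum>t<7. f t) = f 0 + f 1 + f 2 + f 3 + f 4 + f 5 + f (6::nat)"
  by (simp add: eval_nat_numeral)

lemma card_deeper: "card (deeper C) = 7 * card C"
  unfolding deeper_def by (subst card_image) (auto simp: inj_on_def card_cartesian_product)

lemma sum_deeper: "(\<Sum>c\<in>deeper C. f c) = (\<Sum>t<7. \<Sum>c\<in>C. f (t # c))"
  unfolding deeper_def by (subst sum.reindex) (auto simp: inj_on_def sum.cartesian_product comp_def split_def)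

section \<open>Growth, error propagation and correctness of Strassen's coefficients\<close>

lemma strassen_enc_bounds:
  assumes "t < 7" "(a, b, w) \<in> set (strassen_enc s t)"
  shows "a < 2" "b < 2"
  using assms by (auto simp: less7 split: if_splits)

lemma abs_sum_list_le:
  fixes y :: "'a \<Rightarrow> real"
  assumes "\<And>p w. (p, w) \<in> set xs \<Longrightarrow> \<bar>y p\<bar> \<le> B"
  shows "\<bar>\<Sum>(p, w)\<leftarrow>xs. w * y p\<bar> \<le> (\<Sum>(p, w)\<leftarrow>xs. \<bar>w\<bar>) * B"
  using assms
proof (induction xs)
  case Nil
  then show ?case by simp
next
  case (Cons x xs)
  obtain p w where x: "x = (p, w)" by fastforce
  have "\<bar>w * y p\<bar> \<le> \<bar>w\<bar> * B"
    unfolding abs_mult using Cons.prems x by (intro mult_left_mono) auto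
  moreover have "\<bar>\<Sum>(p, w)\<leftarrow>xs. w * y p\<bar> \<le> (\<Sum>(p, w)\<leftarrow>xs. \<bar>w\<bar>) * B"
    using Cons.prems by (intro Cons.IH) auto
  moreover have "\<bar>w * y p + (\<Sum>(p, w)\<leftarrow>xs. w * y p)\<bar> \<le> \<bar>w * y p\<bar> + \<bar>\<Sum>(p, w)\<leftarrow>xs. w * y p\<bar>"
    by (rule abs_triangle_ineq)
  ultimately have "\<bar>w * y p + (\<Sum>(p, w)\<leftarrow>xs. w * y p)\<bar> \<le> \<bar>w\<bar> * B + (\<Sum>(p, w)\<leftarrow>xs. \<bar>w\<bar>) * B"
    by linarith
  then show ?case by (simp add: x distrib_right)
qed

text \<open>Every factor combines at most two blocks with coefficients of modulus one, hence one
  level at most doubles the entries.\<close>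

lemma strassen_enc_abs:
  assumes "t < 7" "\<And>a b. a < 2 \<Longrightarrow> b < 2 \<Longrightarrow> \<bar>y a b\<bar> \<le> (B::real)"
  shows "\<bar>\<Sum>(a, b, w)\<leftarrow>strassen_enc s t. w * y a b\<bar> \<le> 2 * B"
proof -
  let ?xs = "map (\<lambda>(a, b, w). ((a, b), w)) (strassen_enc s t)"
  have "\<bar>\<Sum>(p, w)\<leftarrow>?xs. w * (case p of (a, b) \<Rightarrow> y a b)\<bar> \<le> (\<Sum>(p, w)\<leftarrow>?xs. \<bar>w\<bar>) * B"
    using strassen_enc_bounds[OF assms(1)] assms(2)
    by (intro abs_sum_list_le) (auto simp del: strassen_enc.simps)
  also have "(\<Sum>(p, w)\<leftarrow>?xs. w * (case p of (a, b) \<Rightarrow> y a b)) = (\<Sum>(a, b, w)\<leftarrow>strassen_enc s t. w * y a b)"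
    by (simp add: comp_def split_def del: strassen_enc.simps)
  also have "(\<Sum>(p, w)\<leftarrow>?xs. \<bar>w\<bar>) * B \<le> 2 * B"
  proof (rule mult_right_mono)
    show "(\<Sum>(p, w)\<leftarrow>?xs. \<bar>w\<bar>) \<le> 2"
      using assms(1) unfolding less7 by (elim insertE emptyE) simp_all
    show "0 \<le> B" using order_trans[OF abs_ge_zero assms(2)[of 0 0]] by simp
  qed
  finally show ?thesis .
qed

lemma strassen_dec_bounds: "(t, w) \<in> set (strassen_dec a b) \<Longrightarrow> t < 7"
  by (auto simp: strassen_dec_def split: if_splits)

text \<open>Every output block combines at most four products with coefficients of modulus one; over
  k levels this yields the factor 4^k.\<close>

lemma strassen_dec_error:
  assumes "\<And>t. t < 7 \<Longrightarrow> \<bar>y t - z t\<bar> \<le> (e::real)"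
  shows "\<bar>(\<Sum>(t, w)\<leftarrow>strassen_dec a b. w * y t) - (\<Sum>(t, w)\<leftarrow>strassen_dec a b. w * z t)\<bar> \<le> 4 * e"
proof -
  have "(\<Sum>(t, w)\<leftarrow>strassen_dec a b. w * y t) - (\<Sum>(t, w)\<leftarrow>strassen_dec a b. w * z t) =
      (\<Sum>(t, w)\<leftarrow>strassen_dec a b. w * (y t - z t))"
    by (simp add: sum_list_subtractf[symmetric] split_def right_diff_distrib)
  also have "\<bar>\<dots>\<bar> \<le> (\<Sum>(t, w)\<leftarrow>strassen_dec a b. \<bar>w\<bar>) * e"
    by (intro abs_sum_list_le assms strassen_dec_bounds)
  also have "\<dots> \<le> 4 * e"
  proof (rule mult_right_mono)
    show "(\<Sum>(t, w)\<leftarrow>strassen_dec a b. \<bar>w\<bar>) \<le> 4" by (simp add: strassen_dec_def)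
    show "0 \<le> e" using order_trans[OF abs_ge_zero assms[of 0]] by simp
  qed
  finally show ?thesis .
qed

text \<open>The version for scalars suffices for blocks: encoding and decoding act position by
  position, and a block product is a sum over l of scalar products, so the identity is applied for
  each l and summed.\<close>

lemma strassen_identity:
  fixes x y :: "nat \<Rightarrow> nat \<Rightarrow> real"
  assumes "a < 2" "b < 2"
  shows "(\<Sum>(t, w)\<leftarrow>strassen_dec a b. w * ((\<Sum>(a, b, w)\<leftarrow>strassen_enc 0 t. w * x a b) *
      (\<Sum>(a, b, w)\<leftarrow>strassen_enc 1 t. w * y a b))) = x a 0 * y 0 b + x a 1 * y 1 b"
proof -
  have "a = 0 \<or> a = 1" "b = 0 \<or> b = 1" using assms by auto
  then show ?thesis by (auto simp: strassen_dec_def algebra_simps)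
qed

lemma sum_double: "(\<Sum>l<2 * (m::nat). f l) = (\<Sum>l<m. f l + f (l + m) :: real)"
proof -
  have "(\<Sum>l<2 * m. f l) = (\<Sum>l<m. f l) + (\<Sum>l=m..<m+m. f l)"
    by (metis atLeast0LessThan mult_2 sum.atLeastLessThan_concat le0 le_add1)
  also have "(\<Sum>l=m..<m+m. f l) = (\<Sum>l<m. f (l + m))"
    using sum.shift_bounds_nat_ivl[of f 0 m m] by (simp add: atLeast0LessThan)
  finally show ?thesis by (simp add: sum.distrib)
qed

lemma sum_sum_list: "(\<Sum>i\<in>A. \<Sum>x\<leftarrow>xs. f i x) = (\<Sum>x\<leftarrow>xs. \<Sum>i\<in>A. (f i x :: real))"
  by (induction xs) (simp_all add: sum.distrib)

lemma finite_operands: "finite C \<Longrightarrow> finite E \<Longrightarrow> finite (operands C m E)"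
  by (simp add: operands_def)

section \<open>One level of the recursion as two linear layers\<close>

lemma realizes_encode:
  fixes C :: "nat list set" and E :: "'e set"
  assumes "finite C" "finite E" "C \<noteq> {}" "0 < m"
  shows "realizes \<rho> (operands C (2 * m) E) (operands (deeper C) m E)
     (\<lambda>x. case_sum (\<lambda>(c, s, i, j). \<Sum>(a, b, w)\<leftarrow>strassen_enc s (hd c).
          w * x (Inl (tl c, s, i + a * m, j + b * m))) (\<lambda>e. x (Inr e)))
     (card C * (24 * m\<^sup>2) + card E) 1"
proof -
  define rw :: "nat list \<times> nat \<times> nat \<times> nat + 'e \<Rightarrow> ((nat list \<times> nat \<times> nat \<times> nat + 'e) \<times> real) list" where
    "rw = case_sum (\<lambda>(c, s, i, j). map (\<lambda>(a, b, w). (Inl (tl c, s, i + a * m, j + b * m), w))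
        (strassen_enc s (hd c))) (\<lambda>e. [(Inr e, 1)])"
  have fin: "finite (operands C (2 * m) E)" using assms by (simp add: finite_operands)
  obtain c where "c \<in> C" using assms(3) by blast
  then have "Inl (0 # c, 0, 0, 0) \<in> operands (deeper C) m E"
    using assms(4) by (auto simp: operands_def deeper_def)
  then have ne: "operands (deeper C) m E \<noteq> {}" by blast
  have sub: "fst ` set (rw j) \<subseteq> operands C (2 * m) E" if j: "j \<in> operands (deeper C) m E" for j
  proof (cases j)
    case (Inr e)
    then show ?thesis using j by (auto simp: operands_def rw_def)
  next
    case (Inl q)
    then obtain t c s i k where q: "j = Inl (t # c, s, i, k)" "t < 7" "c \<in> C" "s < 2" "i < m" "k < m"
      using j by (auto simp: operands_def deeper_def)
    have "i + a * m < 2 * m \<and> k + b * m < 2 * m" if "(a, b, w) \<in> set (strassen_enc s t)" for a b w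
    proof -
      have "a * m \<le> 1 * m" "b * m \<le> 1 * m"
        using strassen_enc_bounds[OF q(2) that] by (intro mult_le_mono1; simp)+
      then show ?thesis using q by linarith
    qed
    then show ?thesis using q by (force simp: operands_def rw_def simp del: strassen_enc.simps)
  qed
  have "layer_cost (operands (deeper C) m E) rw (\<lambda>_. 0) =
      (\<Sum>j\<in>deeper C \<times> {..<2} \<times> {..<m} \<times> {..<m}. length (rw (Inl j))) + (\<Sum>j\<in>E. length (rw (Inr j)))"
    unfolding layer_cost_def operands_def using assms(1,2)
    by (subst sum.Plus) (auto simp: deeper_def)
  also have "(\<Sum>j\<in>E. length (rw (Inr j))) = card E" by (simp add: rw_def)
  also have "(\<Sum>j\<in>deeper C \<times> {..<2} \<times> {..<m} \<times> {..<m}. length (rw (Inl j))) =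
      (\<Sum>c\<in>deeper C. \<Sum>s<2. \<Sum>i<m. \<Sum>k<m. length (strassen_enc s (hd c)))"
    unfolding sum.cartesian_product' by (simp add: rw_def del: strassen_enc.simps)
  also have "\<dots> = (\<Sum>t<7. \<Sum>c\<in>C. \<Sum>s<2. m * (m * length (strassen_enc s t)))"
    by (simp add: sum_deeper del: strassen_enc.simps)
  also have "\<dots> = card C * (24 * m\<^sup>2)"
    by (simp add: sum_lessThan7 eval_nat_numeral algebra_simps)
  finally have cost: "layer_cost (operands (deeper C) m E) rw (\<lambda>_. 0) = card C * (24 * m\<^sup>2) + card E" .
  have "id ((\<Sum>(i, w)\<leftarrow>rw j. w * x i) + 0) = case_sum (\<lambda>(c, s, i, j). \<Sum>(a, b, w)\<leftarrow>strassen_enc s (hd c).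
          w * x (Inl (tl c, s, i + a * m, j + b * m))) (\<lambda>e. x (Inr e)) j" for x j
    by (simp add: rw_def comp_def split_def split: sum.split del: strassen_enc.simps)
  then show ?thesis
    using realizes_layer[where rw = rw and b = "\<lambda>_. 0" and act = "\<lambda>_. id", OF fin ne sub]
    unfolding cost by (rule realizes_cong[rotated]) auto
qed

lemma realizes_decode:
  fixes C :: "nat list set" and E :: "'e set"
  assumes "finite C" "finite E" "C \<noteq> {}" "0 < m"
  shows "realizes \<rho> (copies (deeper C) (m, m) E) (copies C (2 * m, 2 * m) E)
     (\<lambda>x. case_sum (\<lambda>(c, i, j). \<Sum>(t, w)\<leftarrow>strassen_dec (i div m) (j div m).
          w * x (Inl (t # c, i mod m, j mod m))) (\<lambda>e. x (Inr e)))
     (card C * (12 * m\<^sup>2) + card E) 1"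
proof -
  define rw :: "nat list \<times> nat \<times> nat + 'e \<Rightarrow> ((nat list \<times> nat \<times> nat + 'e) \<times> real) list" where
    "rw = case_sum (\<lambda>(c, i, j). map (\<lambda>(t, w). (Inl (t # c, i mod m, j mod m), w))
        (strassen_dec (i div m) (j div m))) (\<lambda>e. [(Inr e, 1)])"
  have fin: "finite (copies (deeper C) (m, m) E)"
    using assms by (simp add: finite_copies deeper_def)
  obtain c where "c \<in> C" using assms(3) by blast
  then have "Inl (c, 0, 0) \<in> copies C (2 * m, 2 * m) E"
    using assms(4) by (auto simp: copies_def)
  then have ne: "copies C (2 * m, 2 * m) E \<noteq> {}" by blast
  have sub: "fst ` set (rw j) \<subseteq> copies (deeper C) (m, m) E" if "j \<in> copies C (2 * m, 2 * m) E" for j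
    using that assms(4) by (force simp: copies_def rw_def deeper_def dest: strassen_dec_bounds)
  have "layer_cost (copies C (2 * m, 2 * m) E) rw (\<lambda>_. 0) =
      (\<Sum>j\<in>C \<times> {..<2*m} \<times> {..<2*m}. length (rw (Inl j))) + (\<Sum>j\<in>E. length (rw (Inr j)))"
    unfolding layer_cost_def copies_def using assms(1,2) by (subst sum.Plus) auto
  also have "(\<Sum>j\<in>E. length (rw (Inr j))) = card E" by (simp add: rw_def)
  also have "(\<Sum>j\<in>C \<times> {..<2*m} \<times> {..<2*m}. length (rw (Inl j))) =
      (\<Sum>c\<in>C. \<Sum>i<2*m. \<Sum>k<2*m. length (strassen_dec (i div m) (k div m)))"
    unfolding sum.cartesian_product' by (simp add: rw_def)
  also have "\<dots> = card C * (12 * m\<^sup>2)"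
  proof -
    have D: "(\<Sum>l<2*m. f (l div m)) = m * (f 0 + f 1)" for f :: "nat \<Rightarrow> nat"
    proof -
      have "(\<Sum>l<2 * m. f (l div m)) = (\<Sum>l<m. f (l div m)) + (\<Sum>l=m..<m+m. f (l div m))"
        by (metis atLeast0LessThan mult_2 sum.atLeastLessThan_concat le0 le_add1)
      also have "(\<Sum>l=m..<m+m. f (l div m)) = (\<Sum>l<m. f ((l + m) div m))"
        using sum.shift_bounds_nat_ivl[of "\<lambda>l. f (l div m)" 0 m m] by (simp add: atLeast0LessThan)
      finally show ?thesis using assms(4) by (simp add: algebra_simps)
    qed
    let ?d = "\<lambda>a b. length (strassen_dec a b)"
    have "(\<Sum>i<2*m. \<Sum>k<2*m. ?d (i div m) (k div m)) = (\<Sum>i<2*m. m * (?d (i div m) 0 + ?d (i div m) 1))"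
      by (rule sum.cong[OF refl D])
    also have "\<dots> = m * (m * (?d 0 0 + ?d 0 1) + m * (?d 1 0 + ?d 1 1))"
      by (rule D[of "\<lambda>a. m * (?d a 0 + ?d a 1)"])
    finally show ?thesis by (simp add: strassen_dec_def power2_eq_square)
  qed
  finally have cost: "layer_cost (copies C (2 * m, 2 * m) E) rw (\<lambda>_. 0) = card C * (12 * m\<^sup>2) + card E" .
  have "id ((\<Sum>(i, w)\<leftarrow>rw j. w * x i) + 0) = case_sum (\<lambda>(c, i, j). \<Sum>(t, w)\<leftarrow>strassen_dec (i div m) (j div m).
          w * x (Inl (t # c, i mod m, j mod m))) (\<lambda>e. x (Inr e)) j" for x j
    by (simp add: rw_def comp_def split_def split: sum.split)
  then show ?thesis
    using realizes_layer[where rw = rw and b = "\<lambda>_. 0" and act = "\<lambda>_. id", OF fin ne sub]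
    unfolding cost by (rule realizes_cong[rotated]) auto
qed

text \<open>Each level at most doubles the entries, which must not exceed \<open>K\<close> at the bottom, and
  multiplies the error by at most four. The entries indexed by \<open>E\<close> are passed on unchanged.\<close>

lemma realizes_strassen:
  fixes P :: mnn and E :: "'e set" and K \<sigma> :: real
  assumes P: "is_mnn \<rho> (1, 2) (1, 1) P"
    and PK: "\<And>x y. \<bar>x\<bar> \<le> K \<Longrightarrow> \<bar>y\<bar> \<le> K \<Longrightarrow>
      \<bar>realization P (mat_of_rows_list 2 [[x, y]]) $$ (0,0) - x * y\<bar> \<le> \<sigma>"
    and "finite C" "C \<noteq> {}" "finite E"
  shows "\<exists>F. realizes \<rho> (operands C (2 ^ k) E) (copies C (2 ^ k, 2 ^ k) E) F
      (card C * strassen_weights (num_weights P) k + card E * (2 * k + length P)) (2 * k + length P) \<and>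
    (\<forall>x. (\<forall>e\<in>E. F x (Inr e) = x (Inr e)) \<and>
      ((\<forall>c\<in>C. \<forall>s<2. \<forall>i<2^k. \<forall>j<2^k. 2 ^ k * \<bar>x (Inl (c, s, i, j))\<bar> \<le> K) \<longrightarrow>
        (\<forall>c\<in>C. \<forall>i<2^k. \<forall>j<2^k. \<bar>F x (Inl (c, i, j)) -
           (\<Sum>l<2^k. x (Inl (c, 0, i, l)) * x (Inl (c, 1, l, j)))\<bar> \<le> 4 ^ k * \<sigma>)))"
  using assms(3,4)
proof (induction k arbitrary: C)
  case 0
  \<comment> \<open>At size one the two operands are a pair of scalars, that is, the 1 x 2 input of
    \<open>P\<close> up to renaming: the operand number s becomes the column.\<close>
  define h :: "nat list \<times> nat \<times> nat + 'e \<Rightarrow> nat list \<times> nat \<times> nat \<times> nat + 'e" where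
    "h = case_sum (\<lambda>(c, i, s). Inl (c, s, 0, 0)) Inr"
  have h: "bij_betw h (copies C (1, 2) E) (operands C 1 E)"
    by (rule bij_betw_byWitness[where f' = "case_sum (\<lambda>(c, s, _). Inl (c, 0, s)) Inr"])
       (auto simp: h_def copies_def operands_def)
  have "P \<noteq> []" using P by (simp add: is_mnn_def)
  note R = realizes_reindex[OF realizes_batch[OF is_mnn_imp_chain[OF P] this 0 assms(5)] h]
  have M: "mat (Suc 0) 2 (\<lambda>kl. x (h (Inl (c, kl)))) =
      mat_of_rows_list 2 [[x (Inl (c, 0, 0, 0)), x (Inl (c, 1, 0, 0))]]" for x :: "_ \<Rightarrow> real" and c
    by (intro eq_matI) (auto simp: mat_of_rows_list_def h_def less_2_cases_iff)
  have "batch P (1, 2) (\<lambda>i. x (h i)) (Inl (c, 0, 0)) = realization P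
      (mat_of_rows_list 2 [[x (Inl (c, 0, 0, 0)), x (Inl (c, 1, 0, 0))]]) $$ (0, 0)" for x c
    by (simp add: batch_def M)
  moreover have "batch P (1, 2) (\<lambda>i. x (h i)) (Inr e) = x (Inr e)" for x e
    by (simp add: batch_def h_def)
  ultimately show ?case
    using R by (intro exI[of _ "\<lambda>x. batch P (1, 2) (\<lambda>i. x (h i))"]) (simp add: PK)
next
  case (Suc k)
  have dC: "finite (deeper C)" "deeper C \<noteq> {}"
    using Suc.prems by (auto simp: deeper_def lessThan_empty_iff)
  obtain F where F: "realizes \<rho> (operands (deeper C) (2 ^ k) E) (copies (deeper C) (2 ^ k, 2 ^ k) E) F
      (card (deeper C) * strassen_weights (num_weights P) k + card E * (2 * k + length P)) (2 * k + length P)"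
    and carry: "\<And>x e. e \<in> E \<Longrightarrow> F x (Inr e) = x (Inr e)"
    and mult: "\<And>x c i j. (\<forall>c\<in>deeper C. \<forall>s<2. \<forall>i<2^k. \<forall>j<2^k. 2 ^ k * \<bar>x (Inl (c, s, i, j))\<bar> \<le> K) \<Longrightarrow>
        c \<in> deeper C \<Longrightarrow> i < 2^k \<Longrightarrow> j < 2^k \<Longrightarrow> \<bar>F x (Inl (c, i, j)) -
           (\<Sum>l<2^k. x (Inl (c, 0, i, l)) * x (Inl (c, 1, l, j)))\<bar> \<le> 4 ^ k * \<sigma>"
    using Suc.IH[OF dC] by blast
  define m :: nat where "m = 2 ^ k"
  have m: "0 < m" "2 ^ Suc k = 2 * m" by (simp_all add: m_def)
  define enc where "enc = (\<lambda>x :: nat list \<times> nat \<times> nat \<times> nat + 'e \<Rightarrow> real.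
     case_sum (\<lambda>(c, s, i, j). \<Sum>(a, b, w)\<leftarrow>strassen_enc s (hd c).
          w * x (Inl (tl c, s, i + a * m, j + b * m))) (\<lambda>e. x (Inr e)))"
  define dec where "dec = (\<lambda>x :: nat list \<times> nat \<times> nat + 'e \<Rightarrow> real.
     case_sum (\<lambda>(c, i, j). \<Sum>(t, w)\<leftarrow>strassen_dec (i div m) (j div m).
          w * x (Inl (t # c, i mod m, j mod m))) (\<lambda>e. x (Inr e)))"
  have "realizes \<rho> (operands C (2 * m) E) (copies C (2 * m, 2 * m) E) (\<lambda>x. dec (F (enc x)))
     ((card C * (24 * m\<^sup>2) + card E) +
      (card (deeper C) * strassen_weights (num_weights P) k + card E * (2 * k + length P)) +
      (card C * (12 * m\<^sup>2) + card E)) (1 + (2 * k + length P) + 1)"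
    using realizes_comp[OF realizes_comp[OF
          realizes_encode[OF Suc.prems(1) assms(5) Suc.prems(2) m(1)] F[folded m_def]]
          realizes_decode[OF Suc.prems(1) assms(5) Suc.prems(2) m(1)]] dC(1) assms(5)
    unfolding enc_def dec_def by (simp add: finite_operands finite_copies)
  moreover have "(card C * (24 * m\<^sup>2) + card E) +
      (card (deeper C) * strassen_weights (num_weights P) k + card E * (2 * k + length P)) +
      (card C * (12 * m\<^sup>2) + card E) =
     card C * strassen_weights (num_weights P) (Suc k) + card E * (2 * Suc k + length P)"
  proof -
    have "m\<^sup>2 = 4 ^ k"
      using power_mult[of "2 :: nat" 2 k] by (simp add: m_def power_mult[symmetric] mult.commute)
    then show ?thesis by (simp add: card_deeper algebra_simps)
  qed
  ultimately have R: "realizes \<rho> (operands C (2 * m) E) (copies C (2 * m, 2 * m) E) (\<lambda>x. dec (F (enc x)))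
     (card C * strassen_weights (num_weights P) (Suc k) + card E * (2 * Suc k + length P))
     (2 * Suc k + length P)"
    by simp
  have "\<bar>dec (F (enc x)) (Inl (c, i, j)) -
           (\<Sum>l<2 * m. x (Inl (c, 0, i, l)) * x (Inl (c, 1, l, j)))\<bar> \<le> 4 ^ Suc k * \<sigma>"
    if x: "\<forall>c\<in>C. \<forall>s<2. \<forall>i<2*m. \<forall>j<2*m. 2 * m * \<bar>x (Inl (c, s, i, j))\<bar> \<le> K"
      and c: "c \<in> C" "i < 2 * m" "j < 2 * m"
    for x :: "nat list \<times> nat \<times> nat \<times> nat + 'e \<Rightarrow> real" and c i j
  proof -
    let ?a = "i div m" and ?b = "j div m" and ?i = "i mod m" and ?j = "j mod m"
    have ij: "?a < 2" "?b < 2" "?i < m" "?j < m"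
      using c m(1) by (auto simp: less_mult_imp_div_less)
    have enc: "enc x (Inl (t # c', s, i, j)) =
       (\<Sum>(a, b, w)\<leftarrow>strassen_enc s t. w * x (Inl (c', s, i + a * m, j + b * m)))" for t s i j c'
      by (simp add: enc_def)
    \<comment> \<open>The hypothesis carries the factor \<open>2 ^ Suc k\<close>, the induction
      hypothesis asks for \<open>2 ^ k\<close>; the difference is exactly the doubling by the
      encoding.\<close>
    have small: "2 ^ k * \<bar>enc x (Inl (c', s, i, j))\<bar> \<le> K"
      if "c' \<in> deeper C" "s < 2" "i < 2 ^ k" "j < 2 ^ k" for c' s i j
    proof -
      obtain t c'' where c'': "c' = t # c''" "t < 7" "c'' \<in> C"
        using \<open>c' \<in> deeper C\<close> by (auto simp: deeper_def)
      have "\<bar>x (Inl (c'', s, i + a * m, j + b * m))\<bar> \<le> K / (2 * real m)" if "a < 2" "b < 2" for a b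
      proof -
        have "a * m \<le> 1 * m" "b * m \<le> 1 * m" using that by (intro mult_le_mono1; simp)+
        moreover have "i < m" "j < m" using \<open>i < 2 ^ k\<close> \<open>j < 2 ^ k\<close> by (simp_all add: m_def)
        ultimately have "i + a * m < 2 * m" "j + b * m < 2 * m" by linarith+
        then have "2 * m * \<bar>x (Inl (c'', s, i + a * m, j + b * m))\<bar> \<le> K"
          using x c''(3) \<open>s < 2\<close> by blast
        then show ?thesis using m(1) by (simp add: field_simps)
      qed
      from strassen_enc_abs[OF c''(2) this]
      have "\<bar>enc x (Inl (c', s, i, j))\<bar> \<le> 2 * (K / (2 * real m))"
        unfolding c'' enc .
      then show ?thesis using m(1) by (simp add: m_def field_simps)
    qed
    let ?y = "\<lambda>t. F (enc x) (Inl (t # c, ?i, ?j))"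
    let ?z = "\<lambda>t. \<Sum>l<m. enc x (Inl (t # c, 0, ?i, l)) * enc x (Inl (t # c, 1, l, ?j))"
    have e: "\<bar>?y t - ?z t\<bar> \<le> 4 ^ k * \<sigma>" if t: "t < 7" for t
    proof -
      have "t # c \<in> deeper C" using t c(1) by (auto simp: deeper_def)
      from mult[OF _ this ij(3,4)[unfolded m_def]] show ?thesis
        using small unfolding m_def by blast
    qed
    have "(\<Sum>(t, w)\<leftarrow>strassen_dec ?a ?b. w * ?z t) =
       (\<Sum>l<m. \<Sum>(t, w)\<leftarrow>strassen_dec ?a ?b. w *
         (enc x (Inl (t # c, 0, ?i, l)) * enc x (Inl (t # c, 1, l, ?j))))"
      by (simp add: sum_sum_list split_def sum_distrib_left)
    also have "\<dots> = (\<Sum>l<m. x (Inl (c, 0, i, l)) * x (Inl (c, 1, l, j)) +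
         x (Inl (c, 0, i, l + m)) * x (Inl (c, 1, l + m, j)))"
    proof (intro sum.cong refl)
      fix l
      have "?i + ?a * m = i" "?j + ?b * m = j" by simp_all
      then show "(\<Sum>(t, w)\<leftarrow>strassen_dec ?a ?b. w *
         (enc x (Inl (t # c, 0, ?i, l)) * enc x (Inl (t # c, 1, l, ?j)))) =
         x (Inl (c, 0, i, l)) * x (Inl (c, 1, l, j)) + x (Inl (c, 0, i, l + m)) * x (Inl (c, 1, l + m, j))"
        using strassen_identity[OF ij(1,2), of "\<lambda>a b. x (Inl (c, 0, ?i + a * m, l + b * m))"
           "\<lambda>a b. x (Inl (c, 1, l + a * m, ?j + b * m))"]
        unfolding enc by (simp only: mult_0 mult_1 add_0_right)
    qed
    also have "\<dots> = (\<Sum>l<2 * m. x (Inl (c, 0, i, l)) * x (Inl (c, 1, l, j)))"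
      by (rule sum_double[symmetric])
    finally have z: "(\<Sum>(t, w)\<leftarrow>strassen_dec ?a ?b. w * ?z t) =
      (\<Sum>l<2 * m. x (Inl (c, 0, i, l)) * x (Inl (c, 1, l, j)))" .
    have "\<bar>(\<Sum>(t, w)\<leftarrow>strassen_dec ?a ?b. w * ?y t) - (\<Sum>(t, w)\<leftarrow>strassen_dec ?a ?b. w * ?z t)\<bar>
        \<le> 4 * (4 ^ k * \<sigma>)"
      by (rule strassen_dec_error[OF e])
    moreover have "dec (F (enc x)) (Inl (c, i, j)) = (\<Sum>(t, w)\<leftarrow>strassen_dec ?a ?b. w * ?y t)"
      by (simp add: dec_def)
    ultimately show ?thesis unfolding z by simp
  qed
  moreover have "dec (F (enc x)) (Inr e) = x (Inr e)" if "e \<in> E" for x e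
    using carry[OF that] by (simp add: dec_def enc_def)
  moreover have "real (2 * m) = 2 ^ Suc k" by (simp add: m_def)
  ultimately have "(\<forall>e\<in>E. dec (F (enc x)) (Inr e) = x (Inr e)) \<and>
      ((\<forall>c\<in>C. \<forall>s<2. \<forall>i<2 ^ Suc k. \<forall>j<2 ^ Suc k. 2 ^ Suc k * \<bar>x (Inl (c, s, i, j))\<bar> \<le> K) \<longrightarrow>
        (\<forall>c\<in>C. \<forall>i<2 ^ Suc k. \<forall>j<2 ^ Suc k. \<bar>dec (F (enc x)) (Inl (c, i, j)) -
           (\<Sum>l<2 ^ Suc k. x (Inl (c, 0, i, l)) * x (Inl (c, 1, l, j)))\<bar> \<le> 4 ^ Suc k * \<sigma>))" for x
    unfolding m(2) by simp
  then show ?case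
    using R unfolding m(2) by (intro exI[of _ "\<lambda>x. dec (F (enc x))"] conjI allI) blast+
qed

section \<open>Operator norm bounds and the Neumann series\<close>

text \<open>Matrices are plain functions with the dimension as a parameter. Values outside the range
  are arbitrary, so equalities are only used for indices below n, through \<open>mm_cong\<close> and
  \<open>opb_cong\<close>.\<close>

definition mv :: "nat \<Rightarrow> (nat \<Rightarrow> nat \<Rightarrow> real) \<Rightarrow> (nat \<Rightarrow> real) \<Rightarrow> nat \<Rightarrow> real" where
  "mv n M v i = (\<Sum>j<n. M i j * v j)"

definition mm :: "nat \<Rightarrow> (nat \<Rightarrow> nat \<Rightarrow> real) \<Rightarrow> (nat \<Rightarrow> nat \<Rightarrow> real) \<Rightarrow> nat \<Rightarrow> nat \<Rightarrow> real" where
  "mm n A B i j = (\<Sum>l<n. A i l * B l j)"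

definition idm :: "nat \<Rightarrow> nat \<Rightarrow> real" where
  "idm i j = (if i = j then 1 else 0)"

abbreviation nrm :: "nat \<Rightarrow> (nat \<Rightarrow> real) \<Rightarrow> real" where
  "nrm n v \<equiv> L2_set v {..<n}"

text \<open>An upper bound for the operator norm as a predicate. It composes under sums and products
  without any supremum; the passage to \<open>mat_norm2\<close> is made only at the end.\<close>

definition opb :: "nat \<Rightarrow> (nat \<Rightarrow> nat \<Rightarrow> real) \<Rightarrow> real \<Rightarrow> bool" where
  "opb n M c \<longleftrightarrow> (\<forall>v. nrm n (mv n M v) \<le> c * nrm n v)"

section \<open>Calculus of operator norm bounds\<close>

lemma nrm_cong: "(\<And>i. i < n \<Longrightarrow> v i = w i) \<Longrightarrow> nrm n v = nrm n w"
  by (intro L2_set_cong) auto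

lemma nrm_scale: "nrm n (\<lambda>i. r * v i) = \<bar>r\<bar> * nrm n v"
  by (simp add: L2_set_def power_mult_distrib sum_distrib_left[symmetric] real_sqrt_mult)

lemma opb_cong:
  assumes "\<And>i j. i < n \<Longrightarrow> j < n \<Longrightarrow> M i j = M' i j"
  shows "opb n M c \<longleftrightarrow> opb n M' c"
proof -
  have "nrm n (mv n M v) = nrm n (mv n M' v)" for v
    by (rule nrm_cong) (simp add: mv_def assms)
  then show ?thesis by (simp add: opb_def)
qed

lemma opb_mono: "opb n M c \<Longrightarrow> c \<le> c' \<Longrightarrow> opb n M c'"
  unfolding opb_def by (meson L2_set_nonneg mult_right_mono order_trans)

lemma opb_add:
  assumes "opb n M a" "opb n M' b"
  shows "opb n (\<lambda>i j. M i j + M' i j) (a + b)"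
  unfolding opb_def
proof
  fix v
  have "nrm n (mv n (\<lambda>i j. M i j + M' i j) v) = nrm n (\<lambda>i. mv n M v i + mv n M' v i)"
    by (intro nrm_cong) (simp add: mv_def distrib_right sum.distrib)
  also have "\<dots> \<le> nrm n (mv n M v) + nrm n (mv n M' v)" by (rule L2_set_triangle_ineq)
  also have "\<dots> \<le> (a + b) * nrm n v"
    using assms unfolding opb_def by (simp add: distrib_right add_mono)
  finally show "nrm n (mv n (\<lambda>i j. M i j + M' i j) v) \<le> (a + b) * nrm n v" .
qed

lemma opb_scale:
  assumes "opb n M a"
  shows "opb n (\<lambda>i j. r * M i j) (\<bar>r\<bar> * a)"
  unfolding opb_def
proof
  fix v
  have "mv n (\<lambda>i j. r * M i j) v = (\<lambda>i. r * mv n M v i)"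
    by (simp add: mv_def fun_eq_iff sum_distrib_left mult.assoc)
  then have "nrm n (mv n (\<lambda>i j. r * M i j) v) = \<bar>r\<bar> * nrm n (mv n M v)"
    by (simp add: nrm_scale)
  also have "\<dots> \<le> \<bar>r\<bar> * (a * nrm n v)"
    using assms unfolding opb_def by (intro mult_left_mono) auto
  finally show "nrm n (mv n (\<lambda>i j. r * M i j) v) \<le> \<bar>r\<bar> * a * nrm n v" by (simp add: mult.assoc)
qed

lemma opb_diff:
  assumes "opb n M a" "opb n M' b"
  shows "opb n (\<lambda>i j. M i j - M' i j) (a + b)"
  using opb_add[OF assms(1) opb_scale[OF assms(2), of "-1"]] by simp

lemma mv_mm: "mv n (mm n A B) v = mv n A (mv n B v)"
proof
  fix i
  have "mv n (mm n A B) v i = (\<Sum>j<n. \<Sum>l<n. A i l * (B l j * v j))"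
    by (simp add: mv_def mm_def sum_distrib_right mult.assoc)
  also have "\<dots> = mv n A (mv n B v) i"
    by (subst sum.swap) (simp add: mv_def sum_distrib_left)
  finally show "mv n (mm n A B) v i = mv n A (mv n B v) i" .
qed

lemma opb_mm:
  assumes "opb n A a" "opb n B b" "0 \<le> a"
  shows "opb n (mm n A B) (a * b)"
  unfolding opb_def
proof
  fix v
  have "nrm n (mv n (mm n A B) v) \<le> a * nrm n (mv n B v)"
    using assms(1) by (simp add: mv_mm opb_def)
  also have "\<dots> \<le> a * (b * nrm n v)"
    using assms(2,3) unfolding opb_def by (intro mult_left_mono) auto
  finally show "nrm n (mv n (mm n A B) v) \<le> a * b * nrm n v" by (simp add: mult.assoc)
qed

lemma mv_idm: "i < n \<Longrightarrow> mv n idm v i = v i"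
  by (simp add: mv_def idm_def if_distrib[of "\<lambda>x. x * _"] cong: if_cong)

lemma opb_idm: "opb n idm 1"
  unfolding opb_def using nrm_cong[OF mv_idm, of n] by simp

lemma opb_entry:
  assumes "opb n M c" "i < n" "j < n"
  shows "\<bar>M i j\<bar> \<le> c"
proof -
  let ?e = "\<lambda>k. if k = j then 1 else 0 :: real"
  have "mv n M ?e i = M i j"
    using assms(3) by (simp add: mv_def if_distrib[of "\<lambda>x. _ * x"] cong: if_cong)
  moreover have "\<bar>mv n M ?e i\<bar> \<le> nrm n (mv n M ?e)"
    using member_le_L2_set[of "{..<n}" i "\<lambda>i. \<bar>mv n M ?e i\<bar>"] assms(2) by (simp add: L2_set_def)
  moreover have "nrm n (mv n M ?e) \<le> c * nrm n ?e"
    using assms(1) by (simp add: opb_def)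
  moreover have "nrm n ?e = 1"
    using assms(3) by (simp add: L2_set_def if_distrib[of "\<lambda>x. x\<^sup>2"] cong: if_cong)
  ultimately show ?thesis by simp
qed

text \<open>One factor sqrt n comes from Cauchy-Schwarz in each row, the other from summing n equal
  coordinate bounds.\<close>

lemma opb_of_entries:
  assumes "\<And>i j. i < n \<Longrightarrow> j < n \<Longrightarrow> \<bar>M i j\<bar> \<le> b"
  shows "opb n M (real n * b)"
  unfolding opb_def
proof
  fix v
  have b: "0 \<le> b" if "0 < n" using assms[OF that that] by linarith
  have "\<bar>mv n M v i\<bar> \<le> b * sqrt (real n) * nrm n v" if "i < n" for i
  proof -
    have "\<bar>mv n M v i\<bar> \<le> (\<Sum>j<n. \<bar>M i j\<bar> * \<bar>v j\<bar>)"
      unfolding mv_def by (rule order_trans[OF sum_abs]) (simp add: abs_mult)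
    also have "\<dots> \<le> (\<Sum>j<n. \<bar>b\<bar> * \<bar>v j\<bar>)"
      using assms[OF that] by (intro sum_mono mult_right_mono) (auto intro: order_trans[OF _ abs_ge_self])
    also have "\<dots> \<le> L2_set (\<lambda>_. b) {..<n} * nrm n v"
      by (rule L2_set_mult_ineq)
    also have "L2_set (\<lambda>_. b) {..<n} = b * sqrt (real n)"
      using b that by (simp add: L2_set_def real_sqrt_mult)
    finally show ?thesis .
  qed
  then have "nrm n (\<lambda>i. \<bar>mv n M v i\<bar>) \<le> nrm n (\<lambda>_. b * sqrt (real n) * nrm n v)"
    by (intro L2_set_mono) auto
  also have "\<dots> = sqrt (real n) * \<bar>b * sqrt (real n) * nrm n v\<bar>"
    by (simp add: L2_set_def real_sqrt_mult)
  also have "\<dots> = real n * b * nrm n v"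
    using b by (cases "n = 0") (simp_all add: abs_mult L2_set_nonneg abs_of_nonneg)
  finally show "nrm n (mv n M v) \<le> real n * b * nrm n v"
    by (simp add: L2_set_def)
qed

section \<open>Algebra of the matrix product\<close>

lemma mm_assoc: "mm n (mm n A B) C = mm n A (mm n B C)"
proof (intro ext)
  fix i j
  have "mm n (mm n A B) C i j = mv n (mm n A B) (\<lambda>l. C l j) i" by (simp add: mv_def mm_def[of n "mm n A B"])
  also have "\<dots> = mm n A (mm n B C) i j"
    unfolding mv_mm by (simp add: mv_def mm_def)
  finally show "mm n (mm n A B) C i j = mm n A (mm n B C) i j" .
qed

lemma mm_idm_left: "i < n \<Longrightarrow> mm n idm M i j = M i j"
  using mv_idm[of i n "\<lambda>l. M l j"] by (simp add: mv_def mm_def)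

lemma mm_idm_right: "j < n \<Longrightarrow> mm n M idm i j = M i j"
  by (simp add: mm_def idm_def if_distrib[of "\<lambda>x. _ * x"] cong: if_cong)

lemma mm_cong:
  "(\<And>l. l < n \<Longrightarrow> A i l = A' i l) \<Longrightarrow> (\<And>l. l < n \<Longrightarrow> B l j = B' l j) \<Longrightarrow> mm n A B i j = mm n A' B' i j"
  by (simp add: mm_def)

lemma mm_add_right: "mm n M (\<lambda>i j. A i j + B i j) i j = mm n M A i j + mm n M B i j"
  by (simp add: mm_def distrib_left sum.distrib)

lemma mm_diff_left: "mm n (\<lambda>i j. A i j - B i j) M i j = mm n A M i j - mm n B M i j"
  by (simp add: mm_def left_diff_distrib sum_subtractf)

lemma mm_diff_right: "mm n M (\<lambda>i j. A i j - B i j) i j = mm n M A i j - mm n M B i j"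
  by (simp add: mm_def right_diff_distrib sum_subtractf)

lemma mm_scale_left: "mm n (\<lambda>i j. r * A i j) M i j = r * mm n A M i j"
  by (simp add: mm_def sum_distrib_left mult.assoc)

lemma mm_scale_right: "mm n M (\<lambda>i j. r * A i j) i j = r * mm n M A i j"
  by (simp add: mm_def sum_distrib_left algebra_simps)

text \<open>With $S_j = \sum_{l < 2^j} X^l$ one has $T_j = 2^{-j} S_j$. The scaling keeps the operator norm
  of $T_j$ below one, so that the entries stay in the range of the product network.\<close>

primrec Ym :: "nat \<Rightarrow> (nat \<Rightarrow> nat \<Rightarrow> real) \<Rightarrow> nat \<Rightarrow> nat \<Rightarrow> nat \<Rightarrow> real" where
  "Ym n X 0 = X"
| "Ym n X (Suc j) = mm n (Ym n X j) (Ym n X j)"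

definition half_step :: "(nat \<Rightarrow> nat \<Rightarrow> real) \<Rightarrow> nat \<Rightarrow> nat \<Rightarrow> real" where
  "half_step Y i j = 1/2 * Y i j + 1/2 * idm i j"

primrec Tm :: "nat \<Rightarrow> (nat \<Rightarrow> nat \<Rightarrow> real) \<Rightarrow> nat \<Rightarrow> nat \<Rightarrow> nat \<Rightarrow> real" where
  "Tm n X 0 = idm"
| "Tm n X (Suc j) = mm n (Tm n X j) (half_step (Ym n X j))"

lemma opb_half_step: "opb n Y c \<Longrightarrow> opb n (half_step Y) ((1 + c) / 2)"
  using opb_add[OF opb_scale[of n Y c, where r = "1/2"] opb_scale[OF opb_idm, where r = "1/2"]]
  unfolding half_step_def by (simp add: add_divide_distrib add.commute)

lemma opb_Ym: "opb n X c \<Longrightarrow> 0 \<le> c \<Longrightarrow> opb n (Ym n X j) (c ^ (2 ^ j))"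
proof (induction j)
  case (Suc j)
  then show ?case using opb_mm[of n "Ym n X j" "c ^ 2 ^ j" "Ym n X j" "c ^ 2 ^ j"]
    by (simp add: power_add[symmetric] mult_2)
qed simp

lemma opb_Ym_le_1:
  assumes "opb n X c" "0 \<le> c" "c \<le> 1"
  shows "opb n (Ym n X j) 1"
  by (rule opb_mono[OF opb_Ym[OF assms(1,2)]]) (simp add: power_le_one assms)

lemma opb_Tm:
  assumes "opb n X c" "0 \<le> c" "c \<le> 1"
  shows "opb n (Tm n X j) 1"
proof (induction j)
  case 0
  then show ?case by (simp add: opb_idm)
next
  case (Suc j)
  have "opb n (half_step (Ym n X j)) 1"
    using opb_half_step[OF opb_Ym_le_1[OF assms]] by simp
  then show ?case using opb_mm[OF Suc] by fastforce
qed

text \<open>Iterates (I - Y)(I + Y) = I - Y^2; the factor 2^k undoes the halving in each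
  \<open>half_step\<close>.\<close>

lemma telescope_Tm:
  assumes "i < n" "j < n"
  shows "mm n (\<lambda>i j. idm i j - X i j) (Tm n X k) i j * 2 ^ k = idm i j - Ym n X k i j"
  using assms
proof (induction k arbitrary: i j)
  case 0
  then show ?case by (simp add: mm_idm_right)
next
  case (Suc k)
  let ?Y = "Ym n X k"
  have "mm n (\<lambda>i j. idm i j - X i j) (Tm n X (Suc k)) i j * 2 ^ Suc k =
      2 * (2 ^ k * mm n (mm n (\<lambda>i j. idm i j - X i j) (Tm n X k)) (half_step ?Y) i j)"
    by (simp add: mm_assoc)
  also have "\<dots> = 2 * mm n (\<lambda>i j. 2 ^ k * mm n (\<lambda>i j. idm i j - X i j) (Tm n X k) i j) (half_step ?Y) i j"
    by (simp add: mm_scale_left)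
  also have "\<dots> = 2 * mm n (\<lambda>i j. idm i j - ?Y i j) (half_step ?Y) i j"
    using Suc.IH[OF Suc.prems(1)] by (intro arg_cong[of _ _ "\<lambda>x. 2 * x"] mm_cong) (simp_all add: mult.commute)
  also have "\<dots> = 2 * (half_step ?Y i j - mm n ?Y (half_step ?Y) i j)"
    using Suc.prems by (simp add: mm_diff_left mm_idm_left)
  also have "mm n ?Y (half_step ?Y) i j = 1/2 * mm n ?Y ?Y i j + 1/2 * ?Y i j"
    using Suc.prems unfolding half_step_def mm_add_right mm_scale_right by (simp add: mm_idm_right)
  finally show ?case by (simp add: half_step_def)
qed

text \<open>The invariant: from 1/2 <= q follows q - q^2 = q (1 - q) >= (1 - q)/2 >= eta, so the
  inexact square keeps the bound q. For the error, Yh Yh - Y Y = Yh (Yh - Y) + (Yh - Y) Y, where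
  both outer factors have norm at most one.\<close>

lemma approx_square:
  assumes q: "opb n Yh q" "1/2 \<le> q" "q \<le> 1" and Y: "opb n Y 1"
    and e: "opb n (\<lambda>i j. Yh i j - Y i j) e"
    and Z: "opb n (\<lambda>i j. Z i j - mm n Yh Yh i j) \<eta>" and \<eta>: "\<eta> \<le> (1 - q) / 2"
  shows "opb n Z q" "opb n (\<lambda>i j. Z i j - mm n Y Y i j) (2 * e + \<eta>)"
proof -
  have "opb n (\<lambda>i j. (Z i j - mm n Yh Yh i j) + mm n Yh Yh i j) (\<eta> + q * q)"
    using q(2) by (intro opb_add[OF Z] opb_mm[OF q(1) q(1)]) simp
  moreover have "\<eta> + q * q \<le> q"
  proof -
    have "1/2 * (1 - q) \<le> q * (1 - q)" using q(2,3) by (intro mult_right_mono) auto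
    moreover have "q * (1 - q) = q - q * q" by (simp add: algebra_simps)
    ultimately show ?thesis using \<eta> by linarith
  qed
  ultimately show "opb n Z q" by (simp add: opb_mono)
  have "opb n (mm n Yh (\<lambda>i j. Yh i j - Y i j)) (1 * e)"
    by (intro opb_mm[OF opb_mono[OF q(1,3)] e]) simp
  moreover have "opb n (mm n (\<lambda>i j. Yh i j - Y i j) Y) (e * 1)" if "0 \<le> e"
    by (intro opb_mm[OF e Y] that)
  \<comment> \<open>For n = 0 every constant is a bound, even a negative one; otherwise an entry
    shows that e is nonnegative.\<close>
  moreover have "0 \<le> e \<or> n = 0"
    using opb_entry[OF e, of 0 0] by (cases n) auto
  moreover have "opb n M c" if "n = 0" for M c
    using that by (simp add: opb_def)
  ultimately have "opb n (\<lambda>i j. mm n Yh (\<lambda>i j. Yh i j - Y i j) i j + mm n (\<lambda>i j. Yh i j - Y i j) Y i j) (e + e)"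
    using opb_add by fastforce
  from opb_add[OF Z this] show "opb n (\<lambda>i j. Z i j - mm n Y Y i j) (2 * e + \<eta>)"
    by (simp add: mm_diff_left mm_diff_right algebra_simps)
qed

text \<open>Here eta + (1 + q)/2 <= 1 keeps the norm bound. The error splits as T (Yh - Y)/2 + (Th -
  T) \<open>half_step Yh\<close>, so that the halving also halves the influence of e.\<close>

lemma approx_step:
  assumes q: "opb n Yh q" "0 \<le> q" "q \<le> 1" and T: "opb n T 1" and Th: "opb n Th 1"
    and e: "opb n (\<lambda>i j. Yh i j - Y i j) e" and f: "opb n (\<lambda>i j. Th i j - T i j) f" and "0 \<le> f"
    and Z: "opb n (\<lambda>i j. Z i j - mm n Th (half_step Yh) i j) \<eta>" and \<eta>: "\<eta> \<le> (1 - q) / 2"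
  shows "opb n Z 1" "opb n (\<lambda>i j. Z i j - mm n T (half_step Y) i j) (f + e / 2 + \<eta>)"
proof -
  have h: "opb n (half_step Yh) ((1 + q) / 2)" by (rule opb_half_step[OF q(1)])
  have "opb n (\<lambda>i j. (Z i j - mm n Th (half_step Yh) i j) + mm n Th (half_step Yh) i j)
      (\<eta> + 1 * ((1 + q) / 2))"
    by (intro opb_add[OF Z] opb_mm[OF Th h]) simp
  moreover have "\<eta> + 1 * ((1 + q) / 2) \<le> 1" using \<eta> by (simp add: field_simps)
  ultimately show "opb n Z 1" by (simp add: opb_mono)
  have "opb n (mm n T (\<lambda>i j. 1/2 * (Yh i j - Y i j))) (1 * (\<bar>1/2\<bar> * e))"
    by (intro opb_mm[OF T] opb_scale[OF e]) simp
  moreover have "opb n (mm n (\<lambda>i j. Th i j - T i j) (half_step Yh)) (f * 1)"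
    by (intro opb_mm[OF f] opb_mono[OF h] \<open>0 \<le> f\<close>) (use q(3) in simp)
  ultimately have "opb n (\<lambda>i j. mm n T (\<lambda>i j. 1/2 * (Yh i j - Y i j)) i j +
      mm n (\<lambda>i j. Th i j - T i j) (half_step Yh) i j) (e / 2 + f)"
    using opb_add by fastforce
  from opb_add[OF Z this]
  have "opb n (\<lambda>i j. (Z i j - mm n Th (half_step Yh) i j) + (mm n T (\<lambda>i j. 1/2 * (Yh i j - Y i j)) i j +
      mm n (\<lambda>i j. Th i j - T i j) (half_step Yh) i j)) (f + e / 2 + \<eta>)"
    by (simp add: add.commute add.left_commute)
  moreover have "mm n T (\<lambda>i j. 1/2 * (Yh i j - Y i j)) i j =
      mm n T (half_step Yh) i j - mm n T (half_step Y) i j" for i j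
    unfolding half_step_def mm_add_right mm_scale_right mm_diff_right by (simp add: algebra_simps)
  ultimately show "opb n (\<lambda>i j. Z i j - mm n T (half_step Y) i j) (f + e / 2 + \<eta>)"
    by (simp add: mm_diff_left)
qed

section \<open>The network for the Neumann series\<close>

text \<open>One affine layer forms all operands u x + v I from earlier data and pads them with zeros
  to size 2^k, then Strassen's network runs. An operand costs one weight per entry and, if v is
  nonzero, n biases on the diagonal; the padding is free. The carried scalars may be changed
  affinely in the same layer.\<close>

lemma realizes_stage:
  fixes J :: "'s set" and E :: "'e set" and K \<sigma> :: real and src :: "nat list \<Rightarrow> nat \<Rightarrow> nat \<Rightarrow> nat \<Rightarrow> 's"
    and u v :: "nat list \<Rightarrow> nat \<Rightarrow> real" and csrc :: "'e \<Rightarrow> 's" and cu cv :: "'e \<Rightarrow> real"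
  assumes "finite J"
    and P: "is_mnn \<rho> (1, 2) (1, 1) P"
    and PK: "\<And>x y. \<bar>x\<bar> \<le> K \<Longrightarrow> \<bar>y\<bar> \<le> K \<Longrightarrow>
      \<bar>realization P (mat_of_rows_list 2 [[x, y]]) $$ (0,0) - x * y\<bar> \<le> \<sigma>"
    and C: "finite C" "C \<noteq> {}" "finite E"
    and n: "n \<le> 2 ^ k" "2 ^ k \<le> K"
    and src: "\<And>c s i j. c \<in> C \<Longrightarrow> s < 2 \<Longrightarrow> i < n \<Longrightarrow> j < n \<Longrightarrow> src c s i j \<in> J"
    and csrc: "\<And>e. e \<in> E \<Longrightarrow> csrc e \<in> J"
  obtains H where "realizes \<rho> J (copies C (2 ^ k, 2 ^ k) E) H
     ((\<Sum>c\<in>C. \<Sum>s<2. n\<^sup>2 + (if v c s = 0 then 0 else n)) + (\<Sum>e\<in>E. 1 + (if cv e = 0 then 0 else 1)) +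
      (card C * strassen_weights (num_weights P) k + card E * (2 * k + length P)))
     (1 + (2 * k + length P))"
    "\<forall>x. \<forall>e\<in>E. H x (Inr e) = cu e * x (csrc e) + cv e"
    "\<forall>x. (\<forall>c\<in>C. \<forall>s<2. \<forall>i<n. \<forall>j<n. \<bar>u c s * x (src c s i j) + v c s * idm i j\<bar> \<le> 1) \<longrightarrow>
       (\<forall>c\<in>C. \<forall>i<n. \<forall>j<n. \<bar>H x (Inl (c, i, j)) -
         mm n (\<lambda>i j. u c 0 * x (src c 0 i j) + v c 0 * idm i j)
           (\<lambda>i j. u c 1 * x (src c 1 i j) + v c 1 * idm i j) i j\<bar> \<le> 4 ^ k * \<sigma>)"
proof -
  define rw :: "nat list \<times> nat \<times> nat \<times> nat + 'e \<Rightarrow> ('s \<times> real) list" where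
    "rw = case_sum (\<lambda>(c, s, i, j). if i < n \<and> j < n then [(src c s i j, u c s)] else [])
       (\<lambda>e. [(csrc e, cu e)])"
  define b :: "nat list \<times> nat \<times> nat \<times> nat + 'e \<Rightarrow> real" where
    "b = case_sum (\<lambda>(c, s, i, j). if i < n \<and> j < n then v c s * idm i j else 0) cv"
  define D where "D = (\<lambda>(x :: 's \<Rightarrow> real) j. id ((\<Sum>(i, w)\<leftarrow>rw j. w * x i) + b j))"
  obtain c where "c \<in> C" using C(2) by blast
  then have "Inl (c, 0, 0, 0) \<in> operands C (2 ^ k) E" by (auto simp: operands_def)
  then have ne: "operands C (2 ^ k) E \<noteq> {}" by blast
  have sub: "fst ` set (rw j) \<subseteq> J" if "j \<in> operands C (2 ^ k) E" for j
    using that src csrc by (auto simp: operands_def rw_def)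
  have cost: "layer_cost (operands C (2 ^ k) E) rw b =
     (\<Sum>c\<in>C. \<Sum>s<2. n\<^sup>2 + (if v c s = 0 then 0 else n)) + (\<Sum>e\<in>E. 1 + (if cv e = 0 then 0 else 1))"
  proof -
    let ?g = "\<lambda>c s i j. length (rw (Inl (c, s, i, j))) + (if b (Inl (c, s, i, j)) = 0 then 0 else 1)"
    have restr: "(\<Sum>i<2^k. if i < n then f i else 0) = (\<Sum>i<n. f i)" for f :: "nat \<Rightarrow> nat"
    proof -
      have "{i. i < 2 ^ k \<and> i < n} = {..<n}" using n(1) by auto
      then show ?thesis by (simp add: sum.inter_filter[symmetric] lessThan_def)
    qed
    have inner: "(\<Sum>i<2^k. \<Sum>j<2^k. ?g c s i j) = n\<^sup>2 + (if v c s = 0 then 0 else n)" for c s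
    proof -
      have "(\<Sum>i<2^k. \<Sum>j<2^k. ?g c s i j) =
        (\<Sum>i<2^k. if i < n then (\<Sum>j<2^k. if j < n then 1 + (if v c s * idm i j = 0 then 0 else 1) else 0) else 0)"
        by (intro sum.cong refl) (auto simp: rw_def b_def intro!: sum.cong)
      also have "\<dots> = (\<Sum>i<n. \<Sum>j<n. 1 + (if v c s * idm i j = 0 then 0 else 1))"
        by (simp only: restr)
      also have "\<dots> = (\<Sum>i<n. n + (if v c s = 0 then 0 else 1))"
      proof (intro sum.cong refl)
        fix i assume "i \<in> {..<n}"
        have "(\<Sum>j<n. if v c s * idm i j = 0 then 0 else 1) =
            (\<Sum>j<n. if j = i then if v c s = 0 then 0 else 1 else (0::nat))"
          by (intro sum.cong) (auto simp: idm_def)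
        also have "\<dots> = (if v c s = 0 then 0 else 1)"
          using \<open>i \<in> {..<n}\<close> by (subst sum.delta) auto
        finally show "(\<Sum>j<n. 1 + (if v c s * idm i j = 0 then 0 else 1)) = n + (if v c s = 0 then 0 else 1)"
          by (simp only: sum.distrib) simp
      qed
      finally show ?thesis by (simp add: power2_eq_square)
    qed
    have "layer_cost (operands C (2 ^ k) E) rw b =
      (\<Sum>j\<in>C \<times> {..<2} \<times> {..<2^k} \<times> {..<2^k}. length (rw (Inl j)) + (if b (Inl j) = 0 then 0 else 1)) +
      (\<Sum>e\<in>E. length (rw (Inr e)) + (if b (Inr e) = 0 then 0 else 1))"
      unfolding layer_cost_def operands_def using C by (subst sum.Plus) auto
    also have "(\<Sum>j\<in>C \<times> {..<2} \<times> {..<2^k} \<times> {..<2^k}. length (rw (Inl j)) + (if b (Inl j) = 0 then 0 else 1)) =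
      (\<Sum>c\<in>C. \<Sum>s<2. \<Sum>i<2^k. \<Sum>j<2^k. ?g c s i j)"
      unfolding sum.cartesian_product' ..
    also have "(\<Sum>e\<in>E. length (rw (Inr e)) + (if b (Inr e) = 0 then 0 else 1)) =
      (\<Sum>e\<in>E. 1 + (if cv e = 0 then 0 else 1))"
      by (simp add: rw_def b_def)
    finally show ?thesis by (simp only: inner)
  qed
  have D: "realizes \<rho> J (operands C (2 ^ k) E) D
    ((\<Sum>c\<in>C. \<Sum>s<2. n\<^sup>2 + (if v c s = 0 then 0 else n)) + (\<Sum>e\<in>E. 1 + (if cv e = 0 then 0 else 1))) 1"
    unfolding cost[symmetric] D_def by (rule realizes_layer[OF assms(1) ne sub]) auto
  obtain F where F: "realizes \<rho> (operands C (2 ^ k) E) (copies C (2 ^ k, 2 ^ k) E) F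
      (card C * strassen_weights (num_weights P) k + card E * (2 * k + length P)) (2 * k + length P)"
    and carry: "\<And>x e. e \<in> E \<Longrightarrow> F x (Inr e) = x (Inr e)"
    and mult: "\<And>x c i j. (\<forall>c\<in>C. \<forall>s<2. \<forall>i<2^k. \<forall>j<2^k. 2 ^ k * \<bar>x (Inl (c, s, i, j))\<bar> \<le> K) \<Longrightarrow>
        c \<in> C \<Longrightarrow> i < 2^k \<Longrightarrow> j < 2^k \<Longrightarrow> \<bar>F x (Inl (c, i, j)) -
           (\<Sum>l<2^k. x (Inl (c, 0, i, l)) * x (Inl (c, 1, l, j)))\<bar> \<le> 4 ^ k * \<sigma>"
    using realizes_strassen[where k = k and K = K and \<sigma> = \<sigma>, OF P PK C] by blast
  have DInl: "D x (Inl (c, s, i, j)) = (if i < n \<and> j < n then u c s * x (src c s i j) + v c s * idm i j else 0)"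
    for x c s i j
    by (simp add: D_def rw_def b_def)
  have "\<bar>F (D x) (Inl (c, i, j)) -
         mm n (\<lambda>i j. u c 0 * x (src c 0 i j) + v c 0 * idm i j)
           (\<lambda>i j. u c 1 * x (src c 1 i j) + v c 1 * idm i j) i j\<bar> \<le> 4 ^ k * \<sigma>"
    if x: "\<And>c s i j. c \<in> C \<Longrightarrow> s < 2 \<Longrightarrow> i < n \<Longrightarrow> j < n \<Longrightarrow>
        \<bar>u c s * x (src c s i j) + v c s * idm i j\<bar> \<le> 1"
      and c: "c \<in> C" "i < n" "j < n" for x c i j
  proof -
    have small: "2 ^ k * \<bar>D x (Inl (c, s, i, j))\<bar> \<le> K" if "c \<in> C" "s < 2" for c s i j
    proof -
      have "\<bar>D x (Inl (c, s, i, j))\<bar> \<le> 1" using x that by (auto simp: DInl)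
      then have "2 ^ k * \<bar>D x (Inl (c, s, i, j))\<bar> \<le> 2 ^ k * 1" by (intro mult_left_mono) auto
      then show ?thesis using n(2) by linarith
    qed
    \<comment> \<open>The padded product has the right entries because the terms with l >= n
      vanish.\<close>
    have "(\<Sum>l<2^k. D x (Inl (c, 0, i, l)) * D x (Inl (c, 1, l, j))) =
        (\<Sum>l<n. D x (Inl (c, 0, i, l)) * D x (Inl (c, 1, l, j)))"
      using n(1) by (intro sum.mono_neutral_right) (auto simp: DInl)
    also have "\<dots> = mm n (\<lambda>i j. u c 0 * x (src c 0 i j) + v c 0 * idm i j)
           (\<lambda>i j. u c 1 * x (src c 1 i j) + v c 1 * idm i j) i j"
      using c by (simp add: mm_def DInl)
    finally show ?thesis
      using mult[of "D x" c i j] small c n(1) by simp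
  qed
  moreover have "F (D x) (Inr e) = cu e * x (csrc e) + cv e" if "e \<in> E" for x e
    by (simp add: carry[OF that] D_def rw_def b_def)
  moreover have "realizes \<rho> J (copies C (2 ^ k, 2 ^ k) E) (\<lambda>x. F (D x))
     ((\<Sum>c\<in>C. \<Sum>s<2. n\<^sup>2 + (if v c s = 0 then 0 else n)) + (\<Sum>e\<in>E. 1 + (if cv e = 0 then 0 else 1)) +
      (card C * strassen_weights (num_weights P) k + card E * (2 * k + length P)))
     (1 + (2 * k + length P))"
    by (rule realizes_comp[OF D F]) (simp add: finite_operands C)
  ultimately show ?thesis by (intro that) auto
qed

text \<open>A product computed by Strassen's network is wrong by at most 4^k sigma per entry, hence
  by eta in operator norm. The constant q is the uniform norm bound for all inexact powers.\<close>

locale neumann_net =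
  fixes \<rho> :: "real \<Rightarrow> real" and P :: mnn and n k :: nat and \<sigma> \<delta> \<alpha> q \<eta> :: real
  assumes P: "is_mnn \<rho> (1, 2) (1, 1) P"
    and PK: "\<And>x y. \<bar>x\<bar> \<le> 2 * real n \<Longrightarrow> \<bar>y\<bar> \<le> 2 * real n \<Longrightarrow>
      \<bar>realization P (mat_of_rows_list 2 [[x, y]]) $$ (0,0) - x * y\<bar> \<le> \<sigma>"
    and n: "0 < n" "n \<le> 2 ^ k" "2 ^ k \<le> 2 * n"
    and q: "0 \<le> \<delta>" "\<delta> \<le> q" "1/2 \<le> q" "q < 1"
    and \<eta>: "\<eta> = real n * (4 ^ k * \<sigma>)" "\<eta> \<le> (1 - q) / 2"
begin

definition resid :: "(nat \<times> nat \<Rightarrow> real) \<Rightarrow> nat \<Rightarrow> nat \<Rightarrow> real" where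
  "resid A i j = idm i j - \<alpha> * A (i, j)"

text \<open>The error solves e_0 = 0, e_(m+1) = 2 e_m + eta from \<open>approx_square\<close>. The
  norm bound is q for every m, since inexact squares need not decay like
  \<open>\<delta> ^ 2 ^ m\<close>.\<close>

definition approximates_Y :: "nat \<Rightarrow> 's set \<Rightarrow> ((nat \<times> nat \<Rightarrow> real) \<Rightarrow> 's \<Rightarrow> real) \<Rightarrow>
    (nat \<Rightarrow> nat \<Rightarrow> 's) \<Rightarrow> bool" where
  "approximates_Y m J G r \<longleftrightarrow> (\<forall>i<n. \<forall>j<n. r i j \<in> J) \<and> (\<forall>A. opb n (resid A) \<delta> \<longrightarrow>
      opb n (\<lambda>i j. G A (r i j)) q \<and>
      opb n (\<lambda>i j. G A (r i j) - Ym n (resid A) m i j) ((2 ^ m - 1) * \<eta>))"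

text \<open>The error solves f_1 = 0, f_(m+1) = f_m + e_m / 2 + eta from \<open>approx_step\<close>,
  with e_m = (2^m - 1) eta. It starts at m = 1 because T_1 is affine in A and thus computed
  exactly.\<close>

definition approximates_T :: "nat \<Rightarrow> 's set \<Rightarrow> ((nat \<times> nat \<Rightarrow> real) \<Rightarrow> 's \<Rightarrow> real) \<Rightarrow>
    (nat \<Rightarrow> nat \<Rightarrow> 's) \<Rightarrow> bool" where
  "approximates_T m J G r \<longleftrightarrow> (\<forall>i<n. \<forall>j<n. r i j \<in> J) \<and> (\<forall>A. opb n (resid A) \<delta> \<longrightarrow>
      opb n (\<lambda>i j. G A (r i j)) 1 \<and>
      opb n (\<lambda>i j. G A (r i j) - Tm n (resid A) m i j) ((2 ^ (m - 1) - 1 + (real m - 1) / 2) * \<eta>))"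

text \<open>An existential quantifier cannot range over index types, so one type has to serve every
  round: \<open>Inl\<close> for computed matrices, \<open>Inr\<close> for the entries of T_1 that
  bypass the first product.\<close>

definition reachable :: "nat \<Rightarrow> nat \<Rightarrow> nat \<Rightarrow> bool" where
  "reachable m w l \<longleftrightarrow> (\<exists>(J :: (nat list \<times> nat \<times> nat + nat \<times> nat) set) G rT rY.
     finite J \<and> realizes \<rho> ({..<n} \<times> {..<n}) J G w l \<and>
     approximates_T m J G rT \<and> approximates_Y m J G rY)"

lemma reachableI:
  fixes J :: "(nat list \<times> nat \<times> nat + nat \<times> nat) set"
  assumes "finite J" "realizes \<rho> ({..<n} \<times> {..<n}) J G w l" "approximates_T m J G rT"
    "approximates_Y m J G rY"
  shows "reachable m w l"
  unfolding reachable_def by (intro exI conjI) (rule assms)+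

abbreviation "Q \<equiv> strassen_weights (num_weights P) k"

lemma \<eta>_nonneg: "0 \<le> \<eta>"
  using order_trans[OF abs_ge_zero PK[of 0 0]] by (simp add: \<eta>(1))

lemma K: "2 ^ k \<le> 2 * real n"
proof -
  have "real (2 ^ k) \<le> real (2 * n)" using n(3) by (rule of_nat_mono)
  then show ?thesis by simp
qed

lemma opb_of_product_error:
  assumes "\<And>i j. i < n \<Longrightarrow> j < n \<Longrightarrow> \<bar>M i j\<bar> \<le> 4 ^ k * \<sigma>"
  shows "opb n M \<eta>"
  unfolding \<eta>(1) by (rule opb_of_entries[OF assms])

text \<open>X is squared by the network while T_1 = (I + X)/2 is carried past it, n^2 scalars
  through 2 k + L(P) layers. This is the source of the n^2 (L(P) + 2 log2 n) in the final bound. The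
  3 (n^2 + n) are two operands and the carried matrix.\<close>

lemma reachable_first:
  "reachable 1 (3 * (n\<^sup>2 + n) + (Q + n\<^sup>2 * (2 * k + length P))) (1 + (2 * k + length P))"
proof -
  let ?I = "{..<n} \<times> {..<n}"
  define u :: "nat list \<Rightarrow> nat \<Rightarrow> real" where "u c s = - \<alpha>" for c s
  define v :: "nat list \<Rightarrow> nat \<Rightarrow> real" where "v c s = 1" for c s
  define src :: "nat list \<Rightarrow> nat \<Rightarrow> nat \<Rightarrow> nat \<Rightarrow> nat \<times> nat" where "src c s i j = (i, j)" for c s i j
  define csrc :: "nat \<times> nat \<Rightarrow> nat \<times> nat" where "csrc e = e" for e
  \<comment> \<open>These coefficients encode (I + (I - alpha A))/2 = I - (alpha/2) A.\<close>
  define cu :: "nat \<times> nat \<Rightarrow> real" where "cu e = - \<alpha> / 2" for e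
  define cv :: "nat \<times> nat \<Rightarrow> real" where "cv e = idm (fst e) (snd e)" for e
  have cost: "(\<Sum>c\<in>{[1]}. \<Sum>s<2. n\<^sup>2 + (if v c s = 0 then 0 else n)) +
      (\<Sum>e\<in>?I. 1 + (if cv e = 0 then 0 else 1)) +
      (card {[1::nat]} * Q + card ?I * (2 * k + length P)) =
      3 * (n\<^sup>2 + n) + (Q + n\<^sup>2 * (2 * k + length P))"
  proof -
    have "(\<Sum>e\<in>?I. if cv e = 0 then 0 else 1) = (\<Sum>i<n. \<Sum>j<n. if i = j then 1 else (0::nat))"
      unfolding sum.cartesian_product' by (intro sum.cong refl) (simp add: cv_def idm_def)
    also have "\<dots> = n" by (simp add: sum.delta)
    finally have "(\<Sum>e\<in>?I. if cv e = 0 then 0 else 1) = n" .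
    then have "(\<Sum>e\<in>?I. 1 + (if cv e = 0 then 0 else 1)) = n\<^sup>2 + n"
      by (simp only: sum.distrib) (simp add: power2_eq_square)
    then show ?thesis by (simp add: v_def power2_eq_square)
  qed
  have C1: "finite {[1::nat]}" "{[1::nat]} \<noteq> {}" "finite ?I" by simp_all
  have srcI: "src c s i j \<in> ?I" if "i < n" "j < n" for c s i j using that by (simp add: src_def)
  have csrcI: "csrc e \<in> ?I" if "e \<in> ?I" for e using that by (simp add: csrc_def)
  obtain H where H: "realizes \<rho> ?I (copies {[1]} (2 ^ k, 2 ^ k) ?I) H
     ((\<Sum>c\<in>{[1]}. \<Sum>s<2. n\<^sup>2 + (if v c s = 0 then 0 else n)) +
      (\<Sum>e\<in>?I. 1 + (if cv e = 0 then 0 else 1)) +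
      (card {[1::nat]} * Q + card ?I * (2 * k + length P)))
     (1 + (2 * k + length P))"
    and HT: "\<forall>x. \<forall>e\<in>?I. H x (Inr e) = cu e * x (csrc e) + cv e"
    and HY: "\<forall>x. (\<forall>c\<in>{[1]}. \<forall>s<2. \<forall>i<n. \<forall>j<n. \<bar>u c s * x (src c s i j) + v c s * idm i j\<bar> \<le> 1) \<longrightarrow>
       (\<forall>c\<in>{[1]}. \<forall>i<n. \<forall>j<n. \<bar>H x (Inl (c, i, j)) -
         mm n (\<lambda>i j. u c 0 * x (src c 0 i j) + v c 0 * idm i j)
           (\<lambda>i j. u c 1 * x (src c 1 i j) + v c 1 * idm i j) i j\<bar> \<le> 4 ^ k * \<sigma>)"
    by (rule realizes_stage[where u = u and v = v and src = src and csrc = csrc and cu = cu and cv = cv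
        and K = "2 * real n" and \<sigma> = \<sigma>, OF C1(3) P PK C1 n(2) K srcI csrcI])
      (assumption | erule emptyE | rule that)+
  have T: "H A (Inr (i, j)) = half_step (resid A) i j" if "i < n" "j < n" for A i j
    using HT[rule_format, of "(i, j)" A] that by (simp add: cu_def cv_def csrc_def half_step_def resid_def field_simps)
  have r: "u c s * A (src c s i j) + v c s * idm i j = resid A i j" for A c s i j
    by (simp add: u_def v_def src_def resid_def)
  have Y: "\<bar>H A (Inl ([1], i, j)) - mm n (resid A) (resid A) i j\<bar> \<le> 4 ^ k * \<sigma>"
    if "\<And>i j. i < n \<Longrightarrow> j < n \<Longrightarrow> \<bar>resid A i j\<bar> \<le> 1" "i < n" "j < n" for A i j
    using HY[rule_format, of A "[1]" i j] that unfolding r by simp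
  let ?J = "copies {[1]} (2 ^ k, 2 ^ k) ?I :: (nat list \<times> nat \<times> nat + nat \<times> nat) set"
  let ?rY = "\<lambda>i j. Inl ([1], i, j)" and ?rT = "\<lambda>i j. Inr (i, j)"
  have "approximates_Y 1 ?J H ?rY"
    unfolding approximates_Y_def
  proof (intro conjI allI impI)
    fix i j assume "i < n" "j < n"
    then show "?rY i j \<in> ?J" using n(2) by (auto simp: copies_def)
  next
    fix A assume X: "opb n (resid A) \<delta>"
    have X1: "opb n (resid A) 1" and Xq: "opb n (resid A) q"
      using opb_mono[OF X] q by auto
    have Z: "opb n (\<lambda>i j. H A (?rY i j) - mm n (resid A) (resid A) i j) \<eta>"
      using opb_entry[OF X1] by (intro opb_of_product_error Y) auto
    have e: "opb n (\<lambda>i j. resid A i j - resid A i j) 0" by (simp add: opb_def mv_def L2_set_def)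
    show "opb n (\<lambda>i j. H A (?rY i j)) q"
      using approx_square(1)[OF Xq q(3) _ X1 e Z \<eta>(2)] q(4) by simp
    show "opb n (\<lambda>i j. H A (?rY i j) - Ym n (resid A) 1 i j) ((2 ^ 1 - 1) * \<eta>)"
      using approx_square(2)[OF Xq q(3) _ X1 e Z \<eta>(2)] q(4) by simp
  qed
  moreover have "approximates_T 1 ?J H ?rT"
    unfolding approximates_T_def
  proof (intro conjI allI impI)
    fix i j assume "i < n" "j < n"
    then show "?rT i j \<in> ?J" by (auto simp: copies_def)
  next
    fix A assume X: "opb n (resid A) \<delta>"
    have "opb n (\<lambda>i j. H A (?rT i j)) 1 \<longleftrightarrow> opb n (half_step (resid A)) 1"
      by (intro opb_cong T)
    then show "opb n (\<lambda>i j. H A (?rT i j)) 1"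
      using opb_half_step[OF opb_mono[OF X, of 1]] q by simp
    have "opb n (\<lambda>i j. H A (?rT i j) - Tm n (resid A) 1 i j) 0 \<longleftrightarrow> opb n (\<lambda>i j. 0) 0"
      by (intro opb_cong) (simp add: T mm_idm_left)
    then show "opb n (\<lambda>i j. H A (?rT i j) - Tm n (resid A) 1 i j) ((2 ^ (1 - 1) - 1 + (real 1 - 1) / 2) * \<eta>)"
      by (simp add: opb_def mv_def L2_set_def)
  qed
  ultimately show ?thesis by (intro reachableI[OF _ H[unfolded cost]]) (simp_all add: finite_copies)
qed

text \<open>The batch index \<open>[0]\<close> stands for the product with the next factor, \<open>[1]\<close> for the squaring.
  The last round leaves out the squaring.\<close>

lemma product_round:
  fixes J :: "'s set" and C :: "nat list set"
  assumes J: "finite J" and T: "approximates_T m J G rT" and Y: "approximates_Y m J G rY"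
    and C: "C = {[0]} \<or> C = {[0], [1]}" and m: "1 \<le> m"
  obtains H where "realizes \<rho> J (copies C (2 ^ k, 2 ^ k) ({} :: (nat \<times> nat) set)) H
      (card C * (2 * n\<^sup>2) + n + card C * Q) (1 + (2 * k + length P))"
    "approximates_T (Suc m) (copies C (2 ^ k, 2 ^ k) {}) (\<lambda>A. H (G A)) (\<lambda>i j. Inl ([0], i, j))"
    "[1] \<in> C \<longrightarrow>
      approximates_Y (Suc m) (copies C (2 ^ k, 2 ^ k) {}) (\<lambda>A. H (G A)) (\<lambda>i j. Inl ([1], i, j))"
proof -
  have rJ: "rT i j \<in> J" "rY i j \<in> J" if "i < n" "j < n" for i j
    using T Y that by (auto simp: approximates_T_def approximates_Y_def)
  \<comment> \<open>Product [0] is T times (Y + I)/2, product [1] is Y times Y. Only the second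
    operand of [0] has a bias, which explains the single n in the cost. Nothing is carried, as both
    new matrices are outputs of products.\<close>
  define u :: "nat list \<Rightarrow> nat \<Rightarrow> real" where "u c s = (if c = [0] \<and> s = 1 then 1/2 else 1)" for c s
  define v :: "nat list \<Rightarrow> nat \<Rightarrow> real" where "v c s = (if c = [0] \<and> s = 1 then 1/2 else 0)" for c s
  define src where "src c s = (if c = [0::nat] \<and> s = (0::nat) then rT else rY)" for c s
  have finC: "finite C" "C \<noteq> {}" "[0] \<in> C" using C by auto
  have cost: "(\<Sum>c\<in>C. \<Sum>s<2. n\<^sup>2 + (if v c s = 0 then 0 else n)) +
      (\<Sum>e\<in>({} :: (nat \<times> nat) set). 1 + (if (0::real) = 0 then 0 else 1)) +
      (card C * Q + card ({} :: (nat \<times> nat) set) * (2 * k + length P)) =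
      card C * (2 * n\<^sup>2) + n + card C * Q"
    using C by (auto simp: v_def eval_nat_numeral)
  have srcJ: "src c s i j \<in> J" if "i < n" "j < n" for c s i j using that rJ by (simp add: src_def)
  obtain H where H: "realizes \<rho> J (copies C (2 ^ k, 2 ^ k) ({} :: (nat \<times> nat) set)) H
     ((\<Sum>c\<in>C. \<Sum>s<2. n\<^sup>2 + (if v c s = 0 then 0 else n)) +
      (\<Sum>e\<in>({} :: (nat \<times> nat) set). 1 + (if (0::real) = 0 then 0 else 1)) +
      (card C * Q + card ({} :: (nat \<times> nat) set) * (2 * k + length P)))
     (1 + (2 * k + length P))"
    and H': "\<forall>x. (\<forall>c\<in>C. \<forall>s<2. \<forall>i<n. \<forall>j<n. \<bar>u c s * x (src c s i j) + v c s * idm i j\<bar> \<le> 1) \<longrightarrow>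
       (\<forall>c\<in>C. \<forall>i<n. \<forall>j<n. \<bar>H x (Inl (c, i, j)) -
         mm n (\<lambda>i j. u c 0 * x (src c 0 i j) + v c 0 * idm i j)
           (\<lambda>i j. u c 1 * x (src c 1 i j) + v c 1 * idm i j) i j\<bar> \<le> 4 ^ k * \<sigma>)"
    by (rule realizes_stage[where u = u and v = v and src = src and csrc = "\<lambda>_. rT 0 0" and cu = "\<lambda>_. 0"
        and cv = "\<lambda>_. 0" and K = "2 * real n" and \<sigma> = \<sigma>, OF J P PK finC(1,2) finite.emptyI n(2) K srcJ])
      (assumption | erule emptyE | rule that)+
  note H = H[unfolded cost]
  have ZC: "opb n (\<lambda>i j. H (G A) (Inl (c, i, j)) -
         mm n (\<lambda>i j. u c 0 * G A (src c 0 i j) + v c 0 * idm i j)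
           (\<lambda>i j. u c 1 * G A (src c 1 i j) + v c 1 * idm i j) i j) \<eta>"
    if X: "opb n (resid A) \<delta>" and c: "c \<in> C" for A c
  proof -
    have Y1: "opb n (\<lambda>i j. G A (rY i j)) 1" and T1: "opb n (\<lambda>i j. G A (rT i j)) 1"
      using T Y X opb_mono[of n _ q 1] q(4) by (auto simp: approximates_T_def approximates_Y_def)
    have h1: "opb n (half_step (\<lambda>i j. G A (rY i j))) 1" using opb_half_step[OF Y1] by simp
    have "\<bar>u c s * G A (src c s i j) + v c s * idm i j\<bar> \<le> 1" if "i < n" "j < n" for c s i j
      using opb_entry[OF Y1 that] opb_entry[OF T1 that] opb_entry[OF h1 that]
      by (auto simp: u_def v_def src_def half_step_def)
    then show ?thesis using c by (intro opb_of_product_error H'[rule_format]) auto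
  qed
  have T': "approximates_T (Suc m) (copies C (2 ^ k, 2 ^ k) {} :: (_ + nat \<times> nat) set) (\<lambda>A. H (G A))
      (\<lambda>i j. Inl ([0], i, j))"
    unfolding approximates_T_def
  proof (intro conjI allI impI)
    fix i j assume "i < n" "j < n"
    then show "Inl ([0], i, j) \<in> (copies C (2 ^ k, 2 ^ k) {} :: (_ + nat \<times> nat) set)"
      using n(2) finC(3) by (auto simp: copies_def)
  next
    fix A assume X: "opb n (resid A) \<delta>"
    let ?Y = "\<lambda>i j. G A (rY i j)" and ?T = "\<lambda>i j. G A (rT i j)"
    have Yq: "opb n ?Y q" and T1: "opb n ?T 1"
      and e: "opb n (\<lambda>i j. ?Y i j - Ym n (resid A) m i j) ((2 ^ m - 1) * \<eta>)"
      and f: "opb n (\<lambda>i j. ?T i j - Tm n (resid A) m i j) ((2 ^ (m - 1) - 1 + (real m - 1) / 2) * \<eta>)"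
      using T Y X by (auto simp: approximates_T_def approximates_Y_def)
    have "(\<lambda>i j. 1 / 2 * ?Y i j + 1 / 2 * idm i j) = half_step ?Y"
      by (simp add: half_step_def fun_eq_iff)
    then have Z: "opb n (\<lambda>i j. H (G A) (Inl ([0], i, j)) - mm n ?T (half_step ?Y) i j) \<eta>"
      using ZC[OF X finC(3)] by (simp add: u_def v_def src_def)
    have T'1: "opb n (Tm n (resid A) m) 1"
      using opb_Tm[OF X] q by auto
    have q': "0 \<le> q" "q \<le> 1" using q by auto
    have f0: "0 \<le> (2 ^ (m - 1) - 1 + (real m - 1) / 2) * \<eta>"
      using m \<eta>_nonneg by (intro mult_nonneg_nonneg add_nonneg_nonneg) auto
    show "opb n (\<lambda>i j. H (G A) (Inl ([0], i, j))) 1"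
      by (rule approx_step(1)[OF Yq q' T'1 T1 e f f0 Z \<eta>(2)])
    have "opb n (\<lambda>i j. H (G A) (Inl ([0], i, j)) - Tm n (resid A) (Suc m) i j)
       ((2 ^ (m - 1) - 1 + (real m - 1) / 2) * \<eta> + (2 ^ m - 1) * \<eta> / 2 + \<eta>)"
      using approx_step(2)[OF Yq q' T'1 T1 e f f0 Z \<eta>(2)] by simp
    moreover have "(2 ^ (m - 1) - 1 + (real m - 1) / 2) * \<eta> + (2 ^ m - 1) * \<eta> / 2 + \<eta> =
       (2 ^ (Suc m - 1) - 1 + (real (Suc m) - 1) / 2) * \<eta>"
    proof -
      obtain m' where "m = Suc m'" using m by (cases m) auto
      then show ?thesis by (simp add: field_simps)
    qed
    ultimately show "opb n (\<lambda>i j. H (G A) (Inl ([0], i, j)) - Tm n (resid A) (Suc m) i j)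
       ((2 ^ (Suc m - 1) - 1 + (real (Suc m) - 1) / 2) * \<eta>)"
      by simp
  qed
  have Y': "approximates_Y (Suc m) (copies C (2 ^ k, 2 ^ k) {} :: (_ + nat \<times> nat) set) (\<lambda>A. H (G A))
      (\<lambda>i j. Inl ([1], i, j))" if C1: "[1] \<in> C"
    unfolding approximates_Y_def
  proof (intro conjI allI impI)
    fix i j assume "i < n" "j < n"
    then show "Inl ([1], i, j) \<in> (copies C (2 ^ k, 2 ^ k) {} :: (_ + nat \<times> nat) set)"
      using n(2) C1 by (auto simp: copies_def)
  next
    fix A assume X: "opb n (resid A) \<delta>"
    let ?Y = "\<lambda>i j. G A (rY i j)"
    have Yq: "opb n ?Y q"
      and e: "opb n (\<lambda>i j. ?Y i j - Ym n (resid A) m i j) ((2 ^ m - 1) * \<eta>)"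
      using Y X by (auto simp: approximates_Y_def)
    have Z: "opb n (\<lambda>i j. H (G A) (Inl ([1], i, j)) - mm n ?Y ?Y i j) \<eta>"
      using ZC[OF X C1] by (simp add: u_def v_def src_def)
    have Y1: "opb n (Ym n (resid A) m) 1"
      using opb_Ym_le_1[OF X] q by auto
    have q': "q \<le> 1" using q by auto
    show "opb n (\<lambda>i j. H (G A) (Inl ([1], i, j))) q"
      by (rule approx_square(1)[OF Yq q(3) q' Y1 e Z \<eta>(2)])
    have "opb n (\<lambda>i j. H (G A) (Inl ([1], i, j)) - Ym n (resid A) (Suc m) i j) (2 * ((2 ^ m - 1) * \<eta>) + \<eta>)"
      using approx_square(2)[OF Yq q(3) q' Y1 e Z \<eta>(2)] by simp
    then show "opb n (\<lambda>i j. H (G A) (Inl ([1], i, j)) - Ym n (resid A) (Suc m) i j) ((2 ^ Suc m - 1) * \<eta>)"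
      by (simp add: algebra_simps)
  qed
  show ?thesis by (rule that[OF H T']) (use Y' in simp)
qed

lemma reachable_step:
  assumes "reachable m w l" "1 \<le> m"
  shows "reachable (Suc m) (w + (4 * n\<^sup>2 + n + 2 * Q)) (l + (1 + (2 * k + length P)))"
proof -
  obtain J :: "(nat list \<times> nat \<times> nat + nat \<times> nat) set" and G rT rY where J: "finite J"
    and G: "realizes \<rho> ({..<n} \<times> {..<n}) J G w l"
    and TY: "approximates_T m J G rT" "approximates_Y m J G rY"
    using assms(1) unfolding reachable_def by (elim exE conjE) (rule that)
  let ?C = "{[0], [1]} :: nat list set"
  have "?C = {[0]} \<or> ?C = {[0], [1]}" by simp
  then obtain H where H: "realizes \<rho> J (copies ?C (2 ^ k, 2 ^ k) ({} :: (nat \<times> nat) set)) H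
      (card ?C * (2 * n\<^sup>2) + n + card ?C * Q) (1 + (2 * k + length P))"
    "approximates_T (Suc m) (copies ?C (2 ^ k, 2 ^ k) ({} :: (nat \<times> nat) set)) (\<lambda>A. H (G A)) (\<lambda>i j. Inl ([0], i, j))"
    "[1] \<in> ?C \<longrightarrow> approximates_Y (Suc m) (copies ?C (2 ^ k, 2 ^ k) ({} :: (nat \<times> nat) set)) (\<lambda>A. H (G A))
      (\<lambda>i j. Inl ([1], i, j))"
    by (rule product_round[OF J TY _ assms(2)]) (rule that)
  have "realizes \<rho> ({..<n} \<times> {..<n}) (copies ?C (2 ^ k, 2 ^ k) ({} :: (nat \<times> nat) set)) (\<lambda>A. H (G A))
      (w + (4 * n\<^sup>2 + n + 2 * Q)) (l + (1 + (2 * k + length P)))"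
    using realizes_comp[OF G H(1) J] by (simp add: ac_simps)
  moreover have "finite (copies ?C (2 ^ k, 2 ^ k) ({} :: (nat \<times> nat) set))"
    by (simp add: finite_copies)
  ultimately show ?thesis using H(2,3) by (intro reachableI) simp_all
qed

lemma reachable_rounds:
  "reachable (Suc m) (3 * (n\<^sup>2 + n) + (Q + n\<^sup>2 * (2 * k + length P)) + m * (4 * n\<^sup>2 + n + 2 * Q))
     (Suc m * (1 + (2 * k + length P)))"
proof (induction m)
  case 0
  then show ?case using reachable_first by simp
next
  case (Suc m)
  then show ?case using reachable_step[OF Suc] by (simp add: algebra_simps)
qed

text \<open>One first round, m full rounds and a last one without squaring give N = m + 2 rounds,
  and Q is counted 1 + 2 m + 1 times.\<close>

lemma neumann_mnn:
  obtains \<Phi> where "is_mnn \<rho> (n, n) (n, n) \<Phi>"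
    "length \<Phi> = (m + 2) * (1 + (2 * k + length P)) + 1"
    "num_weights \<Phi> \<le> 3 * (n\<^sup>2 + n) + (Q + n\<^sup>2 * (2 * k + length P)) + m * (4 * n\<^sup>2 + n + 2 * Q) +
       (2 * n\<^sup>2 + n + Q) + n\<^sup>2"
    "\<forall>A\<in>carrier_mat n n. realization \<Phi> A \<in> carrier_mat n n"
    "\<forall>A\<in>carrier_mat n n. opb n (resid (\<lambda>ij. A $$ ij)) \<delta> \<longrightarrow>
       opb n (\<lambda>i j. realization \<Phi> A $$ (i,j) - \<alpha> * 2 ^ (m + 2) * Tm n (resid (\<lambda>ij. A $$ ij)) (m + 2) i j)
         (\<bar>\<alpha>\<bar> * 2 ^ (m + 2) * ((2 ^ (m + 1) - 1 + (real m + 1) / 2) * \<eta>))"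
proof -
  let ?w = "3 * (n\<^sup>2 + n) + (Q + n\<^sup>2 * (2 * k + length P)) + m * (4 * n\<^sup>2 + n + 2 * Q)"
  let ?C = "{[0]} :: nat list set" and ?I = "{..<n} \<times> {..<n}"
  obtain J :: "(nat list \<times> nat \<times> nat + nat \<times> nat) set" and G rT rY where J: "finite J"
    and G: "realizes \<rho> ?I J G ?w (Suc m * (1 + (2 * k + length P)))"
    and TY: "approximates_T (Suc m) J G rT" "approximates_Y (Suc m) J G rY"
    using reachable_rounds[of m] unfolding reachable_def by (elim exE conjE) (rule that)
  have "?C = {[0]} \<or> ?C = {[0], [1]}" "1 \<le> Suc m" by simp_all
  then obtain H where H: "realizes \<rho> J (copies ?C (2 ^ k, 2 ^ k) ({} :: (nat \<times> nat) set)) H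
      (card ?C * (2 * n\<^sup>2) + n + card ?C * Q) (1 + (2 * k + length P))"
    and T: "approximates_T (Suc (Suc m)) (copies ?C (2 ^ k, 2 ^ k) ({} :: (nat \<times> nat) set)) (\<lambda>A. H (G A))
       (\<lambda>i j. Inl ([0], i, j))"
    by (rule product_round[OF J TY]) (rule that)
  let ?J = "copies ?C (2 ^ k, 2 ^ k) ({} :: (nat \<times> nat) set)"
  have R: "realizes \<rho> ?I ?J (\<lambda>A. H (G A)) (?w + (2 * n\<^sup>2 + n + Q))
      (Suc m * (1 + (2 * k + length P)) + (1 + (2 * k + length P)))"
    using realizes_comp[OF G H J] by simp
  \<comment> \<open>The output layer undoes the scaling 2^(-N) and multiplies by alpha, since the
    inverse of A is alpha times that of I - X; this multiplies the accumulated error by |alpha|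
    2^N.\<close>
  define rw :: "nat \<times> nat \<Rightarrow> ((nat list \<times> nat \<times> nat + nat \<times> nat) \<times> real) list" where
    "rw = (\<lambda>(i, j). [(Inl ([0], i, j), \<alpha> * 2 ^ (m + 2))])"
  have cost: "layer_cost ?I rw (\<lambda>_. 0) = n\<^sup>2"
    by (simp add: layer_cost_def rw_def split_def power2_eq_square)
  have sub: "fst ` set (rw ij) \<subseteq> ?J" if "ij \<in> ?I" for ij
    using that T by (auto simp: rw_def approximates_T_def)
  have fin: "finite ?J" by (simp add: finite_copies)
  obtain \<Phi> where \<Phi>: "is_mnn \<rho> (n, n) (n, n) \<Phi>"
    "length \<Phi> = Suc m * (1 + (2 * k + length P)) + (1 + (2 * k + length P)) + 1"
    "num_weights \<Phi> \<le> ?w + (2 * n\<^sup>2 + n + Q) + layer_cost ?I rw (\<lambda>_. 0)"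
    "\<And>A. A \<in> carrier_mat n n \<Longrightarrow> realization \<Phi> A =
        mat n n (\<lambda>ij. (\<Sum>(i, w)\<leftarrow>rw ij. w * H (G (\<lambda>ij. A $$ ij)) i) + 0)"
    by (rule realizes_imp_mnn[OF R fin n(1) sub, where b = "\<lambda>_. 0"]) (assumption | rule that)+
  note \<Phi> = \<Phi>[unfolded cost]
  show ?thesis
  proof (rule that[OF \<Phi>(1) _ \<Phi>(3)])
    show "length \<Phi> = (m + 2) * (1 + (2 * k + length P)) + 1" using \<Phi>(2) by simp
    show "\<forall>A\<in>carrier_mat n n. realization \<Phi> A \<in> carrier_mat n n" by (simp add: \<Phi>(4))
  next
    show "\<forall>A\<in>carrier_mat n n. opb n (resid (\<lambda>ij. A $$ ij)) \<delta> \<longrightarrow>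
       opb n (\<lambda>i j. realization \<Phi> A $$ (i,j) - \<alpha> * 2 ^ (m + 2) * Tm n (resid (\<lambda>ij. A $$ ij)) (m + 2) i j)
         (\<bar>\<alpha>\<bar> * 2 ^ (m + 2) * ((2 ^ (m + 1) - 1 + (real m + 1) / 2) * \<eta>))"
    proof (intro ballI impI)
      fix A :: "real mat" assume A: "A \<in> carrier_mat n n"
      assume "opb n (resid (\<lambda>ij. A $$ ij)) \<delta>"
      then have "opb n (\<lambda>i j. H (G (\<lambda>ij. A $$ ij)) (Inl ([0], i, j)) - Tm n (resid (\<lambda>ij. A $$ ij)) (m + 2) i j)
          ((2 ^ (m + 1) - 1 + (real m + 1) / 2) * \<eta>)"
        using T by (simp add: approximates_T_def add_ac)
      from opb_scale[OF this, of "\<alpha> * 2 ^ (m + 2)"]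
      have *: "opb n (\<lambda>i j. \<alpha> * 2 ^ (m + 2) * (H (G (\<lambda>ij. A $$ ij)) (Inl ([0], i, j)) -
            Tm n (resid (\<lambda>ij. A $$ ij)) (m + 2) i j))
          (\<bar>\<alpha>\<bar> * 2 ^ (m + 2) * ((2 ^ (m + 1) - 1 + (real m + 1) / 2) * \<eta>))"
        by (simp only: abs_mult power_abs abs_numeral)
      show "opb n (\<lambda>i j. realization \<Phi> A $$ (i,j) - \<alpha> * 2 ^ (m + 2) * Tm n (resid (\<lambda>ij. A $$ ij)) (m + 2) i j)
           (\<bar>\<alpha>\<bar> * 2 ^ (m + 2) * ((2 ^ (m + 1) - 1 + (real m + 1) / 2) * \<eta>))"
        by (rule iffD1[OF opb_cong *]) (simp add: \<Phi>(4)[OF A] rw_def right_diff_distrib)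
    qed
  qed
qed

end

section \<open>Inverse matrices\<close>

abbreviation entries :: "real mat \<Rightarrow> nat \<Rightarrow> nat \<Rightarrow> real" where
  "entries M \<equiv> \<lambda>i j. M $$ (i,j)"

section \<open>Translation between \<open>mat_norm2\<close> and \<open>opb\<close>\<close>

lemma vec_norm2_eq: "v \<in> carrier_vec n \<Longrightarrow> vec_norm2 v = nrm n (\<lambda>i. v $ i)"
  by (auto simp: vec_norm2_def scalar_prod_def L2_set_def power2_eq_square atLeast0LessThan)

lemma mult_mat_vec_entries:
  assumes "M \<in> carrier_mat n n" "v \<in> carrier_vec n" "i < n"
  shows "(M *\<^sub>v v) $ i = mv n (entries M) (\<lambda>i. v $ i) i"
  using assms by (auto simp: mult_mat_vec_def scalar_prod_def mv_def atLeast0LessThan intro!: sum.cong)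

lemma vec_norm2_mult_mat_vec:
  assumes "M \<in> carrier_mat n n" "v \<in> carrier_vec n"
  shows "vec_norm2 (M *\<^sub>v v) = nrm n (mv n (entries M) (\<lambda>i. v $ i))"
  using vec_norm2_eq[OF mult_mat_vec_carrier[OF assms]] mult_mat_vec_entries[OF assms]
  by (simp cong: nrm_cong)

lemma mat_norm2_le:
  assumes M: "M \<in> carrier_mat n n" and c: "opb n (entries M) c" "0 \<le> c"
  shows "mat_norm2 M \<le> c"
  unfolding mat_norm2_def
proof (rule cSup_least)
  have "vec_norm2 (0\<^sub>v (dim_col M)) \<le> 1" by (simp add: vec_norm2_def)
  then show "{vec_norm2 (M *\<^sub>v v) |v. v \<in> carrier_vec (dim_col M) \<and> vec_norm2 v \<le> 1} \<noteq> {}"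
    using zero_carrier_vec by blast
  fix x assume "x \<in> {vec_norm2 (M *\<^sub>v v) |v. v \<in> carrier_vec (dim_col M) \<and> vec_norm2 v \<le> 1}"
  then obtain v where v: "x = vec_norm2 (M *\<^sub>v v)" "v \<in> carrier_vec n" "vec_norm2 v \<le> 1"
    using M by auto
  have "x \<le> c * nrm n (\<lambda>i. v $ i)"
    using c(1) by (simp add: v(1) vec_norm2_mult_mat_vec[OF M v(2)] opb_def)
  also have "\<dots> \<le> c * 1"
    using v(2,3) c(2) by (intro mult_left_mono) (simp_all add: vec_norm2_eq)
  finally show "x \<le> c" by simp
qed

text \<open>A crude bound from the entries shows that the supremum is taken over a bounded set;
  homogeneity then extends its bound from the unit ball to all vectors.\<close>

lemma opb_mat_norm2:
  assumes M: "M \<in> carrier_mat n n"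
  shows "opb n (entries M) (mat_norm2 M)"
  unfolding opb_def
proof
  fix v :: "nat \<Rightarrow> real"
  let ?S = "{vec_norm2 (M *\<^sub>v v) |v. v \<in> carrier_vec (dim_col M) \<and> vec_norm2 v \<le> 1}"
  let ?b = "\<Sum>i<n. \<Sum>j<n. \<bar>M $$ (i,j)\<bar>"
  have "\<bar>M $$ (i,j)\<bar> \<le> ?b" if "i < n" "j < n" for i j
  proof -
    have "\<bar>M $$ (i,j)\<bar> \<le> (\<Sum>j<n. \<bar>M $$ (i,j)\<bar>)" using that by (intro member_le_sum) auto
    also have "\<dots> \<le> ?b" using that by (intro member_le_sum) (auto intro: sum_nonneg)
    finally show ?thesis .
  qed
  then have b: "opb n (entries M) (real n * ?b)" by (rule opb_of_entries)
  have b0: "0 \<le> real n * ?b" by (intro mult_nonneg_nonneg sum_nonneg) auto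
  have bdd: "bdd_above ?S"
  proof (rule bdd_aboveI)
    fix x assume "x \<in> ?S"
    then obtain v where v: "x = vec_norm2 (M *\<^sub>v v)" "v \<in> carrier_vec n" "vec_norm2 v \<le> 1"
      using M by auto
    have "x \<le> (real n * ?b) * nrm n (\<lambda>i. v $ i)"
      using b by (simp add: v(1) vec_norm2_mult_mat_vec[OF M v(2)] opb_def)
    also have "\<dots> \<le> (real n * ?b) * 1"
      using v(2,3) b0 by (intro mult_left_mono) (simp_all add: vec_norm2_eq)
    finally show "x \<le> real n * ?b" by simp
  qed
  let ?N = "nrm n v"
  show "nrm n (mv n (entries M) v) \<le> mat_norm2 M * ?N"
  proof (cases "?N = 0")
    case True
    then show ?thesis using b unfolding opb_def by (metis mult_zero_right)
  next
    case False
    then have N: "0 < ?N" using L2_set_nonneg[of v "{..<n}"] by linarith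
    define w where "w = vec n (\<lambda>i. 1 / ?N * v i)"
    have w: "w \<in> carrier_vec n" by (simp add: w_def)
    have "nrm n (\<lambda>i. w $ i) = nrm n (\<lambda>i. 1 / ?N * v i)" by (rule nrm_cong) (simp add: w_def)
    also have "\<dots> = 1" using N by (simp only: nrm_scale) simp
    finally have "vec_norm2 w \<le> 1" by (simp add: vec_norm2_eq[OF w])
    then have "vec_norm2 (M *\<^sub>v w) \<le> mat_norm2 M"
      unfolding mat_norm2_def using w M by (intro cSup_upper bdd) auto
    moreover have "vec_norm2 (M *\<^sub>v w) = nrm n (\<lambda>i. 1 / ?N * mv n (entries M) v i)"
      unfolding vec_norm2_mult_mat_vec[OF M w]
      by (rule nrm_cong) (simp add: mv_def w_def sum_distrib_left sum_divide_distrib)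
    ultimately have "1 / ?N * nrm n (mv n (entries M) v) \<le> mat_norm2 M"
      using N by (simp only: nrm_scale) simp
    then show ?thesis using N by (simp add: field_simps)
  qed
qed

text \<open>Triangle inequality for v = (I - M) v + M v. This lower bound yields both invertibility
  and the norm of the inverse.\<close>

lemma nrm_resid_le:
  assumes X: "opb n (\<lambda>i j. idm i j - M i j) \<delta>"
  shows "(1 - \<delta>) * nrm n v \<le> nrm n (mv n M v)"
proof -
  have "nrm n v = nrm n (\<lambda>i. mv n (\<lambda>i j. idm i j - M i j) v i + mv n M v i)"
  proof (rule nrm_cong)
    fix i assume "i < n"
    then show "v i = mv n (\<lambda>i j. idm i j - M i j) v i + mv n M v i"
      using mv_idm[of i n v] by (simp add: mv_def left_diff_distrib sum_subtractf)
  qed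
  also have "\<dots> \<le> nrm n (mv n (\<lambda>i j. idm i j - M i j) v) + nrm n (mv n M v)"
    by (rule L2_set_triangle_ineq)
  also have "\<dots> \<le> \<delta> * nrm n v + nrm n (mv n M v)"
    using X by (simp add: opb_def)
  finally show ?thesis by (simp add: algebra_simps)
qed

text \<open>A kernel vector v would satisfy (1 - delta) |v| <= 0.\<close>

lemma ex_inverse:
  assumes A: "A \<in> carrier_mat n n" and X: "opb n (\<lambda>i j. idm i j - \<alpha> * A $$ (i,j)) \<delta>" and "\<delta> < 1"
  obtains B where "B \<in> carrier_mat n n" "inverts_mat A B" "inverts_mat B A"
proof -
  have "det A \<noteq> 0"
  proof
    assume "det A = 0"
    then obtain v where v: "v \<in> carrier_vec n" "v \<noteq> 0\<^sub>v n" "A *\<^sub>v v = 0\<^sub>v n"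
      using det_0_iff_vec_prod_zero_field[OF A] by blast
    have "mv n (\<lambda>i j. \<alpha> * A $$ (i,j)) (\<lambda>i. v $ i) i = 0" if "i < n" for i
      using mult_mat_vec_entries[OF A v(1) that] v(3) that
      by (simp add: mv_def mult.assoc sum_distrib_left[symmetric])
    then have "nrm n (mv n (\<lambda>i j. \<alpha> * A $$ (i,j)) (\<lambda>i. v $ i)) = 0"
      by (simp add: L2_set_def)
    then have "(1 - \<delta>) * nrm n (\<lambda>i. v $ i) \<le> 0" using nrm_resid_le[OF X, of "\<lambda>i. v $ i"] by simp
    then have "nrm n (\<lambda>i. v $ i) \<le> 0" using assms(3) by (simp add: mult_le_0_iff)
    then have "nrm n (\<lambda>i. v $ i) = 0" using L2_set_nonneg by (rule antisym)
    then have "v = 0\<^sub>v n" using v(1) by (intro eq_vecI) (auto simp: L2_set_eq_0_iff)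
    with v(2) show False by simp
  qed
  from det_non_zero_imp_unit[OF A this]
  obtain B where "B \<in> carrier_mat n n" "B * A = 1\<^sub>m n" "A * B = 1\<^sub>m n"
    by (auto simp: Units_def ring_mat_def)
  then show ?thesis using A by (intro that[of B]) (auto simp: inverts_mat_def)
qed

section \<open>Estimates for the inverse when I - alpha A has norm at most delta\<close>

context
  fixes n :: nat and A B :: "real mat" and \<alpha> \<delta> :: real and X :: "nat \<Rightarrow> nat \<Rightarrow> real"
  assumes A: "A \<in> carrier_mat n n" and B: "B \<in> carrier_mat n n"
    and AB: "inverts_mat A B" and BA: "inverts_mat B A"
    and X_def: "X = (\<lambda>i j. idm i j - \<alpha> * A $$ (i,j))" and X: "opb n X \<delta>" and \<delta>: "0 \<le> \<delta>" "\<delta> < 1"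
begin

lemma mm_entries_inverse:
  assumes "i < n" "j < n"
  shows "mm n (entries A) (entries B) i j = idm i j" "mm n (entries B) (entries A) i j = idm i j"
proof -
  have "(A * B) $$ (i,j) = idm i j" "(B * A) $$ (i,j) = idm i j"
    using AB BA A B assms by (auto simp: inverts_mat_def idm_def)
  moreover have "(A * B) $$ (i,j) = mm n (entries A) (entries B) i j"
    "(B * A) $$ (i,j) = mm n (entries B) (entries A) i j"
    using A B assms by (auto simp: mm_def scalar_prod_def atLeast0LessThan intro!: sum.cong)
  ultimately show "mm n (entries A) (entries B) i j = idm i j" "mm n (entries B) (entries A) i j = idm i j"
    by simp_all
qed

lemma mv_inverse: "i < n \<Longrightarrow> mv n (\<lambda>i j. \<alpha> * A $$ (i,j)) (mv n (entries B) v) i = \<alpha> * v i"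
proof -
  assume i: "i < n"
  have "mv n (\<lambda>i j. \<alpha> * A $$ (i,j)) (mv n (entries B) v) i = \<alpha> * mv n (mm n (entries A) (entries B)) v i"
    unfolding mv_mm by (simp add: mv_def sum_distrib_left mult.assoc)
  also have "mv n (mm n (entries A) (entries B)) v i = mv n idm v i"
    using mm_entries_inverse(1)[OF i] by (simp add: mv_def)
  finally show ?thesis using i by (simp add: mv_idm)
qed

text \<open>The lower bound for alpha A, applied to B v, where alpha A B v = alpha v.\<close>

lemma opb_inverse: "opb n (entries B) (\<bar>\<alpha>\<bar> / (1 - \<delta>))"
  unfolding opb_def
proof
  fix v
  have "(1 - \<delta>) * nrm n (mv n (entries B) v) \<le> nrm n (mv n (\<lambda>i j. \<alpha> * A $$ (i,j)) (mv n (entries B) v))"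
    by (rule nrm_resid_le) (use X in \<open>simp add: X_def\<close>)
  also have "\<dots> = nrm n (\<lambda>i. \<alpha> * v i)"
    by (rule nrm_cong) (rule mv_inverse)
  finally have "(1 - \<delta>) * nrm n (mv n (entries B) v) \<le> \<bar>\<alpha>\<bar> * nrm n v" by (simp only: nrm_scale)
  then show "nrm n (mv n (entries B) v) \<le> \<bar>\<alpha>\<bar> / (1 - \<delta>) * nrm n v"
    using \<delta> by (simp add: field_simps)
qed

text \<open>From I - X = alpha A follows B (I - X) = alpha I. Multiplying the telescoped identity by
  B from the left gives alpha 2^N T_N = B - B X^(2^N).\<close>

lemma opb_truncation:
  "opb n (\<lambda>i j. B $$ (i,j) - \<alpha> * 2 ^ N * Tm n X N i j) (\<bar>\<alpha>\<bar> / (1 - \<delta>) * \<delta> ^ 2 ^ N)"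
proof -
  have "\<alpha> * 2 ^ N * Tm n X N i j = B $$ (i,j) - mm n (entries B) (Ym n X N) i j" if ij: "i < n" "j < n" for i j
  proof -
    have "mm n (entries B) (\<lambda>i j. idm i j - X i j) i' j' = \<alpha> * idm i' j'" if "i' < n" "j' < n" for i' j'
      using mm_entries_inverse(2)[OF that] by (simp add: X_def mm_scale_right)
    then have "mm n (mm n (entries B) (\<lambda>i j. idm i j - X i j)) (Tm n X N) i j =
        mm n (\<lambda>i j. \<alpha> * idm i j) (Tm n X N) i j"
      using ij by (intro mm_cong) auto
    also have "\<dots> = \<alpha> * Tm n X N i j" using ij by (simp add: mm_scale_left mm_idm_left)
    finally have "\<alpha> * 2 ^ N * Tm n X N i j =
        2 ^ N * mm n (entries B) (mm n (\<lambda>i j. idm i j - X i j) (Tm n X N)) i j"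
      by (simp add: mm_assoc)
    also have "\<dots> = mm n (entries B) (\<lambda>i j. 2 ^ N * mm n (\<lambda>i j. idm i j - X i j) (Tm n X N) i j) i j"
      by (simp add: mm_scale_right)
    also have "\<dots> = mm n (entries B) (\<lambda>i j. idm i j - Ym n X N i j) i j"
      using telescope_Tm[of _ n _ X N] ij by (intro mm_cong) (auto simp: mult.commute)
    finally show ?thesis using ij by (simp add: mm_diff_right mm_idm_right)
  qed
  moreover have "opb n (mm n (entries B) (Ym n X N)) (\<bar>\<alpha>\<bar> / (1 - \<delta>) * \<delta> ^ 2 ^ N)"
    using \<delta> by (intro opb_mm opb_inverse opb_Ym X) auto
  ultimately show ?thesis
    by (subst opb_cong[where M' = "mm n (entries B) (Ym n X N)"]) auto
qed

text \<open>The Moebius map \<open>z \<mapsto> 1 / (1 - z)\<close> sends the disc of radius \<open>\<delta>\<close> to the disc with centre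
  \<open>1 / (1 - \<delta>\<^sup>2)\<close> and radius \<open>\<delta> / (1 - \<delta>\<^sup>2)\<close>.\<close>

lemma opb_constant:
  "opb n (\<lambda>i j. B $$ (i,j) - \<alpha> / (1 - \<delta>\<^sup>2) * idm i j) (\<bar>\<alpha>\<bar> * \<delta> / (1 - \<delta>\<^sup>2))"
  unfolding opb_def
proof
  fix v
  let ?w = "mv n (entries B) v"
  let ?z = "mv n X ?w" and ?s = "1 - \<delta>\<^sup>2"
  have s: "0 < ?s" using \<delta> by (simp add: power_less_one_iff)
  \<comment> \<open>With w = B v and z = X w, alpha v = w - z. The claim becomes an inequality
    between w and z alone, for which only |z| <= delta |w| is known.\<close>
  have v: "\<alpha> * v i = ?w i - ?z i" if "i < n" for i
    using mv_inverse[OF that, of v] mv_idm[OF that, of ?w]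
    by (simp add: X_def mv_def[of n _ ?w] left_diff_distrib sum_subtractf)
  have "?s * mv n (\<lambda>i j. B $$ (i,j) - \<alpha> / ?s * idm i j) v i = ?z i - \<delta>\<^sup>2 * ?w i" if "i < n" for i
  proof -
    have "mv n (\<lambda>i j. B $$ (i,j) - \<alpha> / ?s * idm i j) v i = ?w i - \<alpha> / ?s * mv n idm v i"
      by (simp add: mv_def left_diff_distrib sum_subtractf sum_distrib_left mult.assoc)
    also have "\<dots> = ?w i - (?w i - ?z i) / ?s" using that by (simp add: mv_idm v[symmetric])
    finally show ?thesis using s by (simp add: field_simps)
  qed
  note z = this
  have "?s * nrm n (mv n (\<lambda>i j. B $$ (i,j) - \<alpha> / ?s * idm i j) v) =
      nrm n (\<lambda>i. ?s * mv n (\<lambda>i j. B $$ (i,j) - \<alpha> / ?s * idm i j) v i)"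
    using s by (simp only: nrm_scale abs_of_pos)
  also have "\<dots> = nrm n (\<lambda>i. ?z i - \<delta>\<^sup>2 * ?w i)" by (rule nrm_cong) (rule z)
  also have "\<dots> \<le> \<delta> * nrm n (\<lambda>i. ?w i - ?z i)"
  proof -
    have "nrm n ?z \<le> \<delta> * nrm n ?w" using X by (simp add: opb_def)
    then have "(nrm n ?z)\<^sup>2 \<le> (\<delta> * nrm n ?w)\<^sup>2" by (intro power_mono L2_set_nonneg)
    then have zw: "(\<Sum>i<n. (?z i)\<^sup>2) \<le> \<delta>\<^sup>2 * (\<Sum>i<n. (?w i)\<^sup>2)"
      by (simp add: L2_set_def power_mult_distrib sum_nonneg)
    have "(\<Sum>i<n. (?z i - \<delta>\<^sup>2 * ?w i)\<^sup>2) =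
        (\<Sum>i<n. (?z i)\<^sup>2) - 2 * \<delta>\<^sup>2 * (\<Sum>i<n. ?w i * ?z i) + \<delta>\<^sup>2 * \<delta>\<^sup>2 * (\<Sum>i<n. (?w i)\<^sup>2)"
      by (simp add: power2_diff sum.distrib sum_subtractf sum_distrib_left power_mult_distrib
          power2_eq_square algebra_simps)
    \<comment> \<open>The inner products on both sides cancel; what remains is (1 - delta^2) (|z|^2
      - delta^2 |w|^2) <= 0.\<close>
    also have "\<dots> \<le> \<delta>\<^sup>2 * ((\<Sum>i<n. (?w i)\<^sup>2) - 2 * (\<Sum>i<n. ?w i * ?z i) + (\<Sum>i<n. (?z i)\<^sup>2))"
      using mult_left_mono[OF zw, of ?s] s by (simp add: algebra_simps)
    also have "(\<Sum>i<n. (?w i)\<^sup>2) - 2 * (\<Sum>i<n. ?w i * ?z i) + (\<Sum>i<n. (?z i)\<^sup>2) = (\<Sum>i<n. (?w i - ?z i)\<^sup>2)"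
      by (simp add: power2_diff sum.distrib sum_subtractf sum_distrib_left mult.assoc)
    finally have "sqrt (\<Sum>i<n. (?z i - \<delta>\<^sup>2 * ?w i)\<^sup>2) \<le> sqrt (\<delta>\<^sup>2 * (\<Sum>i<n. (?w i - ?z i)\<^sup>2))"
      by (rule real_sqrt_le_mono)
    then show ?thesis using \<delta> by (simp add: L2_set_def real_sqrt_mult)
  qed
  also have "nrm n (\<lambda>i. ?w i - ?z i) = nrm n (\<lambda>i. \<alpha> * v i)" by (rule nrm_cong) (simp add: v)
  finally have "?s * nrm n (mv n (\<lambda>i j. B $$ (i,j) - \<alpha> / ?s * idm i j) v) \<le> \<delta> * (\<bar>\<alpha>\<bar> * nrm n v)"
    by (simp only: nrm_scale)
  then show "nrm n (mv n (\<lambda>i j. B $$ (i,j) - \<alpha> / ?s * idm i j) v) \<le> \<bar>\<alpha>\<bar> * \<delta> / ?s * nrm n v"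
    using s by (simp add: field_simps)
qed

end

section \<open>Numerical estimates\<close>

lemma ex_two_power: "1 \<le> n \<Longrightarrow> \<exists>k. n \<le> 2 ^ k \<and> (2::nat) ^ k \<le> 2 * n"
proof (induction n rule: dec_induct)
  case base
  show ?case by (rule exI[of _ 0]) simp
next
  case (step n)
  then obtain k where k: "n \<le> 2 ^ k" "(2::nat) ^ k \<le> 2 * n" by blast
  show ?case
  proof (cases "Suc n \<le> 2 ^ k")
    case True
    then show ?thesis using k by (intro exI[of _ k]) simp
  next
    case False
    then show ?thesis using k step.hyps by (intro exI[of _ "Suc k"]) simp
  qed
qed

section \<open>The number of rounds and the accuracy of the products\<close>

lemma N_inv_ge_1: "1 \<le> N_inv e \<delta>"
  by (simp add: N_inv_def Let_def le_nat_iff)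

text \<open>The inequality for which N is chosen: two logarithms reduce it to log2 r <= N. If r <=
  0, then e (1 - delta) >= 1 and every power of delta is small enough.\<close>

lemma N_inv_power:
  assumes "0 < e" "0 < \<delta>" "\<delta> < 1"
  shows "\<delta> ^ 2 ^ N_inv e \<delta> \<le> e * (1 - \<delta>)"
proof -
  let ?c = "e * (1 - \<delta>)" and ?N = "N_inv e \<delta>"
  let ?r = "log 2 ?c / log 2 \<delta>"
  have c: "0 < ?c" and d: "log 2 \<delta> < 0" using assms by simp_all
  show ?thesis
  proof (cases "?r \<le> 0")
    case True
    then have "0 \<le> log 2 ?c" using d by (simp add: divide_le_0_iff)
    then have "1 \<le> ?c" using c by simp
    moreover have "\<delta> ^ 2 ^ ?N \<le> 1" using assms by (intro power_le_one) auto
    ultimately show ?thesis by linarith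
  next
    case False
    then have "?N = nat (max \<lceil>log 2 ?r\<rceil> 1)" by (simp add: N_inv_def Let_def)
    then have "log 2 ?r \<le> real ?N" by linarith
    then have "2 powr log 2 ?r \<le> 2 powr real ?N" by (intro powr_mono) auto
    moreover have "2 powr log 2 ?r = ?r" using False by (intro powr_log_cancel) auto
    ultimately have r: "?r \<le> real (2 ^ ?N)" by (simp add: powr_realpow)
    have "\<delta> ^ 2 ^ ?N = \<delta> powr real (2 ^ ?N)" using assms by (simp only: powr_realpow)
    also have "\<dots> \<le> \<delta> powr ?r" using r assms by (intro powr_mono') auto
    also have "\<delta> powr ?r = (2 powr log 2 \<delta>) powr ?r"
      using assms by simp
    also have "\<dots> = 2 powr (log 2 \<delta> * ?r)"
      by (rule powr_powr)
    also have "log 2 \<delta> * ?r = log 2 ?c" using d by simp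
    also have "2 powr log 2 ?c = ?c" using c by simp
    finally show ?thesis .
  qed
qed

text \<open>Halving e lowers log2 (e (1 - delta)) by one. As this logarithm is at most -1, its
  modulus at most doubles, so r at most doubles and the outer logarithm grows by at most
  one.\<close>

lemma N_inv_half:
  assumes "0 < e" "0 < \<delta>" "\<delta> < 1" "e * (1 - \<delta>) \<le> 1/2"
  shows "N_inv (e / 2) \<delta> \<le> N_inv e \<delta> + 1"
proof -
  let ?c = "e * (1 - \<delta>)"
  let ?r = "log 2 ?c / log 2 \<delta>" and ?r' = "log 2 (?c / 2) / log 2 \<delta>"
  have c: "0 < ?c" and d: "log 2 \<delta> < 0" using assms by simp_all
  have "log 2 ?c \<le> log 2 (1/2)" using assms c by (subst log_le_cancel_iff) auto
  then have lc: "log 2 ?c \<le> -1" by (simp add: log_divide)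
  have "log 2 (x / 2) = log 2 x - 1" if "0 < x" for x :: real using that by (simp add: log_divide)
  note lc' = this[OF c]
  have r: "0 < ?r" using lc d by (intro divide_neg_neg) auto
  have r': "0 < ?r'" using lc d unfolding lc' by (intro divide_neg_neg) auto
  have "2 * ?r - ?r' = (log 2 ?c + 1) / log 2 \<delta>"
    unfolding lc' times_divide_eq_right diff_divide_distrib[symmetric] by simp
  moreover have "0 \<le> (log 2 ?c + 1) / log 2 \<delta>" using lc d by (intro divide_nonpos_neg) auto
  ultimately have "?r' \<le> 2 * ?r" by linarith
  then have "log 2 ?r' \<le> log 2 (2 * ?r)" using r r' by (subst log_le_cancel_iff) auto
  also have "\<dots> = 1 + log 2 ?r" using r by (subst log_mult) auto
  finally have "\<lceil>log 2 ?r'\<rceil> \<le> \<lceil>log 2 ?r\<rceil> + 1" by linarith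
  moreover have "N_inv e \<delta> = nat (max \<lceil>log 2 ?r\<rceil> 1)" using r by (simp add: N_inv_def Let_def)
  moreover have "N_inv (e / 2) \<delta> = nat (max \<lceil>log 2 ?r'\<rceil> 1)" using r' by (simp add: N_inv_def Let_def)
  ultimately show ?thesis by linarith
qed

text \<open>The left side is the accumulated error, in units of eta, after rescaling by 2^N with N =
  m + 2. The exponent on the right is 2^(N - 1), not 2^N, because \<open>Sigma_inv\<close> may be
  built with one round less.\<close>

lemma error_constant:
  "2 ^ (m + 2) * (2 ^ (m + 1) - 1 + (real m + 1) / 2) \<le> 2 * 2 ^ 2 ^ (m + 1)"
proof -
  \<comment> \<open>The comparison 2 m + 3 <= 2^(m + 1) starts at m = 2; for m = 1 the claim is an
    equality, 32 = 32.\<close>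
  consider "m = 0" | "m = 1" | "2 \<le> m" by linarith
  then show ?thesis
  proof cases
    case 3
    have exp: "2 * m + 3 \<le> 2 ^ (m + 1)" using 3 by (induction m rule: dec_induct) auto
    define p where "p = (2::real) ^ m"
    have "real m < p" "1 \<le> p" unfolding p_def by (rule of_nat_less_two_power) simp
    then have "2 * p - 1 + (real m + 1) / 2 \<le> 4 * p" by (simp add: field_simps)
    then have "2 ^ (m + 1) - 1 + (real m + 1) / 2 \<le> (2::real) ^ (m + 2)" by (simp add: p_def)
    then have "2 ^ (m + 2) * (2 ^ (m + 1) - 1 + (real m + 1) / 2) \<le> 2 ^ (m + 2) * 2 ^ (m + 2)"
      by (intro mult_left_mono) auto
    also have "\<dots> = 2 ^ (1 + (2 * m + 3))"
    proof -
      have "1 + (2 * m + 3) = (m + 2) + (m + 2)" by simp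
      then show ?thesis by (simp only: power_add)
    qed
    also have "\<dots> \<le> (2::real) ^ (1 + 2 ^ (m + 1))" by (intro power_increasing) (use exp in auto)
    finally show ?thesis by simp
  qed (simp_all add: eval_nat_numeral)
qed

text \<open>Since 4^k <= 4 n^2, the denominator 16 n^3 turns the error of a product into 2^(-D)
  min(e, 1/4)/4 with D = 2^N(e). The first claim keeps the invariant of
  \<open>approx_square\<close>, the second bounds the accumulated error.\<close>

lemma Sigma_inv_bounds:
  fixes e \<delta> :: real and n k m :: nat
  defines "\<eta> \<equiv> real n * (4 ^ k * Sigma_inv e \<delta> n)"
  assumes e: "0 < e" "0 < \<delta>" "\<delta> < 1" "e * (1 - \<delta>) \<le> 1/2" and n: "1 \<le> n" "2 ^ k \<le> 2 * n"
  shows "\<eta> \<le> (1 - max \<delta> (1/2)) / 2"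
    and "N_inv (e / 2) \<delta> = m + 2 \<Longrightarrow> 2 ^ (m + 2) * ((2 ^ (m + 1) - 1 + (real m + 1) / 2) * \<eta>) \<le> e / 2"
proof -
  let ?D = "2 ^ N_inv e \<delta> :: nat"
  have "real (2 ^ k) \<le> real (2 * n)" using n(2) by (rule of_nat_mono)
  then have "(2 ^ k)\<^sup>2 \<le> (2 * real n)\<^sup>2" by (intro power_mono) auto
  then have k: "4 ^ k \<le> 4 * (real n)\<^sup>2"
    by (simp add: power_mult_distrib power_mult[symmetric] mult.commute[of k]) (simp add: power_mult)
  have "0 \<le> Sigma_inv e \<delta> n" using e by (simp add: Sigma_inv_def)
  then have "\<eta> \<le> real n * (4 * (real n)\<^sup>2 * Sigma_inv e \<delta> n)"
    unfolding \<eta>_def by (intro mult_left_mono mult_right_mono k) auto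
  also have "\<dots> = 1 / 2 ^ ?D * (min e (1/4) / 4)"
    using n(1) by (simp add: Sigma_inv_def power2_eq_square power3_eq_cube field_simps)
  finally have \<eta>: "\<eta> \<le> 1 / 2 ^ ?D * (min e (1/4) / 4)" .
  have "1 / 2 ^ ?D * (min e (1/4) / 4) \<le> 1 / 2 ^ ?D * (1 / 16)" by (intro mult_left_mono) auto
  then have \<eta>1: "\<eta> \<le> 1 / (16 * 2 ^ ?D)" using \<eta> by simp
  have D: "1 \<le> ?D" by simp
  have "real ?D < 2 ^ ?D" by (rule of_nat_less_two_power)
  then have "1 / (16 * 2 ^ ?D) \<le> 1 / (16 * real ?D)" using D by (intro divide_left_mono) auto
  then have \<eta>2: "\<eta> \<le> 1 / (16 * real ?D)" using \<eta>1 by linarith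
  \<comment> \<open>Bernoulli relates D to 1 - delta: 1 - D (1 - delta) <= delta^D <= 1/2, hence
    1/(4 D) <= (1 - delta)/2, while 2^(-D) is below 1/D.\<close>
  have "1 + real ?D * (\<delta> - 1) \<le> (1 + (\<delta> - 1)) ^ ?D"
    using e by (intro Bernoulli_inequality) auto
  also have "\<dots> \<le> 1/2" using N_inv_power[OF e(1-3)] e(4) by simp
  finally have "1/2 \<le> real ?D * (1 - \<delta>)" by (simp add: algebra_simps)
  then have "1 / (4 * real ?D) \<le> (1 - \<delta>) / 2" using D by (simp add: field_simps)
  moreover have "1 / (16 * real ?D) \<le> 1 / (4 * real ?D)" using D by (intro divide_left_mono) auto
  moreover have "1 / (16 * real ?D) \<le> 1 / 16" using D by (simp add: field_simps)
  ultimately have "\<eta> \<le> (1 - \<delta>) / 2" "\<eta> \<le> 1 / 4" using \<eta>2 by linarith+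
  then show "\<eta> \<le> (1 - max \<delta> (1/2)) / 2" by (simp add: max_def)
  assume N: "N_inv (e / 2) \<delta> = m + 2"
  have "1 / 2 ^ ?D * (min e (1/4) / 4) \<le> 1 / 2 ^ ?D * (e / 4)" by (intro mult_left_mono) auto
  moreover have "1 / 2 ^ ?D * (e / 4) \<le> 1 / 2 ^ 2 ^ (m + 1) * (e / 4)"
  proof -
    \<comment> \<open>The truncation uses N(e/2) = m + 2, the accuracy uses N(e); they differ by at
      most one.\<close>
    have "m + 1 \<le> N_inv e \<delta>" using N_inv_half[OF e] N by simp
    then have "(2::real) ^ 2 ^ (m + 1) \<le> 2 ^ ?D" by (intro power_increasing) auto
    then show ?thesis using e(1) by (intro mult_right_mono divide_left_mono) auto
  qed
  ultimately have "\<eta> \<le> 1 / 2 ^ 2 ^ (m + 1) * (e / 4)" using \<eta> by linarith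
  moreover have "0 \<le> 2 ^ (m + 2) * (2 ^ (m + 1) - 1 + (real m + 1) / 2 :: real)"
  proof -
    have "(1::real) \<le> 2 ^ (m + 1)" by (rule one_le_power) simp
    then have "0 \<le> 2 ^ (m + 1) - 1 + (real m + 1) / 2" by (intro add_nonneg_nonneg) auto
    then show ?thesis by simp
  qed
  ultimately have "2 ^ (m + 2) * (2 ^ (m + 1) - 1 + (real m + 1) / 2) * \<eta> \<le>
      2 ^ (m + 2) * (2 ^ (m + 1) - 1 + (real m + 1) / 2) * (1 / 2 ^ 2 ^ (m + 1) * (e / 4))"
    by (rule mult_left_mono)
  also have "\<dots> \<le> 2 * 2 ^ 2 ^ (m + 1) * (1 / 2 ^ 2 ^ (m + 1) * (e / 4))"
    using e(1) by (intro mult_right_mono error_constant) auto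
  finally show "2 ^ (m + 2) * ((2 ^ (m + 1) - 1 + (real m + 1) / 2) * \<eta>) \<le> e / 2"
    by (simp add: mult.assoc)
qed

section \<open>Counting weights and layers\<close>

lemma le_log_of_power: "1 \<le> n \<Longrightarrow> 2 ^ k \<le> 2 * n \<Longrightarrow> real k \<le> log 2 (real n) + 1"
proof -
  assume n: "1 \<le> n" "2 ^ k \<le> 2 * n"
  have "real (2 ^ k) \<le> real (2 * n)" using n(2) by (rule of_nat_mono)
  then have "log 2 (2 ^ k) \<le> log 2 (2 * real n)" using n by (subst log_le_cancel_iff) auto
  then show ?thesis using n by (simp add: log_mult log_nat_power)
qed

text \<open>Padding to a power of two costs at most one further level of the recursion, a factor
  7.\<close>

lemma seven_power_le:
  assumes "1 \<le> n" "2 ^ k \<le> 2 * n"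
  shows "7 ^ k \<le> 7 * real n powr log 2 7"
proof -
  have "7 ^ k = (7::real) powr real k" by (simp add: powr_realpow)
  also have "\<dots> \<le> 7 powr (log 2 (real n) + 1)"
    using le_log_of_power[OF assms] by (intro powr_mono) auto
  also have "\<dots> = 7 * 7 powr log 2 (real n)" by (simp add: powr_add)
  also have "7 powr log 2 (real n) = real n powr log 2 7"
    using assms(1) by (simp add: powr_def log_def)
  finally show ?thesis .
qed

text \<open>The negative term -14 N n^2 is affordable since each of the 2 (m + 1) products saves 12
  * 4^k >= 12 n^2 in the closed form for Strassen's weights. A slack of (6 m + 8) n^2 remains, which
  absorbs the single n in excess.\<close>

lemma weight_bound:
  fixes n k m L M :: nat
  assumes n: "1 \<le> n" "n \<le> 2 ^ k" "2 ^ k \<le> 2 * n"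
    and w: "w \<le> 3 * (n\<^sup>2 + n) + (strassen_weights M k + n\<^sup>2 * (2 * k + L)) +
       m * (4 * n\<^sup>2 + n + 2 * strassen_weights M k) + (2 * n\<^sup>2 + n + strassen_weights M k) + n\<^sup>2"
  shows "real w \<le> 14 * real n powr log 2 7 * (real (m + 2) - 1) * (real M + 12)
     + real n ^ 2 * (real L - 14 * real (m + 2) + 20 + 2 * log 2 (real n)) + real n * (real (m + 2) + 1)"
proof -
  define Q W where "Q = real (strassen_weights M k)" and "W = real n powr log 2 7 * (real M + 12)"
  have "real (strassen_weights M k + 12 * 4 ^ k) = real (7 ^ k * (M + 12))"
    by (simp only: strassen_weights_eq)
  then have "Q + 12 * 4 ^ k = 7 ^ k * (real M + 12)" by (simp add: Q_def)
  also have "\<dots> \<le> 7 * real n powr log 2 7 * (real M + 12)"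
    by (intro mult_right_mono seven_power_le n) auto
  finally have Q1: "Q + 12 * 4 ^ k \<le> 7 * W" by (simp add: W_def)
  have "real n \<le> real (2 ^ k)" using n(2) by (rule of_nat_mono)
  then have "(real n)\<^sup>2 \<le> (2 ^ k)\<^sup>2" by (intro power_mono) auto
  also have "(2 ^ k)\<^sup>2 = (4::real) ^ k"
    by (simp add: power_mult[symmetric] mult.commute[of k]) (simp add: power_mult)
  finally have Q: "Q \<le> 7 * W - 12 * (real n)\<^sup>2" using Q1 by linarith
  have "real w \<le> 2 * (real m + 1) * Q + (real n)\<^sup>2 * (2 * real k + real L + 6 + 4 * real m) + real n * (4 + real m)"
    using of_nat_mono[OF w, where 'a = real] by (simp add: Q_def algebra_simps)
  also have "\<dots> \<le> 2 * (real m + 1) * (7 * W - 12 * (real n)\<^sup>2) +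
      (real n)\<^sup>2 * (2 * (log 2 (real n) + 1) + real L + 6 + 4 * real m) + real n * (4 + real m)"
    using le_log_of_power[OF n(1,3)] by (intro add_mono mult_left_mono Q) auto
  also have "\<dots> = 14 * (real m + 1) * W + (real n)\<^sup>2 * (real L - 14 * (real m + 2) + 20 + 2 * log 2 (real n))
     + real n * (real m + 3) - ((real n)\<^sup>2 * (6 * real m + 8) - real n)"
    by (simp add: algebra_simps)
  also have "\<dots> \<le> 14 * (real m + 1) * W + (real n)\<^sup>2 * (real L - 14 * (real m + 2) + 20 + 2 * log 2 (real n))
     + real n * (real m + 3)"
  proof -
    have "real n * 1 \<le> real n * real n" using n(1) by (intro mult_left_mono) auto
    also have "\<dots> * 1 \<le> real n * real n * (6 * real m + 8)" by (intro mult_left_mono) auto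
    finally show ?thesis by (simp add: power2_eq_square)
  qed
  finally show ?thesis by (simp add: W_def algebra_simps)
qed

text \<open>A round has at most 2 log2 n + 3 + L layers; the two spare layers per round cover the
  output layer.\<close>

lemma layer_bound:
  assumes "1 \<le> n" "2 ^ k \<le> 2 * n"
  shows "real ((m + 2) * (1 + (2 * k + L)) + 1) \<le> real (m + 2) * (2 * log 2 (real n) + 5 + real L)"
proof -
  have "real ((m + 2) * (1 + (2 * k + L)) + 1) = real (m + 2) * (1 + 2 * real k + real L) + 1"
    by (simp add: algebra_simps)
  also have "\<dots> \<le> real (m + 2) * (1 + 2 * (log 2 (real n) + 1) + real L) + 1"
    using le_log_of_power[OF assms] by (intro add_mono mult_left_mono) auto
  also have "\<dots> \<le> real (m + 2) * (2 * log 2 (real n) + 5 + real L)"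
    by (simp add: algebra_simps)
  finally show ?thesis .
qed

text \<open>The middle term may be negative, so that even n weights need an argument: as log2 7 >=
  2, the first term is at least 168 (N - 1) n^2, which outweighs 14 N n^2 for N >= 2.\<close>

lemma constant_weight_bound:
  fixes n M L N :: nat
  assumes "1 \<le> n" "2 \<le> N"
  shows "real n \<le> 14 * real n powr log 2 7 * (real N - 1) * (real M + 12)
     + real n ^ 2 * (real L - 14 * real N + 20 + 2 * log 2 (real n)) + real n * (real N + 1)"
proof -
  have "log 2 (2 ^ 2) \<le> log 2 (7::real)" by (subst log_le_cancel_iff) auto
  then have "2 \<le> log 2 (7::real)" by (subst (asm) log_nat_power) auto
  then have "real n powr 2 \<le> real n powr log 2 7" using assms(1) by (intro powr_mono) auto
  then have W: "(real n)\<^sup>2 \<le> real n powr log 2 7" using assms(1) by simp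
  have "14 * (real n)\<^sup>2 * (real N - 1) * 12 \<le> 14 * real n powr log 2 7 * (real N - 1) * (real M + 12)"
    using assms W by (intro mult_mono) auto
  moreover have "(real n)\<^sup>2 * (- 14 * real N) \<le>
      real n ^ 2 * (real L - 14 * real N + 20 + 2 * log 2 (real n))"
    using assms by (intro mult_left_mono) auto
  moreover have "0 \<le> (real n)\<^sup>2 * (154 * real N - 168)"
    using assms by (intro mult_nonneg_nonneg) auto
  moreover have "real n * 1 \<le> real n * (real N + 1)" by (intro mult_left_mono) auto
  moreover have "14 * (real n)\<^sup>2 * (real N - 1) * 12 + (real n)\<^sup>2 * (- 14 * real N) =
      (real n)\<^sup>2 * (154 * real N - 168)" by (simp add: algebra_simps)
  ultimately show ?thesis by linarith
qed

section \<open>The inversion network\<close>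

text \<open>The map sending A to a A + b I. It is written out because the case N = 1 demands an
  exact number of weights, whereas \<open>realizes\<close> only bounds it.\<close>

definition diag_layer :: "nat \<Rightarrow> real \<Rightarrow> real \<Rightarrow> tensor \<times> real mat \<times> (real \<Rightarrow> real) mat" where
  "diag_layer n a b = (mat n n (\<lambda>ij. mat n n (\<lambda>kl. if kl = ij then a else 0)),
     mat n n (\<lambda>(i, j). if i = j then b else 0), mat n n (\<lambda>_. id))"

lemma chain_diag_layer: "0 < n \<Longrightarrow> chain \<rho> (n, n) (n, n) [diag_layer n a b]"
  by (auto simp: fits_layer_def diag_layer_def carrier_tensor_def)

lemma last_diag_layer: "i < n \<Longrightarrow> j < n \<Longrightarrow> snd (snd (diag_layer n a b)) $$ (i,j) = id"
  by (simp add: diag_layer_def)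

lemma num_weights_diag_layer:
  "num_weights [diag_layer n a b] = (if a = 0 then 0 else n\<^sup>2) + (if b = 0 then 0 else n)"
proof -
  let ?T = "mat n n (\<lambda>ij. mat n n (\<lambda>kl. if kl = ij then a else 0)) :: tensor"
  let ?C = "mat n n (\<lambda>(i, j). if i = j then b else 0) :: real mat"
  have "{(i,j,k,l). i < dim_row ?T \<and> j < dim_col ?T \<and> k < dim_row (?T $$ (i,j)) \<and>
      l < dim_col (?T $$ (i,j)) \<and> ?T $$ (i,j) $$ (k,l) \<noteq> 0} =
      (if a = 0 then {} else (\<lambda>(i, j). (i, j, i, j)) ` ({..<n} \<times> {..<n}))"
    by (force split: if_splits)
  then have "nonzeros_tensor ?T = card (if a = 0 then {} else (\<lambda>(i, j). (i, j, i, j)) ` ({..<n} \<times> {..<n}))"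
    unfolding nonzeros_tensor_def by simp
  also have "\<dots> = (if a = 0 then 0 else n\<^sup>2)"
    by (auto simp: card_image inj_on_def power2_eq_square)
  finally have "nonzeros_tensor ?T = (if a = 0 then 0 else n\<^sup>2)" .
  moreover have "{(i,j). i < dim_row ?C \<and> j < dim_col ?C \<and> ?C $$ (i,j) \<noteq> 0} =
      (if b = 0 then {} else (\<lambda>i. (i, i)) ` {..<n})"
    by (force split: if_splits)
  then have "nonzeros_mat ?C = (if b = 0 then 0 else n)"
    unfolding nonzeros_mat_def by (simp add: card_image inj_on_def)
  ultimately show ?thesis by (simp add: num_weights_def diag_layer_def)
qed

lemma realization_diag_layer:
  assumes "A \<in> carrier_mat n n"
  shows "realization [diag_layer n a b] A = mat n n (\<lambda>(i, j). a * A $$ (i,j) + b * idm i j)"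
proof (intro eq_matI)
  fix i j assume "i < dim_row (mat n n (\<lambda>(i, j). a * A $$ (i,j) + b * idm i j))"
    "j < dim_col (mat n n (\<lambda>(i, j). a * A $$ (i,j) + b * idm i j))"
  then have ij: "i < n" "j < n" by simp_all
  let ?T = "mat n n (\<lambda>kl. if kl = (i,j) then a else 0)"
  have "(\<Sum>k<n. \<Sum>l<n. ?T $$ (k,l) * A $$ (k,l)) = (\<Sum>k<n. \<Sum>l<n. if k = i \<and> l = j then a * A $$ (k,l) else 0)"
    by (intro sum.cong refl) simp
  also have "\<dots> = (\<Sum>k<n. if k = i then a * A $$ (k,j) else 0)"
    using ij by (intro sum.cong refl) simp
  also have "\<dots> = a * A $$ (i,j)" using ij by simp
  finally have "(\<Sum>k<n. \<Sum>l<n. ?T $$ (k,l) * A $$ (k,l)) = a * A $$ (i,j)" .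
  then show "realization [diag_layer n a b] A $$ (i,j) =
      mat n n (\<lambda>(i, j). a * A $$ (i,j) + b * idm i j) $$ (i,j)"
    using ij assms by (simp add: realization_def diag_layer_def act_apply_def tensor_apply_def idm_def)
qed (use assms in \<open>simp_all add: realization_def diag_layer_def act_apply_def tensor_apply_def\<close>)

section \<open>Networks for the three regimes\<close>

lemma entries_one_minus_smult:
  assumes "A \<in> carrier_mat n n" "i < n" "j < n"
  shows "(1\<^sub>m n - \<alpha> \<cdot>\<^sub>m A) $$ (i,j) = idm i j - \<alpha> * A $$ (i,j)"
  using assms by (simp add: idm_def)

lemma opb_of_mat_norm2_le:
  assumes "A \<in> carrier_mat n n" "mat_norm2 (1\<^sub>m n - \<alpha> \<cdot>\<^sub>m A) \<le> \<delta>"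
  shows "opb n (\<lambda>i j. idm i j - \<alpha> * A $$ (i,j)) \<delta>"
proof -
  have "1\<^sub>m n - \<alpha> \<cdot>\<^sub>m A \<in> carrier_mat n n" using assms(1) by (intro minus_carrier_mat) auto
  from opb_mono[OF opb_mat_norm2[OF this] assms(2)] show ?thesis
    by (rule iffD1[OF opb_cong, rotated]) (rule entries_one_minus_smult[OF assms(1)])
qed

lemma mat_norm2_diff_le:
  assumes "B \<in> carrier_mat n n" "R \<in> carrier_mat n n" "opb n (\<lambda>i j. B $$ (i,j) - R $$ (i,j)) c" "0 \<le> c"
  shows "mat_norm2 (B - R) \<le> c"
proof (rule mat_norm2_le)
  show "B - R \<in> carrier_mat n n" using assms(2) by (rule minus_carrier_mat)
  show "opb n (entries (B - R)) c"
    by (rule iffD1[OF opb_cong assms(3)]) (use assms(1,2) in auto)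
qed (rule assms(4))

lemma inverse_approximation:
  assumes "\<delta> < 1" "0 \<le> \<epsilon>"
    and carrier: "\<And>A. A \<in> carrier_mat n n \<Longrightarrow> realization \<Phi> A \<in> carrier_mat n n"
    and approx: "\<And>A B. A \<in> carrier_mat n n \<Longrightarrow> B \<in> carrier_mat n n \<Longrightarrow> inverts_mat A B \<Longrightarrow>
      inverts_mat B A \<Longrightarrow> opb n (\<lambda>i j. idm i j - \<alpha> * A $$ (i,j)) \<delta> \<Longrightarrow>
      opb n (\<lambda>i j. B $$ (i,j) - realization \<Phi> A $$ (i,j)) \<epsilon>"
  shows "\<forall>A \<in> carrier_mat n n. mat_norm2 (1\<^sub>m n - \<alpha> \<cdot>\<^sub>m A) \<le> \<delta> \<longrightarrow>
      (\<exists>B \<in> carrier_mat n n. inverts_mat A B \<and> inverts_mat B A \<and>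
         mat_norm2 (B - realization \<Phi> A) \<le> \<epsilon>)"
proof (intro ballI impI)
  fix A :: "real mat" assume A: "A \<in> carrier_mat n n" "mat_norm2 (1\<^sub>m n - \<alpha> \<cdot>\<^sub>m A) \<le> \<delta>"
  note X = opb_of_mat_norm2_le[OF A]
  obtain B where B: "B \<in> carrier_mat n n" "inverts_mat A B" "inverts_mat B A"
    using ex_inverse[OF A(1) X assms(1)] .
  show "\<exists>B \<in> carrier_mat n n. inverts_mat A B \<and> inverts_mat B A \<and>
         mat_norm2 (B - realization \<Phi> A) \<le> \<epsilon>"
    using B mat_norm2_diff_le[OF B(1) carrier[OF A(1)] approx[OF A(1) B X] assms(2)] by blast
qed

text \<open>The radius in \<open>opb_constant\<close> is |alpha|/(1 - delta) times delta/(1 + delta)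
  <= 1/2, and \<open>e\<close> says that |alpha|/(2 (1 - delta)) <= eps. The coefficient 0 on A
  leaves only the n diagonal biases.\<close>

lemma constant_mnn:
  fixes \<rho> :: "real \<Rightarrow> real"
  assumes "0 < \<epsilon>" "0 < \<delta>" "\<delta> < 1" "1 \<le> n" and e: "1/2 \<le> \<epsilon> / \<bar>\<alpha>\<bar> * (1 - \<delta>)"
  obtains \<Phi> where "is_mnn \<rho> (n, n) (n, n) \<Phi>" "num_weights \<Phi> \<le> n" "length \<Phi> = 1"
    "\<forall>A \<in> carrier_mat n n. mat_norm2 (1\<^sub>m n - \<alpha> \<cdot>\<^sub>m A) \<le> \<delta> \<longrightarrow>
      (\<exists>B \<in> carrier_mat n n. inverts_mat A B \<and> inverts_mat B A \<and>
         mat_norm2 (B - realization \<Phi> A) \<le> \<epsilon>)"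
proof -
  let ?t = "\<alpha> / (1 - \<delta>\<^sup>2)"
  let ?\<Phi> = "[diag_layer n 0 ?t]"
  \<comment> \<open>Division by zero yields 0, which \<open>e\<close> rules out.\<close>
  have \<alpha>: "\<alpha> \<noteq> 0" using e by auto
  have "1 - \<delta>\<^sup>2 = (1 - \<delta>) * (1 + \<delta>)" by (simp add: algebra_simps power2_eq_square)
  then have "\<bar>\<alpha>\<bar> * \<delta> / (1 - \<delta>\<^sup>2) = \<bar>\<alpha>\<bar> / (1 - \<delta>) * (\<delta> / (1 + \<delta>))" by simp
  also have "\<dots> \<le> \<bar>\<alpha>\<bar> / (1 - \<delta>) * (1/2)"
    using assms(2,3) by (intro mult_left_mono) (auto simp: field_simps)
  also have "\<dots> \<le> \<epsilon>" using e \<alpha> assms(3) by (simp add: field_simps)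
  finally have bound: "\<bar>\<alpha>\<bar> * \<delta> / (1 - \<delta>\<^sup>2) \<le> \<epsilon>" .
  show ?thesis
  proof (rule that[of ?\<Phi>])
    show "is_mnn \<rho> (n, n) (n, n) ?\<Phi>"
      using assms(4) by (intro chain_imp_is_mnn[OF chain_diag_layer]) (auto simp: last_diag_layer)
    show "num_weights ?\<Phi> \<le> n" by (simp add: num_weights_diag_layer)
    show "\<forall>A \<in> carrier_mat n n. mat_norm2 (1\<^sub>m n - \<alpha> \<cdot>\<^sub>m A) \<le> \<delta> \<longrightarrow>
      (\<exists>B \<in> carrier_mat n n. inverts_mat A B \<and> inverts_mat B A \<and>
         mat_norm2 (B - realization ?\<Phi> A) \<le> \<epsilon>)"
    proof (rule inverse_approximation[OF assms(3)])
      fix A B :: "real mat" assume A: "A \<in> carrier_mat n n"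
      then show "realization ?\<Phi> A \<in> carrier_mat n n" by (simp add: realization_diag_layer)
      assume B: "B \<in> carrier_mat n n" "inverts_mat A B" "inverts_mat B A"
        "opb n (\<lambda>i j. idm i j - \<alpha> * A $$ (i,j)) \<delta>"
      have "opb n (\<lambda>i j. B $$ (i,j) - ?t * idm i j) \<epsilon>"
        using opb_mono[OF opb_constant[OF A B(1-3) refl B(4)] bound] assms(2,3) by simp
      then show "opb n (\<lambda>i j. B $$ (i,j) - realization ?\<Phi> A $$ (i,j)) \<epsilon>"
        by (rule iffD1[OF opb_cong, rotated]) (simp add: realization_diag_layer[OF A])
    qed (use assms(1) in simp)
  qed simp
qed

lemma truncation_le:
  fixes \<alpha> \<delta> \<epsilon> d :: real
  assumes "d \<le> \<epsilon> / (2 * \<bar>\<alpha>\<bar>) * (1 - \<delta>)" "\<delta> < 1" "\<alpha> \<noteq> 0"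
  shows "\<bar>\<alpha>\<bar> / (1 - \<delta>) * d \<le> \<epsilon> / 2"
proof -
  have "\<bar>\<alpha>\<bar> / (1 - \<delta>) * d \<le> \<bar>\<alpha>\<bar> / (1 - \<delta>) * (\<epsilon> / (2 * \<bar>\<alpha>\<bar>) * (1 - \<delta>))"
    using assms by (intro mult_left_mono) auto
  also have "\<dots> = \<epsilon> / 2" using assms(2,3) by (simp add: field_simps)
  finally show ?thesis .
qed

text \<open>For N = 1 the partial sum is alpha (I + X). The first layer forms X = I - alpha A and
  the second alpha X + alpha I, each with a full diagonal tensor and a full diagonal bias as alpha
  is nonzero; this realizes the prescribed counts exactly.\<close>

lemma two_layer_mnn:
  fixes \<rho> :: "real \<Rightarrow> real"
  assumes "0 < \<epsilon>" "0 < \<delta>" "\<delta> < 1" "1 \<le> n" "\<alpha> \<noteq> 0" and N: "N_inv (\<epsilon> / (2 * \<bar>\<alpha>\<bar>)) \<delta> = 1"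
  obtains \<Phi> where "is_mnn \<rho> (n, n) (n, n) \<Phi>" "num_weights \<Phi> = 2 * (n\<^sup>2 + n)" "length \<Phi> = 2"
    "\<forall>A \<in> carrier_mat n n. mat_norm2 (1\<^sub>m n - \<alpha> \<cdot>\<^sub>m A) \<le> \<delta> \<longrightarrow>
      (\<exists>B \<in> carrier_mat n n. inverts_mat A B \<and> inverts_mat B A \<and>
         mat_norm2 (B - realization \<Phi> A) \<le> \<epsilon>)"
proof -
  let ?\<Phi> = "[diag_layer n (- \<alpha>) 1] @ [diag_layer n \<alpha> \<alpha>]"
  have "\<delta> ^ 2 ^ 1 \<le> \<epsilon> / (2 * \<bar>\<alpha>\<bar>) * (1 - \<delta>)"
    using N_inv_power[of "\<epsilon> / (2 * \<bar>\<alpha>\<bar>)" \<delta>] assms(1-3,5) unfolding N by simp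
  from truncation_le[OF this assms(3,5)]
  have bound: "\<bar>\<alpha>\<bar> / (1 - \<delta>) * \<delta> ^ 2 ^ 1 \<le> \<epsilon>" using assms(1) by linarith
  show ?thesis
  proof (rule that[of ?\<Phi>])
    show "is_mnn \<rho> (n, n) (n, n) ?\<Phi>"
      using assms(4) by (intro chain_imp_is_mnn chain_append[OF chain_diag_layer chain_diag_layer])
        (auto simp: last_diag_layer)
    show "num_weights ?\<Phi> = 2 * (n\<^sup>2 + n)"
      unfolding num_weights_append num_weights_diag_layer using assms(5) by simp
    show "\<forall>A \<in> carrier_mat n n. mat_norm2 (1\<^sub>m n - \<alpha> \<cdot>\<^sub>m A) \<le> \<delta> \<longrightarrow>
      (\<exists>B \<in> carrier_mat n n. inverts_mat A B \<and> inverts_mat B A \<and>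
         mat_norm2 (B - realization ?\<Phi> A) \<le> \<epsilon>)"
    proof (rule inverse_approximation[OF assms(3)])
      fix A B :: "real mat" assume A: "A \<in> carrier_mat n n"
      let ?X = "\<lambda>i j. idm i j - \<alpha> * A $$ (i,j)"
      have R: "realization ?\<Phi> A = mat n n (\<lambda>(i, j). \<alpha> * ?X i j + \<alpha> * idm i j)"
        unfolding realization_append realization_diag_layer[OF A]
        by (subst realization_diag_layer) auto
      then show "realization ?\<Phi> A \<in> carrier_mat n n" by simp
      assume B: "B \<in> carrier_mat n n" "inverts_mat A B" "inverts_mat B A" "opb n ?X \<delta>"
      have "opb n (\<lambda>i j. B $$ (i,j) - \<alpha> * 2 ^ 1 * Tm n ?X 1 i j) \<epsilon>"
        using opb_mono[OF opb_truncation[OF A B(1-3) refl B(4)] bound] assms(2,3) by simp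
      then show "opb n (\<lambda>i j. B $$ (i,j) - realization ?\<Phi> A $$ (i,j)) \<epsilon>"
        by (rule iffD1[OF opb_cong, rotated], unfold R)
          (simp add: mm_idm_left half_step_def algebra_simps)
    qed (use assms(1) in simp)
  qed simp
qed

text \<open>The error budget: N is taken at eps/(2 |alpha|), so truncation costs eps/2, and
  \<open>Sigma_inv_bounds\<close> leaves eps/2 for inexact products.\<close>

lemma iterated_mnn:
  fixes \<rho> :: "real \<Rightarrow> real" and \<Psi> :: "real \<Rightarrow> real \<Rightarrow> mnn" and \<epsilon> \<alpha> \<delta> :: real and n m :: nat
  defines "P \<equiv> \<Psi> (Sigma_inv (\<epsilon> / \<bar>\<alpha>\<bar>) \<delta> n) (2 * real n)"
  assumes \<Psi>: "product_hypothesis \<rho> \<Psi>" and "0 < \<epsilon>" "0 < \<delta>" "\<delta> < 1" "1 \<le> n" "\<alpha> \<noteq> 0"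
    and N: "N_inv (\<epsilon> / (2 * \<bar>\<alpha>\<bar>)) \<delta> = m + 2" and e: "\<epsilon> / \<bar>\<alpha>\<bar> * (1 - \<delta>) \<le> 1/2"
  obtains \<Phi> where "is_mnn \<rho> (n, n) (n, n) \<Phi>"
    "real (num_weights \<Phi>) \<le> 14 * real n powr log 2 7 * (real (m + 2) - 1) * (real (num_weights P) + 12)
     + real n ^ 2 * (real (length P) - 14 * real (m + 2) + 20 + 2 * log 2 (real n)) + real n * (real (m + 2) + 1)"
    "real (length \<Phi>) \<le> real (m + 2) * (2 * log 2 (real n) + 5 + real (length P))"
    "\<forall>A \<in> carrier_mat n n. mat_norm2 (1\<^sub>m n - \<alpha> \<cdot>\<^sub>m A) \<le> \<delta> \<longrightarrow>
      (\<exists>B \<in> carrier_mat n n. inverts_mat A B \<and> inverts_mat B A \<and>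
         mat_norm2 (B - realization \<Phi> A) \<le> \<epsilon>)"
proof -
  let ?e = "\<epsilon> / \<bar>\<alpha>\<bar>"
  let ?\<sigma> = "Sigma_inv ?e \<delta> n"
  have e0: "0 < ?e" using assms by simp
  have half: "?e / 2 = \<epsilon> / (2 * \<bar>\<alpha>\<bar>)" by simp
  obtain k where k: "n \<le> 2 ^ k" "(2::nat) ^ k \<le> 2 * n" using ex_two_power[OF \<open>1 \<le> n\<close>] by blast
  let ?\<eta> = "real n * (4 ^ k * ?\<sigma>)" and ?q = "max \<delta> (1/2)"
  have \<sigma>: "0 < ?\<sigma>" using e0 \<open>1 \<le> n\<close> by (simp add: Sigma_inv_def)
  have "is_mnn \<rho> (1, 2) (1, 1) P \<and> (\<forall>x\<in>{-(2 * real n)..2 * real n}. \<forall>y\<in>{-(2 * real n)..2 * real n}.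
         \<bar>x * y - realization P (mat_of_rows_list 2 [[x, y]]) $$ (0,0)\<bar> \<le> ?\<sigma>)"
    using \<Psi>[unfolded product_hypothesis_def] \<sigma> \<open>1 \<le> n\<close> unfolding P_def by simp
  then have P: "is_mnn \<rho> (1, 2) (1, 1) P"
    and PK: "\<And>x y. \<bar>x\<bar> \<le> 2 * real n \<Longrightarrow> \<bar>y\<bar> \<le> 2 * real n \<Longrightarrow>
      \<bar>realization P (mat_of_rows_list 2 [[x, y]]) $$ (0,0) - x * y\<bar> \<le> ?\<sigma>"
    by (auto simp: abs_le_iff abs_minus_commute)
  interpret neumann_net \<rho> P n k ?\<sigma> \<delta> \<alpha> ?q ?\<eta>
    using P PK k \<open>1 \<le> n\<close> \<open>0 < \<delta>\<close> \<open>\<delta> < 1\<close> Sigma_inv_bounds(1)[OF e0 \<open>0 < \<delta>\<close> \<open>\<delta> < 1\<close> e \<open>1 \<le> n\<close> k(2)]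
    by unfold_locales auto
  obtain \<Phi> where \<Phi>: "is_mnn \<rho> (n, n) (n, n) \<Phi>"
    "length \<Phi> = (m + 2) * (1 + (2 * k + length P)) + 1"
    "num_weights \<Phi> \<le> 3 * (n\<^sup>2 + n) + (Q + n\<^sup>2 * (2 * k + length P)) + m * (4 * n\<^sup>2 + n + 2 * Q) +
       (2 * n\<^sup>2 + n + Q) + n\<^sup>2"
    "\<forall>A\<in>carrier_mat n n. realization \<Phi> A \<in> carrier_mat n n"
    "\<forall>A\<in>carrier_mat n n. opb n (resid (\<lambda>ij. A $$ ij)) \<delta> \<longrightarrow>
       opb n (\<lambda>i j. realization \<Phi> A $$ (i,j) - \<alpha> * 2 ^ (m + 2) * Tm n (resid (\<lambda>ij. A $$ ij)) (m + 2) i j)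
         (\<bar>\<alpha>\<bar> * 2 ^ (m + 2) * ((2 ^ (m + 1) - 1 + (real m + 1) / 2) * ?\<eta>))"
    by (rule neumann_mnn[of m]) (rule that)
  have err: "\<bar>\<alpha>\<bar> * 2 ^ (m + 2) * ((2 ^ (m + 1) - 1 + (real m + 1) / 2) * ?\<eta>) \<le> \<epsilon> / 2"
  proof -
    have "\<bar>\<alpha>\<bar> * (2 ^ (m + 2) * ((2 ^ (m + 1) - 1 + (real m + 1) / 2) * ?\<eta>)) \<le> \<bar>\<alpha>\<bar> * (?e / 2)"
      using Sigma_inv_bounds(2)[OF e0 \<open>0 < \<delta>\<close> \<open>\<delta> < 1\<close> e \<open>1 \<le> n\<close> k(2), unfolded half, OF N]
      unfolding half by (rule mult_left_mono) simp
    then show ?thesis using \<open>\<alpha> \<noteq> 0\<close> by (simp add: mult.assoc)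
  qed
  have "\<delta> ^ 2 ^ (m + 2) \<le> \<epsilon> / (2 * \<bar>\<alpha>\<bar>) * (1 - \<delta>)"
    using N_inv_power[of "\<epsilon> / (2 * \<bar>\<alpha>\<bar>)" \<delta>] \<open>0 < \<epsilon>\<close> \<open>0 < \<delta>\<close> \<open>\<delta> < 1\<close> \<open>\<alpha> \<noteq> 0\<close> unfolding N by simp
  note trunc = truncation_le[OF this \<open>\<delta> < 1\<close> \<open>\<alpha> \<noteq> 0\<close>]
  show ?thesis
  proof (rule that[OF \<Phi>(1) weight_bound[OF \<open>1 \<le> n\<close> k \<Phi>(3)]])
    show "real (length \<Phi>) \<le> real (m + 2) * (2 * log 2 (real n) + 5 + real (length P))"
      unfolding \<Phi>(2) by (rule layer_bound[OF \<open>1 \<le> n\<close> k(2)])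
    show "\<forall>A \<in> carrier_mat n n. mat_norm2 (1\<^sub>m n - \<alpha> \<cdot>\<^sub>m A) \<le> \<delta> \<longrightarrow>
      (\<exists>B \<in> carrier_mat n n. inverts_mat A B \<and> inverts_mat B A \<and>
         mat_norm2 (B - realization \<Phi> A) \<le> \<epsilon>)"
    proof (rule inverse_approximation[OF \<open>\<delta> < 1\<close> _ \<Phi>(4)[rule_format]])
      fix A B :: "real mat" assume A: "A \<in> carrier_mat n n"
        and B: "B \<in> carrier_mat n n" "inverts_mat A B" "inverts_mat B A"
        and X: "opb n (\<lambda>i j. idm i j - \<alpha> * A $$ (i,j)) \<delta>"
      let ?X = "\<lambda>i j. idm i j - \<alpha> * A $$ (i,j)"
      have r: "resid (\<lambda>ij. A $$ ij) = ?X" by (simp add: resid_def fun_eq_iff)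
      have "opb n (\<lambda>i j. B $$ (i,j) - \<alpha> * 2 ^ (m + 2) * Tm n ?X (m + 2) i j) (\<epsilon> / 2)"
        using opb_mono[OF opb_truncation[OF A B refl X] trunc] \<open>0 < \<delta>\<close> \<open>\<delta> < 1\<close> by simp
      from opb_diff[OF this opb_mono[OF \<Phi>(5)[rule_format, OF A, unfolded r, OF X] err]]
      show "opb n (\<lambda>i j. B $$ (i,j) - realization \<Phi> A $$ (i,j)) \<epsilon>"
        by simp
    qed (use \<open>0 < \<epsilon>\<close> in simp_all)
  qed
qed

theorem theorem4p2:
  fixes \<rho> :: "real \<Rightarrow> real" and \<Psi> :: "real \<Rightarrow> real \<Rightarrow> mnn"
    and \<epsilon> \<alpha> \<delta> :: real and n :: nat
  assumes "product_hypothesis \<rho> \<Psi>"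
    and "\<epsilon> > 0" and "0 < \<delta>" and "\<delta> < 1" and "n \<ge> 1"
  shows "\<exists>\<Phi>. is_mnn \<rho> (n, n) (n, n) \<Phi> \<and>
    (\<forall>A \<in> carrier_mat n n. mat_norm2 (1\<^sub>m n - \<alpha> \<cdot>\<^sub>m A) \<le> \<delta> \<longrightarrow>
      (\<exists>B \<in> carrier_mat n n. inverts_mat A B \<and> inverts_mat B A \<and>
         mat_norm2 (B - realization \<Phi> A) \<le> \<epsilon>)) \<and>
    (\<alpha> > 0 \<longrightarrow>
      (let N = N_inv (\<epsilon> / (2 * \<alpha>)) \<delta>;
           P = \<Psi> (Sigma_inv (\<epsilon> / \<alpha>) \<delta> n) (2 * real n)
       in
        (N \<ge> 2 \<longrightarrow>
          real (num_weights \<Phi>) \<le>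
            14 * real n powr log 2 7 * (real N - 1) * (real (num_weights P) + 12)
            + real n ^ 2 * (real (num_layers P) - 14 * real N + 20 + 2 * log 2 (real n))
            + real n * (real N + 1) \<and>
          real (num_layers \<Phi>) \<le>
            real N * (2 * log 2 (real n) + 5 + real (num_layers P))) \<and>
        (N = 1 \<longrightarrow>
          num_weights \<Phi> = 2 * (n ^ 2 + n) \<and> num_layers \<Phi> = 2)))"
proof (cases "\<alpha> = 0")
  case True
  \<comment> \<open>For alpha = 0 the hypothesis on A says that I has norm at most delta < 1, which
    its entry (0, 0) refutes. Any network of the right shape will do.\<close>
  have "is_mnn \<rho> (n, n) (n, n) [diag_layer n 0 0]"
    using assms(5) by (intro chain_imp_is_mnn[OF chain_diag_layer]) (auto simp: last_diag_layer)
  moreover have "\<not> mat_norm2 (1\<^sub>m n - \<alpha> \<cdot>\<^sub>m A) \<le> \<delta>" if A: "A \<in> carrier_mat n n" for A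
  proof
    assume "mat_norm2 (1\<^sub>m n - \<alpha> \<cdot>\<^sub>m A) \<le> \<delta>"
    from opb_entry[OF opb_of_mat_norm2_le[OF A this], of 0 0] show False
      using assms(4,5) True by (simp add: idm_def)
  qed
  ultimately show ?thesis using True by (intro exI[of _ "[diag_layer n 0 0]"]) simp
next
  case False
  \<comment> \<open>With |alpha| the same argument treats negative alpha; for alpha > 0 these are
    the quantities of the stated bounds.\<close>
  define N where "N = N_inv (\<epsilon> / (2 * \<bar>\<alpha>\<bar>)) \<delta>"
  define P where "P = \<Psi> (Sigma_inv (\<epsilon> / \<bar>\<alpha>\<bar>) \<delta> n) (2 * real n)"
  define good where "good \<Phi> \<longleftrightarrow> is_mnn \<rho> (n, n) (n, n) \<Phi> \<and>
    (\<forall>A \<in> carrier_mat n n. mat_norm2 (1\<^sub>m n - \<alpha> \<cdot>\<^sub>m A) \<le> \<delta> \<longrightarrow>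
      (\<exists>B \<in> carrier_mat n n. inverts_mat A B \<and> inverts_mat B A \<and>
         mat_norm2 (B - realization \<Phi> A) \<le> \<epsilon>))" for \<Phi>
  have "1 \<le> N" by (simp only: N_def N_inv_ge_1)
  have "\<exists>\<Phi>. good \<Phi> \<and>
      (N \<ge> 2 \<longrightarrow>
          real (num_weights \<Phi>) \<le>
            14 * real n powr log 2 7 * (real N - 1) * (real (num_weights P) + 12)
            + real n ^ 2 * (real (length P) - 14 * real N + 20 + 2 * log 2 (real n))
            + real n * (real N + 1) \<and>
          real (length \<Phi>) \<le> real N * (2 * log 2 (real n) + 5 + real (length P))) \<and>
        (N = 1 \<longrightarrow> num_weights \<Phi> = 2 * (n ^ 2 + n) \<and> length \<Phi> = 2)"
  proof (cases "N = 1")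
    case True
    with two_layer_mnn[OF assms(2-5) False, of \<rho>] obtain \<Phi> where
      "good \<Phi>" "num_weights \<Phi> = 2 * (n\<^sup>2 + n)" "length \<Phi> = 2"
      unfolding good_def N_def by metis
    with True show ?thesis by (intro exI[of _ \<Phi>]) simp
  next
    case N1: False
    then obtain m where m: "N = m + 2"
      using \<open>1 \<le> N\<close> by (metis One_nat_def Suc_1 add.commute le_SucE le_add_diff_inverse not_less_eq_eq)
    show ?thesis
    proof (cases "\<epsilon> / \<bar>\<alpha>\<bar> * (1 - \<delta>) \<le> 1/2")
      case True
      with iterated_mnn[OF assms False _ True, of m] m obtain \<Phi> where "good \<Phi>"
        "real (num_weights \<Phi>) \<le> 14 * real n powr log 2 7 * (real N - 1) * (real (num_weights P) + 12)
         + real n ^ 2 * (real (length P) - 14 * real N + 20 + 2 * log 2 (real n)) + real n * (real N + 1)"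
        "real (length \<Phi>) \<le> real N * (2 * log 2 (real n) + 5 + real (length P))"
        unfolding good_def N_def[symmetric] P_def[symmetric] by metis
      with N1 show ?thesis by blast
    next
      case c: False
      then have "1/2 \<le> \<epsilon> / \<bar>\<alpha>\<bar> * (1 - \<delta>)" by simp
      with constant_mnn[OF assms(2-5), of \<alpha> \<rho>] obtain \<Phi> where \<Phi>: "good \<Phi>"
        "num_weights \<Phi> \<le> n" "length \<Phi> = 1"
        unfolding good_def by metis
      have "2 \<le> N" using m by simp
      have "real (num_weights \<Phi>) \<le> real n" using \<Phi>(2) by simp
      also note constant_weight_bound[OF assms(5) \<open>2 \<le> N\<close>, of "num_weights P" "length P"]
      finally have w: "real (num_weights \<Phi>) \<le> 14 * real n powr log 2 7 * (real N - 1) * (real (num_weights P) + 12)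
         + real n ^ 2 * (real (length P) - 14 * real N + 20 + 2 * log 2 (real n)) + real n * (real N + 1)" .
      have "1 * 5 \<le> real N * (2 * log 2 (real n) + 5 + real (length P))"
        using \<open>2 \<le> N\<close> assms(5) by (intro mult_mono) auto
      then have "real (length \<Phi>) \<le> real N * (2 * log 2 (real n) + 5 + real (length P))"
        using \<Phi>(3) by simp
      with w \<Phi>(1) N1 show ?thesis by blast
    qed
  qed
  then obtain \<Phi> where \<Phi>: "good \<Phi>"
    "N \<ge> 2 \<longrightarrow>
          real (num_weights \<Phi>) \<le>
            14 * real n powr log 2 7 * (real N - 1) * (real (num_weights P) + 12)
            + real n ^ 2 * (real (length P) - 14 * real N + 20 + 2 * log 2 (real n))
            + real n * (real N + 1) \<and>
          real (length \<Phi>) \<le> real N * (2 * log 2 (real n) + 5 + real (length P))"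
    "N = 1 \<longrightarrow> num_weights \<Phi> = 2 * (n ^ 2 + n) \<and> length \<Phi> = 2"
    by blast
  have eqs: "N_inv (\<epsilon> / (2 * \<alpha>)) \<delta> = N" "\<Psi> (Sigma_inv (\<epsilon> / \<alpha>) \<delta> n) (2 * real n) = P" if "0 < \<alpha>"
    using that by (simp_all add: N_def P_def)
  show ?thesis
  proof (rule exI[of _ \<Phi>], use \<Phi>(1) in \<open>unfold good_def, elim conjE, intro conjI impI\<close>)
    assume "0 < \<alpha>"
    show "let N = N_inv (\<epsilon> / (2 * \<alpha>)) \<delta>;
           P = \<Psi> (Sigma_inv (\<epsilon> / \<alpha>) \<delta> n) (2 * real n)
       in
        (N \<ge> 2 \<longrightarrow>
          real (num_weights \<Phi>) \<le>
            14 * real n powr log 2 7 * (real N - 1) * (real (num_weights P) + 12)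
            + real n ^ 2 * (real (num_layers P) - 14 * real N + 20 + 2 * log 2 (real n))
            + real n * (real N + 1) \<and>
          real (num_layers \<Phi>) \<le>
            real N * (2 * log 2 (real n) + 5 + real (num_layers P))) \<and>
        (N = 1 \<longrightarrow>
          num_weights \<Phi> = 2 * (n ^ 2 + n) \<and> num_layers \<Phi> = 2)"
      unfolding Let_def num_layers_def eqs[OF \<open>0 < \<alpha>\<close>] by (rule conjI[OF \<Phi>(2,3)])
  qed
qed

end
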